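(* Let $B\subseteq A$ be a principal $H$-comodule algebra such that $H$ is commutative. Then $\mathrm{flip}_A$ (restricted to $\mathcal{C}(A,H)$) is an antipode for the Ehresmann–Schauenburg bialgebroid $\mathcal{C}(A,H)$.
   Context: $\mathbb{K}$ is a field, algebras are unital associative over $\mathbb{K}$, $\otimes=\otimes_{\mathbb{K}}$. Sweedler-type notations and expressions such as $a\otimes\tilde a$ denote sums. $\mathrm{flip}_A:A\otimes A\to A\otimes A$ is the linear map $a\otimes\tilde a\mapsto\tilde a\otimes a$. **Principal comodule algebras.** $H$ is a Hopf algebra with bijective antipode $S$; $A$ is a right $H$-comodule algebra, i.e. an algebra with a right coaction $\rho:A\to A\otimes H$, $\rho(a)=a_{(0)}\otimes a_{(1)}$, that is an algebra morphism; $B=A^{coH}=\{a\in A\mid\rho(a)=a\otimes1_H\}$. $B\subseteq A$ is an $H$-Hopf–Galois extension if the canonical map $\chi:A\otimes_BA\to A\otimes H$, $a\otimes_B\tilde a\mapsto a\tilde a_{(0)}\otimes\tilde a_{(1)}$, is bijective; it is a principal $H$-comodule algebra if moreover $A$ is faithfully flat as a left $B$-module. The translation map is $\tau:H\to A\otimes_BA$, $\tau(h)=\chi^{-1}(1_A\otimes h)=h^{\langle1\rangle}\otimes_Bh^{\langle2\rangle}$. **Ehresmann–Schauenburg bialgebroid.** $$\mathcal{C}(A,H)=\{a\otimes\tilde a\in A\otimes A\mid a_{(0)}\otimes a_{(1)}{}^{\langle1\rangle}\otimes_Ba_{(1)}{}^{\langle2\rangle}\tilde a=a\otimes\tilde a\otimes_B1_A\},$$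 which equals the coinvariants $(A\otimes A)^{coH}$ of the diagonal coaction $\rho^\otimes(a\otimes\tilde a)=a_{(0)}\otimes\tilde a_{(0)}\otimes a_{(1)}\tilde a_{(1)}$. It is a subalgebra of $A\otimes A^{op}$: $(a\otimes\tilde a)(c\otimes\tilde c)=ac\otimes\tilde c\tilde a$. It is a left $B$-bialgebroid with source $s(b)=b\otimes1_A$, target $t(b)=1_A\otimes b$, $B$-bimodule structure $b\,h\,b'=s(b)t(b')h$, tensor product $\mathcal{C}(A,H)\otimes_B\mathcal{C}(A,H)$ equal to the quotient of $\mathcal{C}(A,H)\otimes\mathcal{C}(A,H)$ by the span of all $t(b)h\otimes h'-h\otimes s(b)h'$, coproduct $\underline{\Delta}(a\otimes\tilde a)=a_{(0)}\otimes a_{(1)}{}^{\langle1\rangle}\otimes_Ba_{(1)}{}^{\langle2\rangle}\otimes\tilde a$ and counit $\underline{\epsilon}(a\otimes\tilde a)=a\tilde a$. **Antipode.** An antipode for a left $B$-bialgebroid $(\mathcal{H},s,t,\underline{\Delta},\underline{\epsilon})$, with $\underline{\Delta}(h)=h_{(1)}\otimes_Bh_{(2)}$, is a bijective anti-algebra morphism $\underline{S}:\mathcal{H}\to\mathcal{H}$ with $\underline{S}\circ t=s$ and, for all $h\in\mathcal{H}$, $$\underline{S}(h_{(1)})_{(1')}h_{(2)}\otimes_B\underline{S}(h_{(1)})_{(2')}=1_{\mathcal{H}}\otimes_B\underline{S}(h),\qquad \underline{S}^{-1}(h_{(2)})_{(1')}\otimes_B\underline{S}^{-1}(h_{(2)})_{(2')}h_{(1)}=\underline{S}^{-1}(h)\otimes_B1_{\mathcal{H}},$$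 where primed indices denote a further application of $\underline{\Delta}$. *)

theory Defs
  imports
    "HOL-Algebra.Module"
    "HOL-Algebra.Generated_Groups"
    "HOL-Algebra.Free_Abelian_Groups"
begin

section \<open>Tensor products\<close>

text \<open>
  \<open>tensor R M ra N la\<close> is $M \otimes_R N$ for a right action \<open>ra\<close> on \<open>M\<close> and a left action
  \<open>la\<close> on \<open>N\<close> of a set \<open>R\<close> of scalars: the free abelian group on \<open>carrier M \<times> carrier N\<close>
  modulo the usual relations. Its elements are cosets of formal sums of pairs, and its zero
  is the subgroup of relations itself. The multiplicative fields are unused here;
  \<open>tensor_algebra\<close> fills them in.
\<close>

type_synonym ('m, 'n) tensor = "('m \<times> 'n \<Rightarrow>\<^sub>0 int) set"

definition tensor_relations ::
  "'r set \<Rightarrow> ('m, 'x) ring_scheme \<Rightarrow> ('m \<Rightarrow> 'r \<Rightarrow> 'm) \<Rightarrow> ('n, 'y) ring_scheme \<Rightarrow> ('r \<Rightarrow> 'n \<Rightarrow> 'n)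
    \<Rightarrow> ('m, 'n) tensor" where
  "tensor_relations R M ra N la =
     {frag_of (m \<oplus>\<^bsub>M\<^esub> m', n) - frag_of (m, n) - frag_of (m', n) | m m' n.
        m \<in> carrier M \<and> m' \<in> carrier M \<and> n \<in> carrier N} \<union>
     {frag_of (m, n \<oplus>\<^bsub>N\<^esub> n') - frag_of (m, n) - frag_of (m, n') | m n n'.
        m \<in> carrier M \<and> n \<in> carrier N \<and> n' \<in> carrier N} \<union>
     {frag_of (ra m r, n) - frag_of (m, la r n) | m r n.
        m \<in> carrier M \<and> r \<in> R \<and> n \<in> carrier N}"

definition tensor ::
  "'r set \<Rightarrow> ('m, 'x) ring_scheme \<Rightarrow> ('m \<Rightarrow> 'r \<Rightarrow> 'm) \<Rightarrow> ('n, 'y) ring_scheme \<Rightarrow> ('r \<Rightarrow> 'n \<Rightarrow> 'n)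
    \<Rightarrow> ('m, 'n) tensor ring" where
  "tensor R M ra N la =
     (let F = free_Abelian_group (carrier M \<times> carrier N);
          Q = F Mod generate F (tensor_relations R M ra N la)
      in \<lparr>carrier = carrier Q, monoid.mult = undefined, monoid.one = undefined,
          ring.zero = monoid.one Q, ring.add = monoid.mult Q\<rparr>)"

definition ten :: "(('m, 'n) tensor, 'x) ring_scheme \<Rightarrow> 'm \<Rightarrow> 'n \<Rightarrow> ('m, 'n) tensor" where
  "ten T m n = (\<lambda>r. r + frag_of (m, n)) ` \<zero>\<^bsub>T\<^esub>"

text \<open>
  \<open>tensor_lift P f X\<close> is $\sum f(m_i, n_i)$ in \<open>P\<close> for any presentation $X = \sum m_i \otimes n_i$.
  It is independent of the presentation whenever \<open>f\<close> is biadditive and balanced, and is only used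
  for such \<open>f\<close>: it renders Sweedler-type expressions.
\<close>

definition tensor_lift ::
  "('p, 'x) ring_scheme \<Rightarrow> ('m \<Rightarrow> 'n \<Rightarrow> 'p) \<Rightarrow> ('m, 'n) tensor \<Rightarrow> 'p" where
  "tensor_lift P f X =
     (let z = (SOME z. z \<in> X)
      in \<Oplus>\<^bsub>P\<^esub>p \<in> Poly_Mapping.keys z. [Poly_Mapping.lookup z p] \<cdot>\<^bsub>P\<^esub> f (fst p) (snd p))"

definition tensor_module ::
  "'r set \<Rightarrow> ('k, 'm, 'x) module_scheme \<Rightarrow> ('m \<Rightarrow> 'r \<Rightarrow> 'm)
    \<Rightarrow> ('n, 'y) ring_scheme \<Rightarrow> ('r \<Rightarrow> 'n \<Rightarrow> 'n) \<Rightarrow> ('k, ('m, 'n) tensor) module" where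
  "tensor_module R M ra N la =
     (let T = tensor R M ra N la
      in \<lparr>carrier = carrier T, monoid.mult = monoid.mult T, monoid.one = monoid.one T,
          ring.zero = ring.zero T, ring.add = ring.add T,
          smult = (\<lambda>k. tensor_lift T (\<lambda>m n. ten T (k \<odot>\<^bsub>M\<^esub> m) n))\<rparr>)"

abbreviation tensor_K ::
  "('k, 'u) ring_scheme \<Rightarrow> ('k, 'm, 'x) module_scheme \<Rightarrow> ('k, 'n, 'y) module_scheme
    \<Rightarrow> ('k, ('m, 'n) tensor) module" where
  "tensor_K K V W \<equiv>
     tensor_module (carrier K) V (\<lambda>v k. k \<odot>\<^bsub>V\<^esub> v) W (\<lambda>k w. k \<odot>\<^bsub>W\<^esub> w)"

definition tensor_algebra ::
  "('k, 'u) ring_scheme \<Rightarrow> ('k, 'a, 'x) module_scheme \<Rightarrow> ('k, 'c, 'y) module_scheme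
    \<Rightarrow> ('k, ('a, 'c) tensor) module" where
  "tensor_algebra K A C =
     (let T = tensor_K K A C
      in T\<lparr>monoid.mult := (\<lambda>X Y. tensor_lift T (\<lambda>a c. tensor_lift T (\<lambda>a' c'.
               ten T (a \<otimes>\<^bsub>A\<^esub> a') (c \<otimes>\<^bsub>C\<^esub> c')) Y) X),
           monoid.one := ten T \<one>\<^bsub>A\<^esub> \<one>\<^bsub>C\<^esub>\<rparr>)"


section \<open>Algebras and Hopf algebras\<close>

text \<open>
  An algebra over \<open>K\<close> is a \<open>module\<close> record whose ring part is a possibly noncommutative ring;
  the library locale \<open>algebra\<close> covers commutative algebras only.
\<close>

definition K_algebra :: "('k, 'u) ring_scheme \<Rightarrow> ('k, 'a, 'x) module_scheme \<Rightarrow> bool" where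
  "K_algebra K A \<longleftrightarrow> module K A \<and> ring A \<and>
     (\<forall>k \<in> carrier K. \<forall>a \<in> carrier A. \<forall>a' \<in> carrier A.
        (k \<odot>\<^bsub>A\<^esub> a) \<otimes>\<^bsub>A\<^esub> a' = k \<odot>\<^bsub>A\<^esub> (a \<otimes>\<^bsub>A\<^esub> a') \<and>
        a \<otimes>\<^bsub>A\<^esub> (k \<odot>\<^bsub>A\<^esub> a') = k \<odot>\<^bsub>A\<^esub> (a \<otimes>\<^bsub>A\<^esub> a'))"

definition opposite :: "('k, 'a) module \<Rightarrow> ('k, 'a) module" where
  "opposite A = A\<lparr>monoid.mult := (\<lambda>a a'. a' \<otimes>\<^bsub>A\<^esub> a)\<rparr>"

definition linear_map ::
  "('k, 'u) ring_scheme \<Rightarrow> ('k, 'm, 'x) module_scheme \<Rightarrow> ('k, 'n, 'y) module_scheme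
    \<Rightarrow> ('m \<Rightarrow> 'n) set" where
  "linear_map K V W =
     {f. f \<in> carrier V \<rightarrow> carrier W \<and>
         (\<forall>v \<in> carrier V. \<forall>v' \<in> carrier V. f (v \<oplus>\<^bsub>V\<^esub> v') = f v \<oplus>\<^bsub>W\<^esub> f v') \<and>
         (\<forall>k \<in> carrier K. \<forall>v \<in> carrier V. f (k \<odot>\<^bsub>V\<^esub> v) = k \<odot>\<^bsub>W\<^esub> f v)}"

definition algebra_hom ::
  "('k, 'u) ring_scheme \<Rightarrow> ('k, 'm, 'x) module_scheme \<Rightarrow> ('k, 'n, 'y) module_scheme
    \<Rightarrow> ('m \<Rightarrow> 'n) set" where
  "algebra_hom K A C = ring_hom A C \<inter> linear_map K A C"

definition hopf_algebra ::
  "'k ring \<Rightarrow> ('k, 'h) module \<Rightarrow> ('h \<Rightarrow> ('h, 'h) tensor) \<Rightarrow> ('h \<Rightarrow> 'k) \<Rightarrow> ('h \<Rightarrow> 'h) \<Rightarrow> bool" where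
  "hopf_algebra K H \<Delta> \<epsilon> S \<longleftrightarrow>
     (let HH = tensor_algebra K H H; HHH = tensor_K K H HH in
      K_algebra K H \<and>
      \<Delta> \<in> algebra_hom K H HH \<and>
      \<epsilon> \<in> ring_hom H K \<and>
      (\<forall>k \<in> carrier K. \<forall>h \<in> carrier H. \<epsilon> (k \<odot>\<^bsub>H\<^esub> h) = k \<otimes>\<^bsub>K\<^esub> \<epsilon> h) \<and>
      (\<forall>h \<in> carrier H.
         tensor_lift HHH (\<lambda>h1 h2. tensor_lift HHH (\<lambda>x y. ten HHH x (ten HH y h2)) (\<Delta> h1)) (\<Delta> h)
         = tensor_lift HHH (\<lambda>h1 h2. ten HHH h1 (\<Delta> h2)) (\<Delta> h)) \<and>
      (\<forall>h \<in> carrier H.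
         tensor_lift H (\<lambda>h1 h2. \<epsilon> h1 \<odot>\<^bsub>H\<^esub> h2) (\<Delta> h) = h \<and>
         tensor_lift H (\<lambda>h1 h2. \<epsilon> h2 \<odot>\<^bsub>H\<^esub> h1) (\<Delta> h) = h) \<and>
      S \<in> linear_map K H H \<and>
      (\<forall>h \<in> carrier H.
         tensor_lift H (\<lambda>h1 h2. S h1 \<otimes>\<^bsub>H\<^esub> h2) (\<Delta> h) = \<epsilon> h \<odot>\<^bsub>H\<^esub> \<one>\<^bsub>H\<^esub> \<and>
         tensor_lift H (\<lambda>h1 h2. h1 \<otimes>\<^bsub>H\<^esub> S h2) (\<Delta> h) = \<epsilon> h \<odot>\<^bsub>H\<^esub> \<one>\<^bsub>H\<^esub>))"


section \<open>Faithful flatness\<close>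

definition right_module :: "('b, 'u) ring_scheme \<Rightarrow> 'm ring \<Rightarrow> ('m \<Rightarrow> 'b \<Rightarrow> 'm) \<Rightarrow> bool" where
  "right_module B M ra \<longleftrightarrow> abelian_group M \<and>
     (\<forall>m \<in> carrier M. \<forall>b \<in> carrier B. ra m b \<in> carrier M) \<and>
     (\<forall>m \<in> carrier M. \<forall>m' \<in> carrier M. \<forall>b \<in> carrier B.
        ra (m \<oplus>\<^bsub>M\<^esub> m') b = ra m b \<oplus>\<^bsub>M\<^esub> ra m' b) \<and>
     (\<forall>m \<in> carrier M. \<forall>b \<in> carrier B. \<forall>b' \<in> carrier B.
        ra m (b \<oplus>\<^bsub>B\<^esub> b') = ra m b \<oplus>\<^bsub>M\<^esub> ra m b' \<and>
        ra m (b \<otimes>\<^bsub>B\<^esub> b') = ra (ra m b) b') \<and>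
     (\<forall>m \<in> carrier M. ra m \<one>\<^bsub>B\<^esub> = m)"

definition right_module_hom ::
  "('b, 'u) ring_scheme \<Rightarrow> 'm ring \<Rightarrow> ('m \<Rightarrow> 'b \<Rightarrow> 'm) \<Rightarrow> 'n ring \<Rightarrow> ('n \<Rightarrow> 'b \<Rightarrow> 'n)
    \<Rightarrow> ('m \<Rightarrow> 'n) set" where
  "right_module_hom B M ra N rb =
     {f. f \<in> carrier M \<rightarrow> carrier N \<and>
         (\<forall>m \<in> carrier M. \<forall>m' \<in> carrier M. f (m \<oplus>\<^bsub>M\<^esub> m') = f m \<oplus>\<^bsub>N\<^esub> f m') \<and>
         (\<forall>m \<in> carrier M. \<forall>b \<in> carrier B. f (ra m b) = rb (f m) b)}"

definition exact_pair ::
  "('l, 'x) ring_scheme \<Rightarrow> ('l \<Rightarrow> 'm) \<Rightarrow> ('m, 'y) ring_scheme \<Rightarrow> ('m \<Rightarrow> 'n) \<Rightarrow> ('n, 'z) ring_scheme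
    \<Rightarrow> bool" where
  "exact_pair L f M g N \<longleftrightarrow> f ` carrier L = {m \<in> carrier M. g m = \<zero>\<^bsub>N\<^esub>}"

text \<open>
  A left \<open>B\<close>-module \<open>(A, la)\<close> is faithfully flat if a sequence $L \to M \to N$ of right
  \<open>B\<close>-modules is exact iff $L \otimes_B A \to M \otimes_B A \to N \otimes_B A$ is exact. HOL cannot
  quantify over all types inside a formula, so the carriers of the test modules range over the
  subsets of a universe type \<open>'m\<close>. The choice of \<open>'m\<close> is immaterial once it contains copies of the
  cyclic modules and of the right ideals of \<open>B\<close>, since these already detect faithful flatness.
\<close>

definition faithfully_flat_left ::
  "'m itself \<Rightarrow> ('b, 'u) ring_scheme \<Rightarrow> ('a, 'x) ring_scheme \<Rightarrow> ('b \<Rightarrow> 'a \<Rightarrow> 'a) \<Rightarrow> bool" where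
  "faithfully_flat_left _ B A la \<longleftrightarrow>
     (\<forall>(L :: 'm ring) rL (M :: 'm ring) rM (N :: 'm ring) rN f g.
        right_module B L rL \<and> right_module B M rM \<and> right_module B N rN \<and>
        f \<in> right_module_hom B L rL M rM \<and> g \<in> right_module_hom B M rM N rN \<longrightarrow>
        (let LA = tensor (carrier B) L rL A la;
             MA = tensor (carrier B) M rM A la;
             NA = tensor (carrier B) N rN A la
         in exact_pair L f M g N \<longleftrightarrow>
            exact_pair LA (tensor_lift MA (\<lambda>l a. ten MA (f l) a))
                       MA (tensor_lift NA (\<lambda>m a. ten NA (g m) a)) NA))"


section \<open>Principal comodule algebras\<close>

definition comodule_algebra ::
  "'k ring \<Rightarrow> ('k, 'h) module \<Rightarrow> ('h \<Rightarrow> ('h, 'h) tensor) \<Rightarrow> ('h \<Rightarrow> 'k) \<Rightarrow>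
   ('k, 'a) module \<Rightarrow> ('a \<Rightarrow> ('a, 'h) tensor) \<Rightarrow> bool" where
  "comodule_algebra K H \<Delta> \<epsilon> A \<rho> \<longleftrightarrow>
     (let HH = tensor_K K H H; AHH = tensor_K K A HH in
      K_algebra K A \<and>
      \<rho> \<in> algebra_hom K A (tensor_algebra K A H) \<and>
      (\<forall>a \<in> carrier A.
         tensor_lift AHH (\<lambda>a0 a1. tensor_lift AHH (\<lambda>x y. ten AHH x (ten HH y a1)) (\<rho> a0)) (\<rho> a)
         = tensor_lift AHH (\<lambda>a0 a1. ten AHH a0 (\<Delta> a1)) (\<rho> a)) \<and>
      (\<forall>a \<in> carrier A. tensor_lift A (\<lambda>a0 a1. \<epsilon> a1 \<odot>\<^bsub>A\<^esub> a0) (\<rho> a) = a))"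

definition coinvariants ::
  "'k ring \<Rightarrow> ('k, 'h) module \<Rightarrow> ('k, 'a) module \<Rightarrow> ('a \<Rightarrow> ('a, 'h) tensor) \<Rightarrow> ('k, 'a) module" where
  "coinvariants K H A \<rho> =
     A\<lparr>carrier := {a \<in> carrier A. \<rho> a = ten (tensor_K K A H) a \<one>\<^bsub>H\<^esub>}\<rparr>"

definition tensor_B ::
  "'k ring \<Rightarrow> ('k, 'h) module \<Rightarrow> ('k, 'a) module \<Rightarrow> ('a \<Rightarrow> ('a, 'h) tensor)
    \<Rightarrow> ('k, ('a, 'a) tensor) module" where
  "tensor_B K H A \<rho> = tensor_module (carrier (coinvariants K H A \<rho>)) A (monoid.mult A) A (monoid.mult A)"

definition canonical_map ::
  "'k ring \<Rightarrow> ('k, 'h) module \<Rightarrow> ('k, 'a) module \<Rightarrow> ('a \<Rightarrow> ('a, 'h) tensor)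
    \<Rightarrow> ('a, 'a) tensor \<Rightarrow> ('a, 'h) tensor" where
  "canonical_map K H A \<rho> =
     (let AH = tensor_K K A H
      in tensor_lift AH (\<lambda>a a'. tensor_lift AH (\<lambda>a0' a1'. ten AH (a \<otimes>\<^bsub>A\<^esub> a0') a1') (\<rho> a')))"

definition hopf_galois ::
  "'k ring \<Rightarrow> ('k, 'h) module \<Rightarrow> ('k, 'a) module \<Rightarrow> ('a \<Rightarrow> ('a, 'h) tensor) \<Rightarrow> bool" where
  "hopf_galois K H A \<rho> \<longleftrightarrow>
     bij_betw (canonical_map K H A \<rho>) (carrier (tensor_B K H A \<rho>)) (carrier (tensor_K K A H))"

text \<open>
  The universe \<open>('a + 'h) list set\<close> for faithful flatness contains (up to isomorphism) every module
  with at most $\max(|A|, |H|, \aleph_0)$ elements, in particular all finitely generated right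
  \<open>B\<close>-modules and all their submodules.
\<close>

definition principal_comodule_algebra ::
  "'k ring \<Rightarrow> ('k, 'h) module \<Rightarrow> ('h \<Rightarrow> ('h, 'h) tensor) \<Rightarrow> ('h \<Rightarrow> 'k) \<Rightarrow>
   ('k, 'a) module \<Rightarrow> ('a \<Rightarrow> ('a, 'h) tensor) \<Rightarrow> bool" where
  "principal_comodule_algebra K H \<Delta> \<epsilon> A \<rho> \<longleftrightarrow>
     comodule_algebra K H \<Delta> \<epsilon> A \<rho> \<and>
     hopf_galois K H A \<rho> \<and>
     faithfully_flat_left TYPE(('a + 'h) list set) (coinvariants K H A \<rho>) A (monoid.mult A)"

definition translation_map ::
  "'k ring \<Rightarrow> ('k, 'h) module \<Rightarrow> ('k, 'a) module \<Rightarrow> ('a \<Rightarrow> ('a, 'h) tensor)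
    \<Rightarrow> 'h \<Rightarrow> ('a, 'a) tensor" where
  "translation_map K H A \<rho> h =
     the_inv_into (carrier (tensor_B K H A \<rho>)) (canonical_map K H A \<rho>)
       (ten (tensor_K K A H) \<one>\<^bsub>A\<^esub> h)"


section \<open>Left bialgebroids and antipodes\<close>

record ('k, 'b, 't) bialgebroid =
  base :: "('k, 'b) module"
  total :: "('k, 't) module"
  source :: "'b \<Rightarrow> 't"
  target :: "'b \<Rightarrow> 't"
  coproduct :: "'t \<Rightarrow> ('t, 't) tensor"
  counit :: "'t \<Rightarrow> 'b"

text \<open>
  $L \otimes_B L$ for the bimodule structure $b\,h\,b' = s(b)\,t(b')\,h$, that is, the quotient by all
  $t(b)h \otimes h' - h \otimes s(b)h'$. As $s$ and $t$ are unital and linear, \<open>b\<close> running through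
  the multiples of the unit of \<open>B\<close> gives \<open>K\<close>-balancedness.
\<close>

definition bimodule_tensor ::
  "('b, 'u) ring_scheme \<Rightarrow> ('k, 't) module \<Rightarrow> ('b \<Rightarrow> 't) \<Rightarrow> ('b \<Rightarrow> 't)
    \<Rightarrow> ('k, ('t, 't) tensor) module" where
  "bimodule_tensor B L s t =
     tensor_module (carrier B) L (\<lambda>h b. t b \<otimes>\<^bsub>L\<^esub> h) L (\<lambda>b h. s b \<otimes>\<^bsub>L\<^esub> h)"

definition is_antipode ::
  "'k ring \<Rightarrow> ('k, 'b, 't) bialgebroid \<Rightarrow> ('t \<Rightarrow> 't) \<Rightarrow> bool" where
  "is_antipode K \<H> S \<longleftrightarrow>
     (let L = total \<H>; \<Delta> = coproduct \<H>;
          LL = bimodule_tensor (base \<H>) L (source \<H>) (target \<H>);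
          S' = the_inv_into (carrier L) S in
      bij_betw S (carrier L) (carrier L) \<and>
      S \<in> algebra_hom K L (opposite L) \<and>
      (\<forall>b \<in> carrier (base \<H>). S (target \<H> b) = source \<H> b) \<and>
      (\<forall>h \<in> carrier L.
         tensor_lift LL (\<lambda>h1 h2. tensor_lift LL (\<lambda>x y. ten LL (x \<otimes>\<^bsub>L\<^esub> h2) y) (\<Delta> (S h1))) (\<Delta> h)
         = ten LL \<one>\<^bsub>L\<^esub> (S h)) \<and>
      (\<forall>h \<in> carrier L.
         tensor_lift LL (\<lambda>h1 h2. tensor_lift LL (\<lambda>x y. ten LL x (y \<otimes>\<^bsub>L\<^esub> h1)) (\<Delta> (S' h2))) (\<Delta> h)
         = ten LL (S' h) \<one>\<^bsub>L\<^esub>))"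


section \<open>The Ehresmann--Schauenburg bialgebroid\<close>

definition ES_carrier ::
  "'k ring \<Rightarrow> ('k, 'h) module \<Rightarrow> ('k, 'a) module \<Rightarrow> ('a \<Rightarrow> ('a, 'h) tensor)
    \<Rightarrow> ('a, 'a) tensor set" where
  "ES_carrier K H A \<rho> =
     (let ABA = tensor_B K H A \<rho>; P = tensor_K K A ABA in
      {X \<in> carrier (tensor_K K A A).
         tensor_lift P (\<lambda>a a'. tensor_lift P (\<lambda>a0 a1. tensor_lift P (\<lambda>u v.
             ten P a0 (ten ABA u (v \<otimes>\<^bsub>A\<^esub> a')))
           (translation_map K H A \<rho> a1)) (\<rho> a)) X
         = tensor_lift P (\<lambda>a a'. ten P a (ten ABA a' \<one>\<^bsub>A\<^esub>)) X})"

definition ES_algebra ::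
  "'k ring \<Rightarrow> ('k, 'h) module \<Rightarrow> ('k, 'a) module \<Rightarrow> ('a \<Rightarrow> ('a, 'h) tensor)
    \<Rightarrow> ('k, ('a, 'a) tensor) module" where
  "ES_algebra K H A \<rho> = (tensor_algebra K A (opposite A))\<lparr>carrier := ES_carrier K H A \<rho>\<rparr>"

definition ES_source :: "'k ring \<Rightarrow> ('k, 'a) module \<Rightarrow> 'a \<Rightarrow> ('a, 'a) tensor" where
  "ES_source K A b = ten (tensor_K K A A) b \<one>\<^bsub>A\<^esub>"

definition ES_target :: "'k ring \<Rightarrow> ('k, 'a) module \<Rightarrow> 'a \<Rightarrow> ('a, 'a) tensor" where
  "ES_target K A b = ten (tensor_K K A A) \<one>\<^bsub>A\<^esub> b"

text \<open>
  The formula $a_{(0)} \otimes a_{(1)}{}^{\langle 1\rangle} \otimes_B a_{(1)}{}^{\langle 2\rangle} \otimes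
  \tilde a$ a priori denotes an element of $(A \otimes A) \otimes_B (A \otimes A)$. The coproduct is
  the element of $\mathcal{C}(A,H) \otimes_B \mathcal{C}(A,H)$ that the map induced by the inclusion
  $\mathcal{C}(A,H) \subseteq A \otimes A$ sends to it.
\<close>

definition ES_coproduct ::
  "'k ring \<Rightarrow> ('k, 'h) module \<Rightarrow> ('k, 'a) module \<Rightarrow> ('a \<Rightarrow> ('a, 'h) tensor)
    \<Rightarrow> ('a, 'a) tensor \<Rightarrow> (('a, 'a) tensor, ('a, 'a) tensor) tensor" where
  "ES_coproduct K H A \<rho> X =
     (let B = coinvariants K H A \<rho>;
          AA = tensor_algebra K A (opposite A);
          Q = bimodule_tensor B AA (ES_source K A) (ES_target K A);
          CC = bimodule_tensor B (ES_algebra K H A \<rho>) (ES_source K A) (ES_target K A)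
      in the_inv_into (carrier CC) (tensor_lift Q (ten Q))
           (tensor_lift Q (\<lambda>a a'. tensor_lift Q (\<lambda>a0 a1. tensor_lift Q (\<lambda>u v.
               ten Q (ten AA a0 u) (ten AA v a'))
             (translation_map K H A \<rho> a1)) (\<rho> a)) X))"

definition ES_counit :: "('k, 'a) module \<Rightarrow> ('a, 'a) tensor \<Rightarrow> 'a" where
  "ES_counit A = tensor_lift A (monoid.mult A)"

definition ES_bialgebroid ::
  "'k ring \<Rightarrow> ('k, 'h) module \<Rightarrow> ('k, 'a) module \<Rightarrow> ('a \<Rightarrow> ('a, 'h) tensor)
    \<Rightarrow> ('k, 'a, ('a, 'a) tensor) bialgebroid" where
  "ES_bialgebroid K H A \<rho> =
     \<lparr>base = coinvariants K H A \<rho>, total = ES_algebra K H A \<rho>,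
      source = ES_source K A, target = ES_target K A,
      coproduct = ES_coproduct K H A \<rho>, counit = ES_counit A\<rparr>"

definition flip :: "'k ring \<Rightarrow> ('k, 'a) module \<Rightarrow> ('a, 'a) tensor \<Rightarrow> ('a, 'a) tensor" where
  "flip K A = (let AA = tensor_K K A A in tensor_lift AA (\<lambda>a a'. ten AA a' a))"

end

theory Submission
  imports Defs
begin

text \<open>
  Let \<open>M\<close> be $A \otimes A$ with the right \<open>A\<close>-action on the second factor and the diagonal
  coaction $\delta$. Applying the canonical map shows that $C = \mathcal{C}(A,H)$ is the set of
  $\delta$-coinvariants, and since \<open>H\<close> is commutative the flip preserves it.

  The delicate point is the coproduct, which is defined by inverting
  $C \otimes_B C \to M \otimes_B M$. For every right \<open>A\<close>-module \<open>W\<close> the Galois condition gives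
  $W \otimes_B A \cong W \otimes H$. Faithful flatness then yields $C \otimes_B A \cong M$ by testing
  the exact sequence $0 \to C \to M \to M \otimes H$ (with second map $\delta - {-} \otimes 1$) after
  applying $- \otimes_B A$, and, in the opposite direction, that
  $\kappa : C \otimes_B C \to M \otimes A$,
  $(a \otimes a') \otimes (c \otimes c') \mapsto (a \otimes a'c) \otimes c'$, is injective with the
  coinvariants of $M \otimes A$ as image. Under $\kappa$ the coproduct of $a \otimes a'$ becomes
  $(a \otimes 1) \otimes a'$, and both antipode identities reduce to cyclic permutations of
  three tensor factors.
\<close>

section \<open>Tensor products and additive maps\<close>

text \<open>Let \<open>g\<close> be the coaction of a Hopf module \<open>W\<close> minus
  \<open>w \<mapsto> w \<otimes> 1\<close>. What happens to \<open>g\<close> under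
  \<open>- \<otimes>_B A\<close> is read off from two identities: \<open>mu\<close> after it is
  \<open>\<delta>\<close> after \<open>mu\<close> minus \<open>chi\<close>, and \<open>chi\<close>
  after it is \<open>\<delta> \<otimes> id - id \<otimes> \<Delta>\<close> after \<open>chi\<close>.
  The first determines an element of the kernel by its product; the second produces elements of the
  kernel from coassociativity. Coassociativity and counit of the diagonal coaction on
  \<open>A \<otimes> A\<close> are checked only at \<open>a \<otimes> 1\<close>, where they are
  those of \<open>\<rho>\<close>; these elements generate \<open>A \<otimes> A\<close> as a right
  \<open>A\<close>-module. Injectivity of
  \<open>C \<otimes>_B C \<rightarrow> M \<otimes>_B M\<close> is not formal, as flatness of
  \<open>C\<close> over \<open>B\<close> is not among the hypotheses. It holds because the formula
  for \<kappa> makes sense on all of \<open>M \<otimes>_B M\<close>, so that \<kappa> factors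
  through the inclusion. Statements about \<kappa> are tested after \<open>- \<otimes>_B A\<close>,
  along \<open>C \<otimes>_B C \<otimes>_B A = C \<otimes>_B M = (C \<otimes>_B A) \<otimes> A = M
  \<otimes> A\<close>.\<close>

definition additive :: "('m, 'x) ring_scheme \<Rightarrow> ('n, 'y) ring_scheme \<Rightarrow> ('m \<Rightarrow> 'n) \<Rightarrow> bool" where
  "additive M N f \<longleftrightarrow> (\<forall>x \<in> carrier M. f x \<in> carrier N) \<and>
     (\<forall>x \<in> carrier M. \<forall>y \<in> carrier M. f (x \<oplus>\<^bsub>M\<^esub> y) = f x \<oplus>\<^bsub>N\<^esub> f y)"

lemma additiveI:
  "(\<And>x. x \<in> carrier M \<Longrightarrow> f x \<in> carrier N) \<Longrightarrow>
   (\<And>x y. x \<in> carrier M \<Longrightarrow> y \<in> carrier M \<Longrightarrow> f (x \<oplus>\<^bsub>M\<^esub> y) = f x \<oplus>\<^bsub>N\<^esub> f y) \<Longrightarrow> additive M N f"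
  by (simp add: additive_def)

lemma additive_closed: "additive M N f \<Longrightarrow> x \<in> carrier M \<Longrightarrow> f x \<in> carrier N"
  by (simp add: additive_def)

lemma additive_add:
  "additive M N f \<Longrightarrow> x \<in> carrier M \<Longrightarrow> y \<in> carrier M \<Longrightarrow> f (x \<oplus>\<^bsub>M\<^esub> y) = f x \<oplus>\<^bsub>N\<^esub> f y"
  by (simp add: additive_def)

lemma additive_comp:
  "additive M N f \<Longrightarrow> additive N P g \<Longrightarrow> additive M P (\<lambda>x. g (f x))"
  by (simp add: additive_def)

lemma additive_hom:
  assumes "additive M N f" "abelian_group M" "abelian_group N"
  shows "group_hom (add_monoid M) (add_monoid N) f"
  using assms unfolding additive_def group_hom_def group_hom_axioms_def
  by (auto simp: abelian_group.a_group hom_def)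

lemma additive_zero:
  assumes "additive M N f" "abelian_group M" "abelian_group N"
  shows "f \<zero>\<^bsub>M\<^esub> = \<zero>\<^bsub>N\<^esub>"
  using group_hom.hom_one[OF additive_hom[OF assms]] by simp

lemma additive_a_inv:
  assumes "additive M N f" "abelian_group M" "abelian_group N" "x \<in> carrier M"
  shows "f (\<ominus>\<^bsub>M\<^esub> x) = \<ominus>\<^bsub>N\<^esub> f x"
  using group_hom.hom_inv[OF additive_hom[OF assms(1-3)]] assms(4) by (simp add: a_inv_def)

lemma additive_minus:
  assumes "additive M N f" "abelian_group M" "abelian_group N" "x \<in> carrier M" "y \<in> carrier M"
  shows "f (x \<ominus>\<^bsub>M\<^esub> y) = f x \<ominus>\<^bsub>N\<^esub> f y"
  using assms additive_add[OF assms(1), of x "\<ominus>\<^bsub>M\<^esub> y"] additive_a_inv[OF assms(1-3)]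
  by (simp add: a_minus_def abelian_group.a_inv_closed)

lemma additive_diff:
  assumes "additive M N f" "additive M N g" "abelian_group N"
  shows "additive M N (\<lambda>x. f x \<ominus>\<^bsub>N\<^esub> g x)"
proof -
  interpret N: abelian_group N by fact
  show ?thesis
    using assms(1,2) by (auto simp: additive_def a_minus_def N.minus_add N.a_ac)
qed

lemma additive_inj_onI:
  assumes "additive M N f" "abelian_group M" "abelian_group N"
    and "\<And>x. x \<in> carrier M \<Longrightarrow> f x = \<zero>\<^bsub>N\<^esub> \<Longrightarrow> x = \<zero>\<^bsub>M\<^esub>"
  shows "inj_on f (carrier M)"
proof (rule inj_onI)
  interpret M: abelian_group M by fact
  interpret N: abelian_group N by fact
  fix x y assume xy: "x \<in> carrier M" "y \<in> carrier M" "f x = f y"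
  then have "f (x \<ominus>\<^bsub>M\<^esub> y) = \<zero>\<^bsub>N\<^esub>"
    using additive_minus[OF assms(1-3), of x y] additive_closed[OF assms(1)] by (simp add: N.r_neg a_minus_def)
  then have "x \<ominus>\<^bsub>M\<^esub> y = \<zero>\<^bsub>M\<^esub>" using assms(4) xy by simp
  then have "x \<oplus>\<^bsub>M\<^esub> (\<ominus>\<^bsub>M\<^esub> y) = \<zero>\<^bsub>M\<^esub>" by (simp add: a_minus_def)
  then show "x = y" using xy M.minus_equality M.minus_minus by (metis M.a_inv_closed)
qed

text \<open>The kernel is written as a set equation so that it matches \<open>exact_pair\<close> for
  a sequence that starts with the zero module.\<close>

lemma additive_inj_iff:
  assumes f: "additive M N f" and M: "abelian_group M" and N: "abelian_group N"
  shows "inj_on f (carrier M) \<longleftrightarrow> {\<zero>\<^bsub>M\<^esub>} = {m \<in> carrier M. f m = \<zero>\<^bsub>N\<^esub>}"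
proof
  interpret M: abelian_group M by fact
  note z = additive_zero[OF f M N]
  show "{\<zero>\<^bsub>M\<^esub>} = {m \<in> carrier M. f m = \<zero>\<^bsub>N\<^esub>}" if "inj_on f (carrier M)"
  proof (intro equalityI subsetI)
    fix m assume "m \<in> {m \<in> carrier M. f m = \<zero>\<^bsub>N\<^esub>}"
    then have "f m = f \<zero>\<^bsub>M\<^esub>" "m \<in> carrier M" using z by simp_all
    then show "m \<in> {\<zero>\<^bsub>M\<^esub>}" using inj_onD[OF that] by blast
  qed (use z in simp)
  show "inj_on f (carrier M)" if "{\<zero>\<^bsub>M\<^esub>} = {m \<in> carrier M. f m = \<zero>\<^bsub>N\<^esub>}"
    by (rule additive_inj_onI[OF f M N]) (use that in blast)
qed

lemma additive_the_inv:
  assumes "additive M N f" "bij_betw f (carrier M) (carrier N)" "abelian_group M"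
  shows "additive N M (the_inv_into (carrier M) f)"
proof (rule additiveI)
  interpret M: abelian_group M by fact
  have inj: "inj_on f (carrier M)" and im: "f ` carrier M = carrier N"
    using assms(2) by (auto simp: bij_betw_def)
  show cl: "the_inv_into (carrier M) f x \<in> carrier M" if "x \<in> carrier N" for x
    using the_inv_into_into[OF inj, of x] that im by auto
  fix x y assume xy: "x \<in> carrier N" "y \<in> carrier N"
  have fx: "f (the_inv_into (carrier M) f z) = z" if "z \<in> carrier N" for z
    using f_the_inv_into_f[OF inj] that im by auto
  have "f (the_inv_into (carrier M) f x \<oplus>\<^bsub>M\<^esub> the_inv_into (carrier M) f y) = x \<oplus>\<^bsub>N\<^esub> y"
    using additive_add[OF assms(1) cl[OF xy(1)] cl[OF xy(2)]] fx xy by simp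
  then show "the_inv_into (carrier M) f (x \<oplus>\<^bsub>N\<^esub> y)
      = the_inv_into (carrier M) f x \<oplus>\<^bsub>M\<^esub> the_inv_into (carrier M) f y"
    using the_inv_into_f_f[OF inj] cl xy by (metis M.a_closed)
qed

section \<open>Balanced maps and the universal property of the tensor product\<close>

definition balanced ::
  "'r set \<Rightarrow> ('m, 'x) ring_scheme \<Rightarrow> ('m \<Rightarrow> 'r \<Rightarrow> 'm) \<Rightarrow> ('n, 'y) ring_scheme \<Rightarrow> ('r \<Rightarrow> 'n \<Rightarrow> 'n)
    \<Rightarrow> ('p, 'z) ring_scheme \<Rightarrow> ('m \<Rightarrow> 'n \<Rightarrow> 'p) \<Rightarrow> bool" where
  "balanced R M ra N la P f \<longleftrightarrow>
     (\<forall>n \<in> carrier N. additive M P (\<lambda>m. f m n)) \<and>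
     (\<forall>m \<in> carrier M. additive N P (f m)) \<and>
     (\<forall>m \<in> carrier M. \<forall>r \<in> R. \<forall>n \<in> carrier N. f (ra m r) n = f m (la r n))"

lemma balancedI:
  assumes "\<And>n. n \<in> carrier N \<Longrightarrow> additive M P (\<lambda>m. f m n)"
    and "\<And>m. m \<in> carrier M \<Longrightarrow> additive N P (f m)"
    and "\<And>m r n. m \<in> carrier M \<Longrightarrow> r \<in> R \<Longrightarrow> n \<in> carrier N \<Longrightarrow> f (ra m r) n = f m (la r n)"
  shows "balanced R M ra N la P f"
  using assms by (simp add: balanced_def)

lemma balanced_comp:
  "balanced R M ra N la P f \<Longrightarrow> additive P Q g \<Longrightarrow> balanced R M ra N la Q (\<lambda>m n. g (f m n))"
  by (simp add: balanced_def additive_def)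

text \<open>Of the two actions only closure on the carriers is assumed, so the same results serve
  for scalars in \<open>K\<close>, for scalars in \<open>B\<close>, and for sub-carriers such as the
  coinvariants.\<close>

locale tensor_data =
  fixes R :: "'r set" and M :: "('m, 'x) ring_scheme" and ra :: "'m \<Rightarrow> 'r \<Rightarrow> 'm"
    and N :: "('n, 'y) ring_scheme" and la :: "'r \<Rightarrow> 'n \<Rightarrow> 'n"
  assumes M_group: "abelian_group M" and N_group: "abelian_group N"
    and ra_closed: "\<And>m r. m \<in> carrier M \<Longrightarrow> r \<in> R \<Longrightarrow> ra m r \<in> carrier M"
    and la_closed: "\<And>r n. r \<in> R \<Longrightarrow> n \<in> carrier N \<Longrightarrow> la r n \<in> carrier N"
begin

abbreviation "T \<equiv> tensor R M ra N la"
abbreviation "F \<equiv> free_Abelian_group (carrier M \<times> carrier N)"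
abbreviation "G \<equiv> generate F (tensor_relations R M ra N la)"

lemma relations_subset: "tensor_relations R M ra N la \<subseteq> carrier F"
proof -
  interpret M: abelian_group M by (rule M_group)
  interpret N: abelian_group N by (rule N_group)
  have diff: "a - b \<in> carrier F" if "a \<in> carrier F" "b \<in> carrier F" for a b
    using that keys_diff[of a b] by auto
  show ?thesis
    unfolding tensor_relations_def
    using ra_closed la_closed by (auto intro!: diff simp del: carrier_free_Abelian_group_iff)
qed

lemma G_normal: "G \<lhd> F"
  using comm_group.normal_iff_subgroup[OF abelian_free_Abelian_group]
    group.generate_is_subgroup[OF group_free_Abelian_group relations_subset] by blast

lemma carrier_T: "carrier T = (\<lambda>z. G #>\<^bsub>F\<^esub> z) ` carrier F"
  by (auto simp: tensor_def Let_def FactGroup_def RCOSETS_def)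

lemma zero_T: "\<zero>\<^bsub>T\<^esub> = G"
  by (simp add: tensor_def Let_def FactGroup_def)

lemma add_T:
  "x \<in> carrier F \<Longrightarrow> y \<in> carrier F \<Longrightarrow> (G #>\<^bsub>F\<^esub> x) \<oplus>\<^bsub>T\<^esub> (G #>\<^bsub>F\<^esub> y) = G #>\<^bsub>F\<^esub> (x + y)"
  using normal.rcos_sum[OF G_normal, of x y]
  by (simp add: tensor_def Let_def FactGroup_def)

lemma ten_T: "ten T m n = G #>\<^bsub>F\<^esub> frag_of (m, n)"
  by (auto simp: ten_def zero_T r_coset_def)

lemma T_group: "abelian_group T"
proof -
  interpret Q: comm_group "F Mod G"
    by (rule comm_group.abelian_FactGroup[OF abelian_free_Abelian_group])
      (metis G_normal normal_imp_subgroup)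
  have eq: "carrier T = carrier (F Mod G)" "add T = monoid.mult (F Mod G)" "ring.zero T = monoid.one (F Mod G)"
    by (simp_all add: tensor_def Let_def)
  show ?thesis
    by (rule abelian_groupI, unfold eq)
      (rule Q.m_closed Q.one_closed Q.m_assoc Q.m_comm Q.l_one Q.l_inv_ex; assumption)+
qed

lemma coset_eq: "a \<in> carrier F \<Longrightarrow> b \<in> carrier F \<Longrightarrow> a - b \<in> G \<Longrightarrow> G #>\<^bsub>F\<^esub> a = G #>\<^bsub>F\<^esub> b"
proof -
  assume a: "a \<in> carrier F" and b: "b \<in> carrier F" and d: "a - b \<in> G"
  have "a = (a - b) \<otimes>\<^bsub>F\<^esub> b" by simp
  then have "a \<in> G #>\<^bsub>F\<^esub> b" using d unfolding r_coset_def by blast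
  then show ?thesis
    using group.repr_independence[OF group_free_Abelian_group _ b normal_imp_subgroup[OF G_normal]]
    by simp
qed

lemma ten_closed: "m \<in> carrier M \<Longrightarrow> n \<in> carrier N \<Longrightarrow> ten T m n \<in> carrier T"
  by (auto simp: ten_T carrier_T)

lemma ten_add_left:
  assumes "m \<in> carrier M" "m' \<in> carrier M" "n \<in> carrier N"
  shows "ten T (m \<oplus>\<^bsub>M\<^esub> m') n = ten T m n \<oplus>\<^bsub>T\<^esub> ten T m' n"
proof -
  interpret M: abelian_group M by (rule M_group)
  have "frag_of (m \<oplus>\<^bsub>M\<^esub> m', n) - (frag_of (m, n) + frag_of (m', n)) \<in> G"
    by (rule generate.incl) (use assms in \<open>auto simp: tensor_relations_def algebra_simps\<close>)
  moreover have "frag_of (m, n) + frag_of (m', n) \<in> carrier F"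
    using assms keys_add[of "frag_of (m, n)" "frag_of (m', n)"] by auto
  ultimately show ?thesis
    unfolding ten_T by (subst add_T) (use assms in \<open>simp_all add: coset_eq\<close>)
qed

lemma ten_add_right:
  assumes "m \<in> carrier M" "n \<in> carrier N" "n' \<in> carrier N"
  shows "ten T m (n \<oplus>\<^bsub>N\<^esub> n') = ten T m n \<oplus>\<^bsub>T\<^esub> ten T m n'"
proof -
  interpret N: abelian_group N by (rule N_group)
  have "frag_of (m, n \<oplus>\<^bsub>N\<^esub> n') - (frag_of (m, n) + frag_of (m, n')) \<in> G"
    by (rule generate.incl) (use assms in \<open>auto simp: tensor_relations_def algebra_simps\<close>)
  moreover have "frag_of (m, n) + frag_of (m, n') \<in> carrier F"
    using assms keys_add[of "frag_of (m, n)" "frag_of (m, n')"] by auto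
  ultimately show ?thesis
    unfolding ten_T by (subst add_T) (use assms in \<open>simp_all add: coset_eq\<close>)
qed

lemma ten_move:
  assumes "m \<in> carrier M" "r \<in> R" "n \<in> carrier N"
  shows "ten T (ra m r) n = ten T m (la r n)"
proof -
  have "frag_of (ra m r, n) - frag_of (m, la r n) \<in> G"
    by (rule generate.incl) (use assms in \<open>auto simp: tensor_relations_def\<close>)
  then show ?thesis
    unfolding ten_T using assms by (simp add: coset_eq ra_closed la_closed)
qed

lemma ten_balanced: "balanced R M ra N la T (ten T)"
  by (intro balancedI additiveI) (auto simp: ten_closed ten_add_left ten_add_right ten_move)

lemma ten_minus_left:
  assumes "m \<in> carrier M" "n \<in> carrier N"
  shows "ten T (\<ominus>\<^bsub>M\<^esub> m) n = \<ominus>\<^bsub>T\<^esub> ten T m n"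
  by (rule additive_a_inv[OF _ M_group T_group])
    (use assms ten_balanced in \<open>auto simp: balanced_def\<close>)

lemma ten_zero_left:
  assumes "n \<in> carrier N"
  shows "ten T \<zero>\<^bsub>M\<^esub> n = \<zero>\<^bsub>T\<^esub>"
  by (rule additive_zero[OF _ M_group T_group])
    (use assms ten_balanced in \<open>auto simp: balanced_def\<close>)

text \<open>Closure under sums suffices because zero and the negative of a pure tensor are again
  pure: the sign goes into the left factor.\<close>

lemma tensor_induct:
  assumes X: "X \<in> carrier T"
    and ten: "\<And>m n. m \<in> carrier M \<Longrightarrow> n \<in> carrier N \<Longrightarrow> P (ten T m n)"
    and add: "\<And>X Y. X \<in> carrier T \<Longrightarrow> Y \<in> carrier T \<Longrightarrow> P X \<Longrightarrow> P Y \<Longrightarrow> P (X \<oplus>\<^bsub>T\<^esub> Y)"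
  shows "P X"
proof -
  interpret M: abelian_group M by (rule M_group)
  interpret N: abelian_group N by (rule N_group)
  interpret T: abelian_group T by (rule T_group)
  \<comment> \<open>Induction on the free abelian group passes through differences, so
    \<open>P\<close> is carried along for a coset and for its negative at once.\<close>
  have "P (G #>\<^bsub>F\<^esub> z) \<and> P (\<ominus>\<^bsub>T\<^esub> (G #>\<^bsub>F\<^esub> z))" if z: "Poly_Mapping.keys z \<subseteq> carrier M \<times> carrier N" for z
    using z
  proof (induction z rule: free_Abelian_group_induct[consumes 1, case_names zero diff of])
    case zero
    have "G #>\<^bsub>F\<^esub> 0 = ten T \<zero>\<^bsub>M\<^esub> \<zero>\<^bsub>N\<^esub>"
      using ten_zero_left[of "\<zero>\<^bsub>N\<^esub>"] by (auto simp: zero_T r_coset_def)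
    then show ?case
      using ten[of "\<zero>\<^bsub>M\<^esub>" "\<zero>\<^bsub>N\<^esub>"] ten[of "\<ominus>\<^bsub>M\<^esub> \<zero>\<^bsub>M\<^esub>" "\<zero>\<^bsub>N\<^esub>"] ten_minus_left[of "\<zero>\<^bsub>M\<^esub>" "\<zero>\<^bsub>N\<^esub>"] by simp
  next
    case (diff x y)
    then have c: "x \<in> carrier F" "y \<in> carrier F" "x - y \<in> carrier F"
      using keys_diff[of x y] by auto
    have cl: "G #>\<^bsub>F\<^esub> x \<in> carrier T" "G #>\<^bsub>F\<^esub> y \<in> carrier T" "G #>\<^bsub>F\<^esub> (x - y) \<in> carrier T"
      using c unfolding carrier_T by blast+
    have "(G #>\<^bsub>F\<^esub> (x - y)) \<oplus>\<^bsub>T\<^esub> (G #>\<^bsub>F\<^esub> y) = G #>\<^bsub>F\<^esub> x"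
      using add_T[OF c(3) c(2)] by simp
    then have e: "G #>\<^bsub>F\<^esub> (x - y) = (G #>\<^bsub>F\<^esub> x) \<oplus>\<^bsub>T\<^esub> (\<ominus>\<^bsub>T\<^esub> (G #>\<^bsub>F\<^esub> y))"
      using cl by (metis T.add.inv_closed T.add.inv_solve_right)
    then have "\<ominus>\<^bsub>T\<^esub> (G #>\<^bsub>F\<^esub> (x - y)) = (\<ominus>\<^bsub>T\<^esub> (G #>\<^bsub>F\<^esub> x)) \<oplus>\<^bsub>T\<^esub> (G #>\<^bsub>F\<^esub> y)"
      using cl by (simp add: T.minus_add)
    then show ?case
      using e diff cl add by simp
  next
    case (of p)
    then show ?case
      by (cases p) (use ten ten_minus_left in \<open>auto simp flip: ten_T\<close>,
          metis M.a_inv_closed)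
  qed
  then show ?thesis using X by (auto simp: carrier_T)
qed

lemma additive_eqI:
  assumes "additive T P f" "additive T P g" "X \<in> carrier T"
    and "\<And>m n. m \<in> carrier M \<Longrightarrow> n \<in> carrier N \<Longrightarrow> f (ten T m n) = g (ten T m n)"
  shows "f X = g X"
  using assms(3) by (rule tensor_induct) (use assms in \<open>auto simp: additive_add\<close>)

text \<open>\<open>tensor_lift\<close> sums over an arbitrarily chosen representative. The sum is
  therefore studied as a homomorphism \<open>g\<close> on the free group; it kills the relations
  because \<open>f\<close> is balanced, hence is constant on each coset.\<close>

lemma lift_coset:
  assumes P: "abelian_group P" and f: "balanced R M ra N la P f"
  obtains g where "g \<in> hom F (add_monoid P)"
    and "\<And>p. p \<in> carrier M \<times> carrier N \<Longrightarrow> g (frag_of p) = f (fst p) (snd p)"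
    and "\<And>z. z \<in> carrier F \<Longrightarrow> tensor_lift P f (G #>\<^bsub>F\<^esub> z) = g z"
proof -
  interpret P: abelian_group P by fact
  interpret M: abelian_group M by (rule M_group)
  interpret N: abelian_group N by (rule N_group)
  let ?S = "carrier M \<times> carrier N"
  let ?h = "\<lambda>p. f (fst p) (snd p)"
  have cl: "?h p \<in> carrier P" if "p \<in> ?S" for p
    using f that by (auto simp: balanced_def additive_def)
  have pcl: "[k] \<cdot>\<^bsub>P\<^esub> f a b \<in> carrier P" and p0: "[(0::int)] \<cdot>\<^bsub>P\<^esub> f a b = \<zero>\<^bsub>P\<^esub>"
    if "a \<in> carrier M" "b \<in> carrier N" for k :: int and a b
    using cl[of "(a, b)"] that by (auto intro: P.add.int_pow_closed, simp add: add_pow_def int_pow_0)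
  define g where "g (z :: 'm \<times> 'n \<Rightarrow>\<^sub>0 int) = (\<Oplus>\<^bsub>P\<^esub>p \<in> Poly_Mapping.keys z. [Poly_Mapping.lookup z p] \<cdot>\<^bsub>P\<^esub> ?h p)" for z
  \<comment> \<open>The supports of \<open>x\<close>, \<open>y\<close> and \<open>x + y\<close>
    differ; summing over any larger finite set puts the three sums on one index set.\<close>
  have g_sup: "g z = (\<Oplus>\<^bsub>P\<^esub>p \<in> U. [Poly_Mapping.lookup z p] \<cdot>\<^bsub>P\<^esub> ?h p)"
    if "finite U" "Poly_Mapping.keys z \<subseteq> U" "U \<subseteq> ?S" for z U
    unfolding g_def
    by (rule P.add.finprod_mono_neutral_cong_left)
      (use that in \<open>auto intro!: pcl p0 simp: in_keys_iff\<close>)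
  have hom: "g \<in> hom F (add_monoid P)"
  proof (rule homI)
    fix x assume "x \<in> carrier F"
    then show "g x \<in> carrier (add_monoid P)"
      by (auto simp: g_def intro!: P.finsum_closed P.add.int_pow_closed cl)
  next
    fix x y assume xy: "x \<in> carrier F" "y \<in> carrier F"
    define U where "U = Poly_Mapping.keys x \<union> Poly_Mapping.keys y"
    have U: "finite U" "Poly_Mapping.keys x \<subseteq> U" "Poly_Mapping.keys y \<subseteq> U"
      "Poly_Mapping.keys (x + y) \<subseteq> U" "U \<subseteq> ?S"
      using xy keys_add[of x y] by (auto simp: U_def)
    have "g (x + y) = (\<Oplus>\<^bsub>P\<^esub>p \<in> U. [Poly_Mapping.lookup x p] \<cdot>\<^bsub>P\<^esub> ?h p \<oplus>\<^bsub>P\<^esub> [Poly_Mapping.lookup y p] \<cdot>\<^bsub>P\<^esub> ?h p)"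
      unfolding g_sup[OF U(1,4,5)]
      by (rule P.finsum_cong') (use U(5) cl in \<open>auto simp: lookup_add P.add.int_pow_mult
          intro!: P.add.int_pow_closed P.a_closed\<close>)
    also have "\<dots> = g x \<oplus>\<^bsub>P\<^esub> g y"
      unfolding g_sup[OF U(1,2,5)] g_sup[OF U(1,3,5)]
      by (rule P.finsum_addf) (use U(5) cl in \<open>auto intro!: P.add.int_pow_closed\<close>)
    finally show "g (x \<otimes>\<^bsub>F\<^esub> y) = g x \<otimes>\<^bsub>add_monoid P\<^esub> g y" by simp
  qed
  have g_of: "g (frag_of p) = ?h p" if "p \<in> ?S" for p
    using cl[OF that] by (simp add: g_def P.finsum_singleton P.add.int_pow_1)
  interpret g: group_hom F "add_monoid P" g
    using hom by (simp add: group_hom_def group_hom_axioms_def P.a_group)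
  have keysD: "a - b \<in> carrier F" if "a \<in> carrier F" "b \<in> carrier F" for a b
    using that keys_diff[of a b] by auto
  have g_diff: "g (a - b) = g a \<ominus>\<^bsub>P\<^esub> g b" if "a \<in> carrier F" "b \<in> carrier F" for a b
  proof -
    have "g (a - b) \<oplus>\<^bsub>P\<^esub> g b = g a"
      using g.hom_mult[OF keysD[OF that] that(2)] by simp
    then show ?thesis
      using g.hom_closed that keysD[OF that] P.add.inv_solve_right by (simp add: a_minus_def)
  qed
  \<comment> \<open>This is what is left of a biadditivity relation once \<open>g\<close> has been
    applied and the terms are sorted.\<close>
  have canc: "p \<oplus>\<^bsub>P\<^esub> (q \<oplus>\<^bsub>P\<^esub> (\<ominus>\<^bsub>P\<^esub> p \<oplus>\<^bsub>P\<^esub> \<ominus>\<^bsub>P\<^esub> q)) = \<zero>\<^bsub>P\<^esub>"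
    if "p \<in> carrier P" "q \<in> carrier P" for p q
    using that P.a_lcomm[of q "\<ominus>\<^bsub>P\<^esub> p" "\<ominus>\<^bsub>P\<^esub> q"] by (simp add: P.r_neg)
  have G0: "g z = \<zero>\<^bsub>P\<^esub>" if "z \<in> G" for z
  proof -
    have rel: "g r = \<zero>\<^bsub>P\<^esub>" if "r \<in> tensor_relations R M ra N la" for r
      using that f cl ra_closed la_closed unfolding tensor_relations_def
      by (auto simp: g_diff keysD g_of balanced_def additive_def a_minus_def P.a_ac P.r_neg P.minus_add
          simp del: carrier_free_Abelian_group_iff)
        (simp_all add: canc)
    have sub: "x \<in> carrier F" if "x \<in> G" for x
      using group.generate_incl[OF group_free_Abelian_group relations_subset] that by blast
    show ?thesis using that
    proof (induction rule: generate.induct)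
      case one then show ?case using g.hom_one by simp
    next
      case (incl h) then show ?case by (rule rel)
    next
      case (inv h)
      then have "h \<in> carrier F" using relations_subset by blast
      then show ?case using g.hom_inv[of h] rel[OF inv] P.add.inv_one by (simp add: a_inv_def)
    next
      case (eng a b)
      then show ?case using g.hom_mult[OF sub[OF eng(1)] sub[OF eng(2)]] by simp
    qed
  qed
  have "tensor_lift P f (G #>\<^bsub>F\<^esub> z) = g z" if z: "z \<in> carrier F" for z
  proof -
    define z' where "z' = (SOME z'. z' \<in> G #>\<^bsub>F\<^esub> z)"
    have "z \<in> G #>\<^bsub>F\<^esub> z"
      by (rule group.rcos_self[OF group_free_Abelian_group z]) (metis G_normal normal_imp_subgroup)
    then have "z' \<in> G #>\<^bsub>F\<^esub> z" unfolding z'_def by (rule someI)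
    then obtain r where r: "r \<in> G" "z' = r + z" by (auto simp: r_coset_def)
    have "r \<in> carrier F"
      using group.generate_incl[OF group_free_Abelian_group relations_subset] r(1) by blast
    then have "g z' = g z" using g.hom_mult[of r z] z G0[OF r(1)] g.hom_closed[OF z] r(2) by simp
    then show ?thesis by (simp add: tensor_lift_def Let_def g_def flip: z'_def)
  qed
  then show ?thesis using that hom g_of by blast
qed

lemma lift_ten:
  assumes "abelian_group P" "balanced R M ra N la P f" "m \<in> carrier M" "n \<in> carrier N"
  shows "tensor_lift P f (ten T m n) = f m n"
  by (rule lift_coset[OF assms(1,2)]) (use assms(3,4) in \<open>simp add: ten_T\<close>)

lemma lift_additive:
  assumes "abelian_group P" "balanced R M ra N la P f"
  shows "additive T P (tensor_lift P f)"
proof (rule lift_coset[OF assms])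
  fix g assume hom: "g \<in> hom F (add_monoid P)"
    and l: "\<And>z. z \<in> carrier F \<Longrightarrow> tensor_lift P f (G #>\<^bsub>F\<^esub> z) = g z"
  show ?thesis
  proof (rule additiveI)
    fix X assume "X \<in> carrier T"
    then show "tensor_lift P f X \<in> carrier P"
      using hom l by (auto simp: carrier_T hom_def simp del: carrier_free_Abelian_group_iff)
  next
    fix X Y assume "X \<in> carrier T" "Y \<in> carrier T"
    then obtain x y where xy: "x \<in> carrier F" "y \<in> carrier F" "X = G #>\<^bsub>F\<^esub> x" "Y = G #>\<^bsub>F\<^esub> y"
      by (auto simp: carrier_T simp del: carrier_free_Abelian_group_iff)
    have "x + y \<in> carrier F" using xy keys_add[of x y] by auto
    then show "tensor_lift P f (X \<oplus>\<^bsub>T\<^esub> Y) = tensor_lift P f X \<oplus>\<^bsub>P\<^esub> tensor_lift P f Y"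
      using xy l hom add_T[OF xy(1,2)] hom_mult[OF hom xy(1,2)] by simp
  qed
qed

text \<open>Holds for arbitrary functions: every member of a coset is supported on
  \<open>carrier M \<times> carrier N\<close>, so the chosen representative only feeds in arguments
  from the carriers. It is the tool for rewriting inside nested lifts.\<close>

lemma lift_cong:
  assumes "X \<in> carrier T" "abelian_group P"
    and "\<And>m n. m \<in> carrier M \<Longrightarrow> n \<in> carrier N \<Longrightarrow> f m n = g m n"
    and "\<And>m n. m \<in> carrier M \<Longrightarrow> n \<in> carrier N \<Longrightarrow> g m n \<in> carrier P"
  shows "tensor_lift P f X = tensor_lift P g X"
proof -
  interpret P: abelian_group P by fact
  obtain x where x: "x \<in> carrier F" "X = G #>\<^bsub>F\<^esub> x"
    using assms(1) by (auto simp: carrier_T)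
  define z where "z = (SOME z'. z' \<in> X)"
  have "x \<in> X" unfolding x(2)
    by (rule group.rcos_self[OF group_free_Abelian_group x(1)]) (metis G_normal normal_imp_subgroup)
  then have "z \<in> X" unfolding z_def by (rule someI)
  then obtain r where r: "r \<in> G" "z = r + x" using x(2) by (auto simp: r_coset_def)
  have "r \<in> carrier F"
    using group.generate_incl[OF group_free_Abelian_group relations_subset] r(1) by blast
  then have "z \<in> carrier F" using x(1) r(2) keys_add[of r x] by auto
  then have k: "Poly_Mapping.keys z \<subseteq> carrier M \<times> carrier N" by simp
  show ?thesis
    unfolding tensor_lift_def Let_def z_def[symmetric]
    by (rule P.finsum_cong') (use k assms(3,4) in \<open>auto intro!: P.add.int_pow_closed\<close>)
qed

end

lemma subgroup_abelian_group:
  assumes M: "abelian_group M" and S: "S \<subseteq> carrier M" "\<zero>\<^bsub>M\<^esub> \<in> S"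
    "\<And>x y. x \<in> S \<Longrightarrow> y \<in> S \<Longrightarrow> x \<oplus>\<^bsub>M\<^esub> y \<in> S" "\<And>x. x \<in> S \<Longrightarrow> \<ominus>\<^bsub>M\<^esub> x \<in> S"
  shows "abelian_group (M\<lparr>carrier := S\<rparr>)"
proof -
  interpret abelian_group M by fact
  have c: "x \<in> carrier M" if "x \<in> S" for x using S(1) that by blast
  show ?thesis
  proof (rule abelian_groupI)
    fix x assume x: "x \<in> carrier (M\<lparr>carrier := S\<rparr>)"
    then have "\<ominus>\<^bsub>M\<^esub> x \<oplus>\<^bsub>M\<^esub> x = \<zero>\<^bsub>M\<^esub>" using c by (simp add: l_neg)
    then show "\<exists>y \<in> carrier (M\<lparr>carrier := S\<rparr>). y \<oplus>\<^bsub>M\<lparr>carrier := S\<rparr>\<^esub> x = \<zero>\<^bsub>M\<lparr>carrier := S\<rparr>\<^esub>"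
      using x S(4) by (intro bexI[of _ "\<ominus>\<^bsub>M\<^esub> x"]) simp_all
  qed (use S c in \<open>auto simp: a_ac\<close>)
qed

section \<open>Linear and bilinear maps over the ground ring\<close>

lemma additive_sum:
  assumes "additive M N f" "additive M N g" "abelian_group N"
  shows "additive M N (\<lambda>x. f x \<oplus>\<^bsub>N\<^esub> g x)"
proof -
  interpret N: abelian_group N by fact
  show ?thesis
    using assms(1,2) by (auto simp: additive_def N.a_ac)
qed

text \<open>In nested lifts the integrand depends on outer variables. Additivity in such a parameter
  makes the inner lift a legitimate integrand for the next one.\<close>

lemma (in tensor_data) lift_additive_param:
  assumes P: "abelian_group P" and V: "abelian_group V" and X: "X \<in> carrier T"
    and f: "\<And>v. v \<in> carrier V \<Longrightarrow> balanced R M ra N la P (f v)"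
    and add: "\<And>m n. m \<in> carrier M \<Longrightarrow> n \<in> carrier N \<Longrightarrow> additive V P (\<lambda>v. f v m n)"
  shows "additive V P (\<lambda>v. tensor_lift P (f v) X)"
proof (rule additiveI)
  interpret V: abelian_group V by fact
  show "tensor_lift P (f v) X \<in> carrier P" if "v \<in> carrier V" for v
    using additive_closed[OF lift_additive[OF P f] X] that by blast
  fix v w assume vw: "v \<in> carrier V" "w \<in> carrier V"
  show "tensor_lift P (f (v \<oplus>\<^bsub>V\<^esub> w)) X = tensor_lift P (f v) X \<oplus>\<^bsub>P\<^esub> tensor_lift P (f w) X"
    by (rule additive_eqI[OF lift_additive[OF P f] additive_sum[OF lift_additive[OF P f] lift_additive[OF P f] P] X])
      (use vw add in \<open>simp_all add: lift_ten[OF P f] additive_def\<close>)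
qed

lemma tensor_module_simps [simp]:
  "carrier (tensor_module R M ra N la) = carrier (tensor R M ra N la)"
  "\<zero>\<^bsub>tensor_module R M ra N la\<^esub> = \<zero>\<^bsub>tensor R M ra N la\<^esub>"
  "add (tensor_module R M ra N la) = add (tensor R M ra N la)"
  "ten (tensor_module R M ra N la) = ten (tensor R M ra N la)"
  by (simp_all add: tensor_module_def Let_def ten_def fun_eq_iff)

lemma additive_simps:
  assumes "carrier M = carrier M'" "add M = add M'"
  shows "additive M N f = additive M' N f" "additive N M g = additive N M' g"
  using assms by (simp_all add: additive_def)

lemma abelian_group_simps:
  assumes "carrier M = carrier M'" "add M = add M'" "\<zero>\<^bsub>M\<^esub> = \<zero>\<^bsub>M'\<^esub>" "abelian_group M'"
  shows "abelian_group M"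
proof -
  interpret abelian_group M' by fact
  show ?thesis
    by (rule abelian_groupI) (use assms(1-3) in \<open>auto simp: a_ac intro: add.l_inv_ex\<close>)
qed

definition klin :: "('k, 'u) ring_scheme \<Rightarrow> ('k, 'm, 'x) module_scheme \<Rightarrow> ('k, 'n, 'y) module_scheme
    \<Rightarrow> ('m \<Rightarrow> 'n) \<Rightarrow> bool" where
  "klin K V W f \<longleftrightarrow> additive V W f \<and>
     (\<forall>k \<in> carrier K. \<forall>v \<in> carrier V. f (k \<odot>\<^bsub>V\<^esub> v) = k \<odot>\<^bsub>W\<^esub> f v)"

lemma klinI:
  "additive V W f \<Longrightarrow>
   (\<And>k v. k \<in> carrier K \<Longrightarrow> v \<in> carrier V \<Longrightarrow> f (k \<odot>\<^bsub>V\<^esub> v) = k \<odot>\<^bsub>W\<^esub> f v) \<Longrightarrow> klin K V W f"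
  by (simp add: klin_def)

lemma klin_additive: "klin K V W f \<Longrightarrow> additive V W f"
  by (simp add: klin_def)

lemma klin_closed: "klin K V W f \<Longrightarrow> v \<in> carrier V \<Longrightarrow> f v \<in> carrier W"
  by (simp add: klin_def additive_def)

lemma klin_add:
  "klin K V W f \<Longrightarrow> v \<in> carrier V \<Longrightarrow> v' \<in> carrier V \<Longrightarrow> f (v \<oplus>\<^bsub>V\<^esub> v') = f v \<oplus>\<^bsub>W\<^esub> f v'"
  by (simp add: klin_def additive_def)

lemma klin_smult:
  "klin K V W f \<Longrightarrow> k \<in> carrier K \<Longrightarrow> v \<in> carrier V \<Longrightarrow> f (k \<odot>\<^bsub>V\<^esub> v) = k \<odot>\<^bsub>W\<^esub> f v"
  by (simp add: klin_def)

lemma klin_comp: "klin K V W f \<Longrightarrow> klin K W U g \<Longrightarrow> klin K V U (\<lambda>v. g (f v))"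
  by (simp add: klin_def additive_def)

lemma klin_id: "klin K V V (\<lambda>v. v)"
  by (simp add: klin_def additive_def)

lemma linear_map_klin: "f \<in> linear_map K V W \<longleftrightarrow> klin K V W f"
  by (auto simp: linear_map_def klin_def additive_def)

definition kbil :: "('k, 'u) ring_scheme \<Rightarrow> ('k, 'm, 'x) module_scheme \<Rightarrow> ('k, 'n, 'y) module_scheme
    \<Rightarrow> ('k, 'p, 'z) module_scheme \<Rightarrow> ('m \<Rightarrow> 'n \<Rightarrow> 'p) \<Rightarrow> bool" where
  "kbil K V W U f \<longleftrightarrow> (\<forall>w \<in> carrier W. klin K V U (\<lambda>v. f v w)) \<and> (\<forall>v \<in> carrier V. klin K W U (f v))"

lemma kbilI:
  "(\<And>w. w \<in> carrier W \<Longrightarrow> klin K V U (\<lambda>v. f v w)) \<Longrightarrow> (\<And>v. v \<in> carrier V \<Longrightarrow> klin K W U (f v)) \<Longrightarrow>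
   kbil K V W U f"
  by (simp add: kbil_def)

lemma kbil_left: "kbil K V W U f \<Longrightarrow> w \<in> carrier W \<Longrightarrow> klin K V U (\<lambda>v. f v w)"
  by (simp add: kbil_def)

lemma kbil_right: "kbil K V W U f \<Longrightarrow> v \<in> carrier V \<Longrightarrow> klin K W U (f v)"
  by (simp add: kbil_def)

lemma kbil_closed: "kbil K V W U f \<Longrightarrow> v \<in> carrier V \<Longrightarrow> w \<in> carrier W \<Longrightarrow> f v w \<in> carrier U"
  by (simp add: kbil_def klin_def additive_def)

lemma kbil_comp_args:
  assumes "kbil K V W U f" "klin K V' V g" "klin K W' W h"
  shows "kbil K V' W' U (\<lambda>v w. f (g v) (h w))"
  using assms klin_comp[OF assms(2) kbil_left[OF assms(1)]] klin_comp[OF assms(3) kbil_right[OF assms(1)]]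
  by (auto intro!: kbilI simp: klin_closed)

lemma kbil_swap: "kbil K V W U f \<Longrightarrow> kbil K W V U (\<lambda>w v. f v w)"
  by (simp add: kbil_def)

abbreviation kbalanced where
  "kbalanced K V W P f \<equiv> balanced (carrier K) V (\<lambda>v k. k \<odot>\<^bsub>V\<^esub> v) W (\<lambda>k w. k \<odot>\<^bsub>W\<^esub> w) P f"

lemma kbil_balanced: "kbil K V W U f \<Longrightarrow> kbalanced K V W U f"
  by (simp add: kbil_def balanced_def klin_def)

lemma K_algebra_mult_kbil: "K_algebra K A \<Longrightarrow> kbil K A A A (monoid.mult A)"
proof -
  assume A: "K_algebra K A"
  then interpret ring A by (simp add: K_algebra_def)
  show ?thesis
    by (intro kbilI klinI additiveI) (use A in \<open>auto simp: K_algebra_def l_distr r_distr\<close>)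
qed

text \<open>Scalars act through the left factor, as in \<open>tensor_module\<close>;
  \<open>ra_smult\<close> is what lets this action descend to the quotient by the relations.\<close>

locale tensor_module_data = tensor_data R M ra N la
  for R :: "'r set" and M :: "('k, 'm, 'x) module_scheme" and ra :: "'m \<Rightarrow> 'r \<Rightarrow> 'm"
    and N :: "('n, 'y) ring_scheme" and la :: "'r \<Rightarrow> 'n \<Rightarrow> 'n" +
  fixes K :: "('k, 'u) ring_scheme"
  assumes M_module: "module K M"
    and ra_smult: "\<And>k m r. k \<in> carrier K \<Longrightarrow> m \<in> carrier M \<Longrightarrow> r \<in> R \<Longrightarrow>
      ra (k \<odot>\<^bsub>M\<^esub> m) r = k \<odot>\<^bsub>M\<^esub> ra m r"
begin

abbreviation "TM \<equiv> tensor_module R M ra N la"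

lemma smult_balanced:
  assumes "k \<in> carrier K"
  shows "balanced R M ra N la T (\<lambda>m n. ten T (k \<odot>\<^bsub>M\<^esub> m) n)"
proof -
  interpret M: module K M by (rule M_module)
  show ?thesis
    using assms
    by (intro balancedI additiveI)
      (auto simp: ten_closed ten_add_left ten_add_right M.smult_r_distr ten_move ra_smult[symmetric] ra_closed la_closed)
qed

lemma TM_smult: "k \<odot>\<^bsub>TM\<^esub> X = tensor_lift T (\<lambda>m n. ten T (k \<odot>\<^bsub>M\<^esub> m) n) X"
  by (simp add: tensor_module_def Let_def)

lemma TM_smult_ten:
  "k \<in> carrier K \<Longrightarrow> m \<in> carrier M \<Longrightarrow> n \<in> carrier N \<Longrightarrow> k \<odot>\<^bsub>TM\<^esub> ten T m n = ten T (k \<odot>\<^bsub>M\<^esub> m) n"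
  by (simp add: TM_smult lift_ten[OF T_group smult_balanced])

lemma TM_smult_additive: "k \<in> carrier K \<Longrightarrow> additive T T (\<lambda>X. k \<odot>\<^bsub>TM\<^esub> X)"
  unfolding TM_smult by (rule lift_additive[OF T_group smult_balanced])

lemma TM_group: "abelian_group TM"
  by (rule abelian_group_simps[OF _ _ _ T_group]) simp_all

lemma TM_module: "module K TM"
proof -
  interpret M: module K M by (rule M_module)
  interpret T: abelian_group T by (rule T_group)
  note cl = additive_closed[OF TM_smult_additive] and ad = additive_add[OF TM_smult_additive]
  show ?thesis
  proof (rule moduleI)
    show "cring K" by (rule M.R.is_cring)
    show "abelian_group TM" by (rule TM_group)
  next
    fix k x assume "k \<in> carrier K" "x \<in> carrier TM"
    then show "k \<odot>\<^bsub>TM\<^esub> x \<in> carrier TM" using cl by simp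
  next
    fix a b x assume ab: "a \<in> carrier K" "b \<in> carrier K" and x: "x \<in> carrier TM"
    have "additive T T (\<lambda>x. a \<odot>\<^bsub>TM\<^esub> x \<oplus>\<^bsub>T\<^esub> b \<odot>\<^bsub>TM\<^esub> x)"
      by (rule additive_sum[OF TM_smult_additive TM_smult_additive T_group]) (use ab in auto)
    then show "(a \<oplus>\<^bsub>K\<^esub> b) \<odot>\<^bsub>TM\<^esub> x = a \<odot>\<^bsub>TM\<^esub> x \<oplus>\<^bsub>TM\<^esub> b \<odot>\<^bsub>TM\<^esub> x"
      using additive_eqI[OF TM_smult_additive] ab x
      by (simp add: TM_smult_ten M.smult_l_distr ten_add_left)
  next
    fix a x y assume "a \<in> carrier K" "x \<in> carrier TM" "y \<in> carrier TM"
    then show "a \<odot>\<^bsub>TM\<^esub> (x \<oplus>\<^bsub>TM\<^esub> y) = a \<odot>\<^bsub>TM\<^esub> x \<oplus>\<^bsub>TM\<^esub> a \<odot>\<^bsub>TM\<^esub> y" using ad by simp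
  next
    fix a b x assume ab: "a \<in> carrier K" "b \<in> carrier K" and x: "x \<in> carrier TM"
    have "additive T T (\<lambda>x. a \<odot>\<^bsub>TM\<^esub> (b \<odot>\<^bsub>TM\<^esub> x))"
      by (rule additive_comp[OF TM_smult_additive TM_smult_additive]) (use ab in auto)
    then show "(a \<otimes>\<^bsub>K\<^esub> b) \<odot>\<^bsub>TM\<^esub> x = a \<odot>\<^bsub>TM\<^esub> (b \<odot>\<^bsub>TM\<^esub> x)"
      using additive_eqI[OF TM_smult_additive] ab x
      by (simp add: TM_smult_ten M.smult_assoc1)
  next
    fix x assume x: "x \<in> carrier TM"
    have "additive T T (\<lambda>x. x)" by (simp add: additive_def)
    then show "\<one>\<^bsub>K\<^esub> \<odot>\<^bsub>TM\<^esub> x = x"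
      using additive_eqI[OF TM_smult_additive] x
      by (simp add: TM_smult_ten)
  qed
qed

end

lemma tensor_K_data:
  assumes "module K V" "module K W"
  shows "tensor_module_data (carrier K) V (\<lambda>v k. k \<odot>\<^bsub>V\<^esub> v) W (\<lambda>k w. k \<odot>\<^bsub>W\<^esub> w) K"
proof -
  interpret V: module K V by fact
  interpret W: module K W by fact
  show ?thesis
    by unfold_locales (auto simp: V.smult_assoc1[symmetric] V.R.m_comm)
qed

context
  fixes K :: "('k, 'u) ring_scheme" and V :: "('k, 'v, 'x) module_scheme" and W :: "('k, 'w, 'y) module_scheme"
  assumes V: "module K V" and W: "module K W"
begin

interpretation TD: tensor_module_data "carrier K" V "\<lambda>v k. k \<odot>\<^bsub>V\<^esub> v" W "\<lambda>k w. k \<odot>\<^bsub>W\<^esub> w" K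
  by (rule tensor_K_data[OF V W])

abbreviation (input) "VW \<equiv> tensor_K K V W"

lemma tK_module: "module K (tensor_K K V W)"
  by (rule TD.TM_module)

lemma tK_group: "abelian_group (tensor_K K V W)"
  by (rule TD.TM_group)

lemma tK_smult_ten:
  "k \<in> carrier K \<Longrightarrow> v \<in> carrier V \<Longrightarrow> w \<in> carrier W \<Longrightarrow>
    k \<odot>\<^bsub>tensor_K K V W\<^esub> ten (tensor_K K V W) v w = ten (tensor_K K V W) (k \<odot>\<^bsub>V\<^esub> v) w"
  using TD.TM_smult_ten by simp

lemma tK_move:
  "k \<in> carrier K \<Longrightarrow> v \<in> carrier V \<Longrightarrow> w \<in> carrier W \<Longrightarrow>
    ten (tensor_K K V W) (k \<odot>\<^bsub>V\<^esub> v) w = ten (tensor_K K V W) v (k \<odot>\<^bsub>W\<^esub> w)"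
  using TD.ten_move[of v k w] by simp

lemma tK_closed:
  "v \<in> carrier V \<Longrightarrow> w \<in> carrier W \<Longrightarrow> ten (tensor_K K V W) v w \<in> carrier (tensor_K K V W)"
  using TD.ten_closed by simp

lemma tK_kbil: "kbil K V W (tensor_K K V W) (ten (tensor_K K V W))"
proof (intro kbilI klinI additiveI)
  fix k v w assume "k \<in> carrier K" "v \<in> carrier V" "w \<in> carrier W"
  then show "ten VW v (k \<odot>\<^bsub>W\<^esub> w) = k \<odot>\<^bsub>VW\<^esub> ten VW v w"
    using tK_smult_ten[of k v w] tK_move[of k v w] by simp
qed (auto simp: TD.ten_closed TD.ten_add_left TD.ten_add_right TD.TM_smult_ten)

lemma tK_induct:
  assumes "X \<in> carrier (tensor_K K V W)"
    and "\<And>v w. v \<in> carrier V \<Longrightarrow> w \<in> carrier W \<Longrightarrow> P (ten (tensor_K K V W) v w)"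
    and "\<And>X Y. X \<in> carrier (tensor_K K V W) \<Longrightarrow> Y \<in> carrier (tensor_K K V W) \<Longrightarrow> P X \<Longrightarrow> P Y \<Longrightarrow>
      P (X \<oplus>\<^bsub>tensor_K K V W\<^esub> Y)"
  shows "P X"
  using TD.tensor_induct[of X P] assms by simp

lemma tK_eqI:
  assumes "additive (tensor_K K V W) P f" "additive (tensor_K K V W) P g"
    and "X \<in> carrier (tensor_K K V W)"
    and "\<And>v w. v \<in> carrier V \<Longrightarrow> w \<in> carrier W \<Longrightarrow> f (ten (tensor_K K V W) v w) = g (ten (tensor_K K V W) v w)"
  shows "f X = g X"
  using assms(3) by (rule tK_induct) (use assms in \<open>auto simp: additive_add[unfolded tensor_module_simps]
      simp del: tensor_module_simps\<close>)

lemma tK_lift_additive: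
  "abelian_group P \<Longrightarrow> kbalanced K V W P f \<Longrightarrow> additive (tensor_K K V W) P (tensor_lift P f)"
  using TD.lift_additive additive_simps(1)[of VW TD.T P] by simp

lemma tK_lift_ten:
  "abelian_group P \<Longrightarrow> kbalanced K V W P f \<Longrightarrow> v \<in> carrier V \<Longrightarrow> w \<in> carrier W \<Longrightarrow>
    tensor_lift P f (ten (tensor_K K V W) v w) = f v w"
  using TD.lift_ten by simp

lemma tK_lift_klin:
  assumes "module K U" "kbil K V W U f"
  shows "klin K (tensor_K K V W) U (tensor_lift U f)"
proof (rule klinI)
  interpret U: module K U by fact
  interpret V: module K V by (rule V)
  interpret VW: module K VW by (rule tK_module)
  show l: "additive VW U (tensor_lift U f)"
    by (rule tK_lift_additive[OF U.abelian_group_axioms kbil_balanced[OF assms(2)]])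
  fix k X assume k: "k \<in> carrier K" and X: "X \<in> carrier VW"
  have a: "additive VW VW (\<lambda>X. k \<odot>\<^bsub>VW\<^esub> X)" "additive U U (\<lambda>X. k \<odot>\<^bsub>U\<^esub> X)"
    using k by (auto intro!: additiveI simp: U.smult_r_distr VW.smult_r_distr simp del: tensor_module_simps)
  show "tensor_lift U f (k \<odot>\<^bsub>VW\<^esub> X) = k \<odot>\<^bsub>U\<^esub> tensor_lift U f X"
    by (rule tK_eqI[OF additive_comp[OF a(1) l] additive_comp[OF l a(2)] X])
      (use k assms(2) in \<open>simp add: tK_smult_ten tK_lift_ten U.abelian_group_axioms kbil_balanced
          kbil_def[of K V W U] klin_def del: tensor_module_simps\<close>)
qed

lemma tK_lift_cong:
  assumes "X \<in> carrier (tensor_K K V W)" "abelian_group P"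
    and "\<And>m n. m \<in> carrier V \<Longrightarrow> n \<in> carrier W \<Longrightarrow> f m n = g m n"
    and "\<And>m n. m \<in> carrier V \<Longrightarrow> n \<in> carrier W \<Longrightarrow> g m n \<in> carrier P"
  shows "tensor_lift P f X = tensor_lift P g X"
  using TD.lift_cong[of X P f g] assms by simp

lemma tK_lift_param:
  assumes U: "module K U" and X: "module K X"
    and f: "\<And>x. x \<in> carrier X \<Longrightarrow> kbil K V W U (f x)"
    and lin: "\<And>v w. v \<in> carrier V \<Longrightarrow> w \<in> carrier W \<Longrightarrow> klin K X U (\<lambda>x. f x v w)"
  shows "kbil K X (tensor_K K V W) U (\<lambda>x. tensor_lift U (f x))"
proof (rule kbilI)
  interpret U: module K U by fact
  interpret X: module K X by fact
  show "klin K VW U (tensor_lift U (f x))" if "x \<in> carrier X" for x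
    by (rule tK_lift_klin[OF U f[OF that]])
  fix Z assume Z: "Z \<in> carrier VW"
  show "klin K X U (\<lambda>x. tensor_lift U (f x) Z)"
  proof (rule klinI)
    show "additive X U (\<lambda>x. tensor_lift U (f x) Z)"
      by (rule TD.lift_additive_param) (use Z f klin_additive[OF lin] in \<open>auto simp: U.abelian_group_axioms
          X.abelian_group_axioms kbil_balanced\<close>)
    fix k x assume kx: "k \<in> carrier K" "x \<in> carrier X"
    have a: "additive U U (\<lambda>X. k \<odot>\<^bsub>U\<^esub> X)"
      using kx by (auto intro!: additiveI simp: U.smult_r_distr)
    have l: "additive VW U (tensor_lift U (f x))" if "x \<in> carrier X" for x
      by (rule klin_additive[OF tK_lift_klin[OF U f[OF that]]])
    show "tensor_lift U (f (k \<odot>\<^bsub>X\<^esub> x)) Z = k \<odot>\<^bsub>U\<^esub> tensor_lift U (f x) Z"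
      by (rule tK_eqI[OF l additive_comp[OF l a] Z])
        (use kx lin in \<open>simp_all add: tK_lift_ten U.abelian_group_axioms kbil_balanced f
          klin_def del: tensor_module_simps\<close>)
  qed
qed

end

declare tensor_module_simps [simp del]

text \<open>A lift uses only the additive structure of its target, which the scalar field of the
  record leaves alone. This reconciles lifts into modules, as in the definitions, with lifts into
  bare tensor groups, as in the proofs.\<close>

lemma tensor_lift_tensor_module:
  "tensor_lift (tensor_module R M ra N la) f = tensor_lift (tensor R M ra N la) f"
proof -
  have "[k] \<cdot>\<^bsub>tensor_module R M ra N la\<^esub> x = [k] \<cdot>\<^bsub>tensor R M ra N la\<^esub> x" for k :: int and x
    by (cases "k < 0") (simp_all add: add_pow_def int_pow_def nat_pow_def m_inv_def Let_def tensor_module_simps)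
  then show ?thesis
    by (simp add: tensor_lift_def fun_eq_iff finsum_def finprod_def foldD_def tensor_module_simps)
qed

lemma opposite_simps [simp]:
  "carrier (opposite A) = carrier A" "add (opposite A) = add A" "\<zero>\<^bsub>opposite A\<^esub> = \<zero>\<^bsub>A\<^esub>"
  "\<one>\<^bsub>opposite A\<^esub> = \<one>\<^bsub>A\<^esub>" "x \<otimes>\<^bsub>opposite A\<^esub> y = y \<otimes>\<^bsub>A\<^esub> x" "smult (opposite A) = smult A"
  by (simp_all add: opposite_def)

lemma tensor_module_opposite [simp]: "tensor_module R V ra (opposite A) la = tensor_module R V ra A la"
  by (simp add: tensor_module_def tensor_def tensor_relations_def)

lemma opposite_algebra:
  assumes "K_algebra K A"
  shows "K_algebra K (opposite A)"
proof -
  interpret AR: ring A using assms by (simp add: K_algebra_def)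
  interpret Am: module K A using assms by (simp add: K_algebra_def)
  have g: "abelian_group (opposite A)"
    by (rule abelian_group_simps[OF _ _ _ AR.is_abelian_group]) simp_all
  have "module K (opposite A)"
    by (rule moduleI) (auto simp: g Am.smult_r_distr Am.smult_l_distr Am.smult_assoc1 Am.R.is_cring)
  moreover have "ring (opposite A)"
    by (rule ringI) (auto simp: g AR.l_distr AR.r_distr AR.m_assoc intro!: monoidI)
  ultimately show ?thesis using assms by (simp add: K_algebra_def)
qed

text \<open>The relations only involve scalars from \<open>R\<close> and elements of the carriers,
  so the actions may differ elsewhere. This identifies tensor products over source and target
  multiplication with those over the Hopf module actions.\<close>

lemma tensor_cong:
  assumes "carrier M = carrier M'" "add M = add M'" "carrier N = carrier N'" "add N = add N'"
    and "\<And>m r. m \<in> carrier M' \<Longrightarrow> r \<in> R \<Longrightarrow> ra m r = ra' m r"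
    and "\<And>r n. r \<in> R \<Longrightarrow> n \<in> carrier N' \<Longrightarrow> la r n = la' r n"
  shows "tensor R M ra N la = tensor R M' ra' N' la'"
proof -
  have "{frag_of (ra m r, n) - frag_of (m, la r n) | m r n. m \<in> carrier M' \<and> r \<in> R \<and> n \<in> carrier N'}
      = {frag_of (ra' m r, n) - frag_of (m, la' r n) | m r n. m \<in> carrier M' \<and> r \<in> R \<and> n \<in> carrier N'}"
    by (intro Collect_cong ex_cong1) (use assms(5,6) in auto)
  then have "tensor_relations R M ra N la = tensor_relations R M' ra' N' la'"
    unfolding tensor_relations_def using assms(1-4) by simp
  then show ?thesis unfolding tensor_def using assms(1,3) by simp
qed

section \<open>Comodule algebras and the canonical map\<close>

lemma kbil_add_left:
  "kbil K V W U f \<Longrightarrow> v \<in> carrier V \<Longrightarrow> v' \<in> carrier V \<Longrightarrow> w \<in> carrier W \<Longrightarrow>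
    f (v \<oplus>\<^bsub>V\<^esub> v') w = f v w \<oplus>\<^bsub>U\<^esub> f v' w"
  by (simp add: kbil_def klin_def additive_def)

lemma kbil_add_right:
  "kbil K V W U f \<Longrightarrow> v \<in> carrier V \<Longrightarrow> w \<in> carrier W \<Longrightarrow> w' \<in> carrier W \<Longrightarrow>
    f v (w \<oplus>\<^bsub>W\<^esub> w') = f v w \<oplus>\<^bsub>U\<^esub> f v w'"
  by (simp add: kbil_def klin_def additive_def)

lemma kbil_smult_left:
  "kbil K V W U f \<Longrightarrow> k \<in> carrier K \<Longrightarrow> v \<in> carrier V \<Longrightarrow> w \<in> carrier W \<Longrightarrow>
    f (k \<odot>\<^bsub>V\<^esub> v) w = k \<odot>\<^bsub>U\<^esub> f v w"
  by (simp add: kbil_def klin_def)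

lemma kbil_smult_right:
  "kbil K V W U f \<Longrightarrow> k \<in> carrier K \<Longrightarrow> v \<in> carrier V \<Longrightarrow> w \<in> carrier W \<Longrightarrow>
    f v (k \<odot>\<^bsub>W\<^esub> w) = k \<odot>\<^bsub>U\<^esub> f v w"
  by (simp add: kbil_def klin_def)

lemma module_group: "module K V \<Longrightarrow> abelian_group V"
  by (simp add: module_def)

text \<open>Combines the left legs by \<open>f\<close> and multiplies the right legs in
  \<open>H\<close>. The second algebra is a parameter because \<open>opposite A\<close> will take
  its place as well, giving the product of \<open>A \<otimes> A^op\<close>.\<close>

definition hbil ::
  "('k, 'u) ring_scheme \<Rightarrow> ('k, 'h) module \<Rightarrow> ('k, 'p, 'z) module_scheme \<Rightarrow> ('m \<Rightarrow> 'n \<Rightarrow> 'p)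
    \<Rightarrow> ('m, 'h) tensor \<Rightarrow> ('n, 'h) tensor \<Rightarrow> ('p, 'h) tensor" where
  "hbil K H U f X Y = tensor_lift (tensor_K K U H) (\<lambda>v h. tensor_lift (tensor_K K U H)
     (\<lambda>v' h'. ten (tensor_K K U H) (f v v') (h \<otimes>\<^bsub>H\<^esub> h')) Y) X"

text \<open>The map \<open>q \<otimes> id\<close>. With \<open>A\<close> in the role of
  \<open>H\<close> it also yields \<open>kap_pair\<close> and \<open>insert_one\<close>.\<close>

definition hmap ::
  "('k, 'u) ring_scheme \<Rightarrow> ('k, 'h) module \<Rightarrow> ('k, 'p, 'z) module_scheme \<Rightarrow> ('m \<Rightarrow> 'p)
    \<Rightarrow> ('m, 'h) tensor \<Rightarrow> ('p, 'h) tensor" where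
  "hmap K H U q = tensor_lift (tensor_K K U H) (\<lambda>v h. ten (tensor_K K U H) (q v) h)"

locale k_alg =
  fixes K :: "('k, 'u) ring_scheme" and H :: "('k, 'h) module"
  assumes H_alg: "K_algebra K H"
begin

lemma H_module: "module K H" and H_ring: "ring H"
  using H_alg by (simp_all add: K_algebra_def)

lemma H_mult: "kbil K H H H (monoid.mult H)"
  by (rule K_algebra_mult_kbil[OF H_alg])

lemma one_H: "\<one>\<^bsub>H\<^esub> \<in> carrier H"
  using H_ring by (simp add: ring.is_monoid monoid.one_closed)

abbreviation VH where "VH V \<equiv> tensor_K K V H"

text \<open>Bilinearity is built lift by lift: the integrand is linear in each of the four
  variables, so the inner lift is bilinear in the second argument together with either leg of the
  first, and the outer lift inherits this.\<close>

lemma hbil_kbil: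
  assumes V1: "module K V1" and V2: "module K V2" and U: "module K U" and f: "kbil K V1 V2 U f"
  shows "kbil K (VH V1) (VH V2) (VH U) (hbil K H U f)"
    and "v \<in> carrier V1 \<Longrightarrow> h \<in> carrier H \<Longrightarrow> v' \<in> carrier V2 \<Longrightarrow> h' \<in> carrier H \<Longrightarrow>
      hbil K H U f (ten (VH V1) v h) (ten (VH V2) v' h') = ten (VH U) (f v v') (h \<otimes>\<^bsub>H\<^esub> h')"
proof -
  note H = H_module
  have UH: "module K (VH U)" by (rule tK_module[OF U H])
  let ?i = "\<lambda>v h. tensor_lift (VH U) (\<lambda>v' h'. ten (VH U) (f v v') (h \<otimes>\<^bsub>H\<^esub> h'))"
  have b: "kbil K V2 H (VH U) (\<lambda>v' h'. ten (VH U) (f v v') (h \<otimes>\<^bsub>H\<^esub> h'))"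
    if "v \<in> carrier V1" "h \<in> carrier H" for v h
    by (rule kbil_comp_args[OF tK_kbil[OF U H] kbil_right[OF f] kbil_right[OF H_mult]]) fact+
  have l1: "klin K V1 (VH U) (\<lambda>v. ten (VH U) (f v v') (h \<otimes>\<^bsub>H\<^esub> h'))"
    if "v' \<in> carrier V2" "h \<in> carrier H" "h' \<in> carrier H" for v' h h'
    by (rule klin_comp[OF kbil_left[OF f] kbil_left[OF tK_kbil[OF U H]]])
      (use that kbil_closed[OF H_mult] in auto)
  have l2: "klin K H (VH U) (\<lambda>h. ten (VH U) (f v v') (h \<otimes>\<^bsub>H\<^esub> h'))"
    if "v \<in> carrier V1" "v' \<in> carrier V2" "h' \<in> carrier H" for v v' h'
    by (rule klin_comp[OF kbil_left[OF H_mult] kbil_right[OF tK_kbil[OF U H]]])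
      (use that kbil_closed[OF f] in auto)
  have i1: "kbil K V1 (VH V2) (VH U) (\<lambda>v. ?i v h)" if "h \<in> carrier H" for h
    by (rule tK_lift_param[OF V2 H UH V1 b l1]) (use that in auto)
  have i2: "kbil K H (VH V2) (VH U) (\<lambda>h. ?i v h)" if "v \<in> carrier V1" for v
    by (rule tK_lift_param[OF V2 H UH H b l2]) (use that in auto)
  have c: "kbil K V1 H (VH U) (\<lambda>v h. ?i v h Y)" if "Y \<in> carrier (VH V2)" for Y
    by (intro kbilI kbil_left[OF i1] kbil_left[OF i2]) (use that in auto)
  have d: "klin K (VH V2) (VH U) (\<lambda>Y. ?i v h Y)" if "v \<in> carrier V1" "h \<in> carrier H" for v h
    by (rule kbil_right[OF i1]) (use that in auto)
  have "kbil K (VH V2) (VH V1) (VH U) (\<lambda>Y. tensor_lift (VH U) (\<lambda>v h. ?i v h Y))"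
    by (rule tK_lift_param[OF V1 H UH tK_module[OF V2 H] c d])
  then show "kbil K (VH V1) (VH V2) (VH U) (hbil K H U f)"
    unfolding hbil_def by (rule kbil_swap)
  show "hbil K H U f (ten (VH V1) v h) (ten (VH V2) v' h') = ten (VH U) (f v v') (h \<otimes>\<^bsub>H\<^esub> h')"
    if "v \<in> carrier V1" "h \<in> carrier H" "v' \<in> carrier V2" "h' \<in> carrier H"
    unfolding hbil_def using that
    by (simp add: tK_lift_ten[OF V1 H module_group[OF UH] kbil_balanced[OF c]]
        tK_lift_ten[OF V2 H module_group[OF UH] kbil_balanced[OF b]] tK_closed[OF V2 H])
qed

lemma hmap_klin:
  assumes V: "module K V" and U: "module K U" and q: "klin K V U q"
  shows "klin K (VH V) (VH U) (hmap K H U q)"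
    and "v \<in> carrier V \<Longrightarrow> h \<in> carrier H \<Longrightarrow> hmap K H U q (ten (VH V) v h) = ten (VH U) (q v) h"
proof -
  have b: "kbil K V H (VH U) (\<lambda>v h. ten (VH U) (q v) h)"
    by (rule kbil_comp_args[OF tK_kbil[OF U H_module] q klin_id])
  show "klin K (VH V) (VH U) (hmap K H U q)"
    unfolding hmap_def by (rule tK_lift_klin[OF V H_module tK_module[OF U H_module] b])
  show "v \<in> carrier V \<Longrightarrow> h \<in> carrier H \<Longrightarrow> hmap K H U q (ten (VH V) v h) = ten (VH U) (q v) h"
    unfolding hmap_def
    by (rule tK_lift_ten[OF V H_module tK_group[OF U H_module] kbil_balanced[OF b]])
qed

text \<open>Associativity on the right legs is that of \<open>H\<close>. The four maps on the left
  legs are kept apart so that one lemma covers the action of \<open>A \<otimes> H\<close> on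
  \<open>W \<otimes> H\<close>, the Hopf module law for \<open>V \<otimes> A\<close>, and
  associativity of \<open>A \<otimes> A^op\<close>.\<close>

lemma hbil_assoc:
  assumes V1: "module K V1" and V2: "module K V2" and V3: "module K V3"
    and V12: "module K V12" and V23: "module K V23" and U: "module K U"
    and g: "kbil K V1 V2 V12 g" and f: "kbil K V12 V3 U f"
    and g': "kbil K V2 V3 V23 g'" and f': "kbil K V1 V23 U f'"
    and eq: "\<And>x y z. x \<in> carrier V1 \<Longrightarrow> y \<in> carrier V2 \<Longrightarrow> z \<in> carrier V3 \<Longrightarrow> f (g x y) z = f' x (g' y z)"
    and X: "X \<in> carrier (VH V1)" and Y: "Y \<in> carrier (VH V2)" and Z: "Z \<in> carrier (VH V3)"
  shows "hbil K H U f (hbil K H V12 g X Y) Z = hbil K H U f' X (hbil K H V23 g' Y Z)"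
proof -
  interpret ring H by (rule H_ring)
  note H = H_module
  note gH = hbil_kbil[OF V1 V2 V12 g] and fH = hbil_kbil[OF V12 V3 U f]
    and gH' = hbil_kbil[OF V2 V3 V23 g'] and fH' = hbil_kbil[OF V1 V23 U f']
  show ?thesis
    using X
  proof (rule tK_eqI[OF V1 H, rotated 2])
    show "additive (VH V1) (VH U) (\<lambda>X. hbil K H U f (hbil K H V12 g X Y) Z)"
      by (rule klin_additive[OF klin_comp[OF kbil_left[OF gH(1) Y] kbil_left[OF fH(1) Z]]])
    show "additive (VH V1) (VH U) (\<lambda>X. hbil K H U f' X (hbil K H V23 g' Y Z))"
      by (rule klin_additive[OF kbil_left[OF fH'(1) kbil_closed[OF gH'(1) Y Z]]])
    fix x h assume x: "x \<in> carrier V1" "h \<in> carrier H"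
    note xc = tK_closed[OF V1 H x]
    show "hbil K H U f (hbil K H V12 g (ten (VH V1) x h) Y) Z = hbil K H U f' (ten (VH V1) x h) (hbil K H V23 g' Y Z)"
      using Y
    proof (rule tK_eqI[OF V2 H, rotated 2])
      show "additive (VH V2) (VH U) (\<lambda>Y. hbil K H U f (hbil K H V12 g (ten (VH V1) x h) Y) Z)"
        by (rule klin_additive[OF klin_comp[OF kbil_right[OF gH(1) xc] kbil_left[OF fH(1) Z]]])
      show "additive (VH V2) (VH U) (\<lambda>Y. hbil K H U f' (ten (VH V1) x h) (hbil K H V23 g' Y Z))"
        by (rule klin_additive[OF klin_comp[OF kbil_left[OF gH'(1) Z] kbil_right[OF fH'(1) xc]]])
      fix y k assume y: "y \<in> carrier V2" "k \<in> carrier H"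
      note yc = tK_closed[OF V2 H y]
      show "hbil K H U f (hbil K H V12 g (ten (VH V1) x h) (ten (VH V2) y k)) Z
          = hbil K H U f' (ten (VH V1) x h) (hbil K H V23 g' (ten (VH V2) y k) Z)"
        using Z
      proof (rule tK_eqI[OF V3 H, rotated 2])
        show "additive (VH V3) (VH U) (hbil K H U f (hbil K H V12 g (ten (VH V1) x h) (ten (VH V2) y k)))"
          by (rule klin_additive[OF kbil_right[OF fH(1) kbil_closed[OF gH(1) xc yc]]])
        show "additive (VH V3) (VH U) (\<lambda>Z. hbil K H U f' (ten (VH V1) x h) (hbil K H V23 g' (ten (VH V2) y k) Z))"
          by (rule klin_additive[OF klin_comp[OF kbil_right[OF gH'(1) yc] kbil_right[OF fH'(1) xc]]])
      qed (use x y in \<open>simp add: gH(2) fH(2) gH'(2) fH'(2) kbil_closed[OF g] kbil_closed[OF g'] eq m_assoc\<close>)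
    qed
  qed
qed

end

section \<open>Right \<open>A\<close>-modules and the canonical map with coefficients\<close>

definition ract ::
  "('k, 'u) ring_scheme \<Rightarrow> ('k, 'a) module \<Rightarrow> ('k, 'w) module \<Rightarrow> ('w \<Rightarrow> 'a \<Rightarrow> 'w) \<Rightarrow> bool" where
  "ract K A W act \<longleftrightarrow> module K W \<and> kbil K W A W act \<and>
     (\<forall>w \<in> carrier W. \<forall>a \<in> carrier A. \<forall>a' \<in> carrier A. act (act w a) a' = act w (a \<otimes>\<^bsub>A\<^esub> a')) \<and>
     (\<forall>w \<in> carrier W. act w \<one>\<^bsub>A\<^esub> = w)"

lemma K_algebra_ract: "K_algebra K A \<Longrightarrow> ract K A A (monoid.mult A)"
  using K_algebra_mult_kbil[of K A] 
  by (auto simp: ract_def K_algebra_def ring.is_monoid monoid.m_assoc monoid.r_one)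

locale comod = k_alg K H for K :: "('k, 'u) ring_scheme" and H :: "('k, 'h) module" +
  fixes A :: "('k, 'a) module" and \<rho> :: "'a \<Rightarrow> ('a, 'h) tensor"
  assumes A_alg: "K_algebra K A"
    and rho: "klin K A (tensor_K K A H) \<rho>"
    and rho_mult: "\<And>a a'. a \<in> carrier A \<Longrightarrow> a' \<in> carrier A \<Longrightarrow>
      \<rho> (a \<otimes>\<^bsub>A\<^esub> a') = hbil K H A (monoid.mult A) (\<rho> a) (\<rho> a')"
    and rho_one: "\<rho> \<one>\<^bsub>A\<^esub> = ten (tensor_K K A H) \<one>\<^bsub>A\<^esub> \<one>\<^bsub>H\<^esub>"
begin

sublocale A: k_alg K A by unfold_locales (rule A_alg)

lemma rho_closed: "a \<in> carrier A \<Longrightarrow> \<rho> a \<in> carrier (VH A)"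
  by (rule klin_closed[OF rho])

abbreviation B where "B \<equiv> {a \<in> carrier A. \<rho> a = ten (tensor_K K A H) a \<one>\<^bsub>H\<^esub>}"

abbreviation WB :: "('k, 'w) module \<Rightarrow> ('w \<Rightarrow> 'a \<Rightarrow> 'w) \<Rightarrow> ('w, 'a) tensor ring"
  where "WB W act \<equiv> tensor B W act A (monoid.mult A)"

abbreviation D where "D \<equiv> WB A (monoid.mult A)"

text \<open>The right action of the algebra \<open>A \<otimes> H\<close> on
  \<open>W \<otimes> H\<close>.\<close>

abbreviation star :: "('k, 'w) module \<Rightarrow> ('w \<Rightarrow> 'a \<Rightarrow> 'w) \<Rightarrow> ('w, 'h) tensor \<Rightarrow> ('a, 'h) tensor \<Rightarrow> ('w, 'h) tensor"
  where "star W act \<equiv> hbil K H W act"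

lemma WB_data: "ract K A W act \<Longrightarrow> tensor_data B W act A (monoid.mult A)"
  using kbil_closed[of K W A W act] kbil_closed[OF A.H_mult]
  by (auto simp: tensor_data_def ract_def module_group module_group[OF A.H_module])

lemma A_ract: "ract K A A (monoid.mult A)"
  by (rule K_algebra_ract[OF A_alg])

context
  fixes W :: "('k, 'w) module" and act
  assumes W: "ract K A W act"
begin

lemma W_module: "module K W" and W_kbil: "kbil K W A W act"
  and W_assoc: "w \<in> carrier W \<Longrightarrow> a \<in> carrier A \<Longrightarrow> a' \<in> carrier A \<Longrightarrow> act (act w a) a' = act w (a \<otimes>\<^bsub>A\<^esub> a')"
  and W_one: "w \<in> carrier W \<Longrightarrow> act w \<one>\<^bsub>A\<^esub> = w"
  using W by (auto simp: ract_def)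

interpretation WB: tensor_data B W act A "monoid.mult A" by (rule WB_data[OF W])
interpretation D: tensor_data B A "monoid.mult A" A "monoid.mult A" by (rule WB_data[OF A_ract])

lemmas star_kbil = hbil_kbil[OF W_module A.H_module W_module W_kbil]

lemma star_assoc:
  "X \<in> carrier (VH W) \<Longrightarrow> Y \<in> carrier (VH A) \<Longrightarrow> Z \<in> carrier (VH A) \<Longrightarrow>
    star W act (star W act X Y) Z = star W act X (star A (monoid.mult A) Y Z)"
  by (rule hbil_assoc[OF W_module A.H_module A.H_module W_module A.H_module W_module W_kbil W_kbil A.H_mult W_kbil])
    (auto simp: W_assoc)

lemma ten1_klin: "klin K W (VH W) (\<lambda>w. ten (VH W) w \<one>\<^bsub>H\<^esub>)"
  by (rule kbil_left[OF tK_kbil[OF W_module H_module] one_H])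

lemma star_one: "X \<in> carrier (VH W) \<Longrightarrow> star W act X (\<rho> \<one>\<^bsub>A\<^esub>) = X"
proof (rule tK_eqI[OF W_module H_module, where f = "\<lambda>X. star W act X (\<rho> \<one>\<^bsub>A\<^esub>)" and g = "\<lambda>X. X"])
  interpret ring H by (rule H_ring)
  show "additive (VH W) (VH W) (\<lambda>X. star W act X (\<rho> \<one>\<^bsub>A\<^esub>))"
    by (rule klin_additive[OF kbil_left[OF star_kbil(1) rho_closed[OF A.one_H]]])
  show "additive (VH W) (VH W) (\<lambda>X. X)" by (rule klin_additive[OF klin_id])
  show "star W act (ten (VH W) v w) (\<rho> \<one>\<^bsub>A\<^esub>) = ten (VH W) v w" if "v \<in> carrier W" "w \<in> carrier H" for v w
    using that by (simp add: rho_one star_kbil(2) A.one_H W_one)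
qed

text \<open>Through \<open>\<rho>\<close> the space \<open>W \<otimes> H\<close> is itself a right
  \<open>A\<close>-module, so the Galois bijection can be applied to it in place of
  \<open>W\<close>.\<close>

lemma VH_ract: "ract K A (VH W) (\<lambda>X a. star W act X (\<rho> a))"
  unfolding ract_def
  using tK_module[OF W_module H_module] kbil_comp_args[OF star_kbil(1) klin_id rho]
  by (auto simp: star_assoc star_one rho_closed rho_mult)

text \<open>The canonical map with \<open>W\<close> in place of the left factor \<open>A\<close>,
  that is \<open>w \<otimes> e \<mapsto> w e_0 \<otimes> e_1\<close>.\<close>

definition chi :: "('w, 'a) tensor \<Rightarrow> ('w, 'h) tensor" where
  "chi = tensor_lift (VH W) (\<lambda>w e. star W act (ten (VH W) w \<one>\<^bsub>H\<^esub>) (\<rho> e))"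

lemma chi_balanced:
  "balanced B W act A (monoid.mult A) (VH W) (\<lambda>w e. star W act (ten (VH W) w \<one>\<^bsub>H\<^esub>) (\<rho> e))"
proof (rule balancedI)
  interpret H: ring H by (rule H_ring)
  have k: "kbil K W A (VH W) (\<lambda>w e. star W act (ten (VH W) w \<one>\<^bsub>H\<^esub>) (\<rho> e))"
    by (rule kbil_comp_args[OF star_kbil(1) ten1_klin rho])
  show "additive W (VH W) (\<lambda>w. star W act (ten (VH W) w \<one>\<^bsub>H\<^esub>) (\<rho> e))" if "e \<in> carrier A" for e
    using klin_additive[OF kbil_left[OF k that]] .
  show "additive A (VH W) (\<lambda>e. star W act (ten (VH W) w \<one>\<^bsub>H\<^esub>) (\<rho> e))" if "w \<in> carrier W" for w
    using klin_additive[OF kbil_right[OF k that]] .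
  fix w b e assume w: "w \<in> carrier W" and b: "b \<in> B" and e: "e \<in> carrier A"
  have "ten (VH W) (act w b) \<one>\<^bsub>H\<^esub> = star W act (ten (VH W) w \<one>\<^bsub>H\<^esub>) (\<rho> b)"
    using w b by (simp add: star_kbil(2) one_H)
  then show "star W act (ten (VH W) (act w b) \<one>\<^bsub>H\<^esub>) (\<rho> e) = star W act (ten (VH W) w \<one>\<^bsub>H\<^esub>) (\<rho> (b \<otimes>\<^bsub>A\<^esub> e))"
    using w b e star_assoc[OF klin_closed[OF ten1_klin w] rho_closed rho_closed, of b e]
    by (simp add: rho_mult)
qed

lemma chi_ten: "w \<in> carrier W \<Longrightarrow> e \<in> carrier A \<Longrightarrow> chi (ten (WB W act) w e) = star W act (ten (VH W) w \<one>\<^bsub>H\<^esub>) (\<rho> e)"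
  unfolding chi_def by (rule WB.lift_ten[OF tK_group[OF W_module H_module] chi_balanced])

lemma chi_additive: "additive (WB W act) (VH W) chi"
  unfolding chi_def by (rule WB.lift_additive[OF tK_group[OF W_module H_module] chi_balanced])

text \<open>The identification of \<open>W \<otimes>_A (A \<otimes>_B A)\<close> with
  \<open>W \<otimes>_B A\<close>, for one \<open>w\<close> at a time.\<close>

definition eta :: "'w \<Rightarrow> ('a, 'a) tensor \<Rightarrow> ('w, 'a) tensor" where
  "eta w = tensor_lift (WB W act) (\<lambda>u v. ten (WB W act) (act w u) v)"

lemma eta_balanced:
  "w \<in> carrier W \<Longrightarrow> balanced B A (monoid.mult A) A (monoid.mult A) (WB W act) (\<lambda>u v. ten (WB W act) (act w u) v)"
  using W_kbil
  by (intro balancedI additiveI)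
    (auto simp: WB.ten_closed WB.ten_add_left WB.ten_add_right kbil_closed[OF W_kbil]
      kbil_add_right[OF W_kbil] WB.ten_move[symmetric] W_assoc)

lemma eta_ten: "w \<in> carrier W \<Longrightarrow> u \<in> carrier A \<Longrightarrow> v \<in> carrier A \<Longrightarrow> eta w (ten D u v) = ten (WB W act) (act w u) v"
  unfolding eta_def by (rule D.lift_ten[OF WB.T_group eta_balanced])

lemma eta_additive: "w \<in> carrier W \<Longrightarrow> additive D (WB W act) (eta w)"
  unfolding eta_def by (rule D.lift_additive[OF WB.T_group eta_balanced])

lemma eta_additive_left:
  assumes "d \<in> carrier D" shows "additive W (WB W act) (\<lambda>w. eta w d)"
  unfolding eta_def
  by (rule D.lift_additive_param[OF WB.T_group WB.M_group assms eta_balanced])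
    (auto intro!: additiveI simp: WB.ten_closed WB.ten_add_left kbil_closed[OF W_kbil] kbil_add_left[OF W_kbil])

end

end

section \<open>Bijectivity of the canonical map with arbitrary coefficients\<close>

locale galois = comod K H A \<rho>
  for K :: "('k, 'u) ring_scheme" and H :: "('k, 'h) module"
    and A :: "('k, 'a) module" and \<rho> :: "'a \<Rightarrow> ('a, 'h) tensor" +
  fixes can :: "('a, 'a) tensor \<Rightarrow> ('a, 'h) tensor" and DK :: "('k, ('a, 'a) tensor) module"
    and \<tau> :: "'h \<Rightarrow> ('a, 'a) tensor"
  assumes can_def: "can = tensor_lift (VH A) (\<lambda>a a'. tensor_lift (VH A) (\<lambda>a0' a1'. ten (VH A) (a \<otimes>\<^bsub>A\<^esub> a0') a1') (\<rho> a'))"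
    and DK_def: "DK = tensor_module B A (monoid.mult A) A (monoid.mult A)"
    and tau_def: "\<tau> h = the_inv_into (carrier DK) can (ten (VH A) \<one>\<^bsub>A\<^esub> h)"
    and can_bij: "bij_betw can (carrier DK) (carrier (VH A))"
begin

interpretation D: tensor_data B A "monoid.mult A" A "monoid.mult A" by (rule WB_data[OF A_ract])

lemma DK_data: "tensor_module_data B A (monoid.mult A) A (monoid.mult A) K"
  using A.H_module kbil_smult_left[OF A.H_mult]
  by (intro tensor_module_data.intro WB_data[OF A_ract] tensor_module_data_axioms.intro) auto

interpretation DK: tensor_module_data B A "monoid.mult A" A "monoid.mult A" K by (rule DK_data)

lemma DK_simps:
  "carrier DK = carrier D" "add DK = add D" "\<zero>\<^bsub>DK\<^esub> = \<zero>\<^bsub>D\<^esub>" "ten DK = ten D"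
  by (simp_all add: DK_def tensor_module_simps)

lemma DK_module: "module K DK"
  unfolding DK_def by (rule DK.TM_module)

lemma DK_smult_ten:
  "k \<in> carrier K \<Longrightarrow> u \<in> carrier A \<Longrightarrow> v \<in> carrier A \<Longrightarrow> k \<odot>\<^bsub>DK\<^esub> ten D u v = ten D (k \<odot>\<^bsub>A\<^esub> u) v"
  unfolding DK_def by (rule DK.TM_smult_ten)

abbreviation "chiA \<equiv> chi A (monoid.mult A)"

lemma can_eq:
  assumes "X \<in> carrier D" shows "can X = chiA X"
  unfolding can_def chi_def[OF A_ract]
proof (rule D.lift_cong[OF assms])
  show "abelian_group (VH A)" by (rule tK_group[OF A.H_module H_module])
  interpret HR: ring H by (rule H_ring)
  fix a a' assume a: "a \<in> carrier A" "a' \<in> carrier A"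
  have k: "kbil K A H (VH A) (\<lambda>a0' a1'. ten (VH A) (a \<otimes>\<^bsub>A\<^esub> a0') a1')"
    by (rule kbil_comp_args[OF tK_kbil[OF A.H_module H_module] kbil_right[OF A.H_mult a(1)] klin_id])
  note s = star_kbil[OF A_ract]
  show "tensor_lift (VH A) (\<lambda>a0' a1'. ten (VH A) (a \<otimes>\<^bsub>A\<^esub> a0') a1') (\<rho> a')
      = star A (monoid.mult A) (ten (VH A) a \<one>\<^bsub>H\<^esub>) (\<rho> a')"
    by (rule tK_eqI[OF A.H_module H_module klin_additive[OF tK_lift_klin[OF A.H_module H_module _ k]]
          klin_additive[OF kbil_right[OF s(1)]] rho_closed])
      (use a in \<open>auto simp: tK_module[OF A.H_module H_module] tK_closed[OF A.H_module H_module] one_H s(2)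
        tK_lift_ten[OF A.H_module H_module tK_group[OF A.H_module H_module] kbil_balanced[OF k]]\<close>)
  show "star A (monoid.mult A) (ten (VH A) a \<one>\<^bsub>H\<^esub>) (\<rho> a') \<in> carrier (VH A)"
    using a by (auto intro!: kbil_closed[OF s(1)] rho_closed tK_closed[OF A.H_module H_module] one_H)
qed

lemma chiA_bij: "bij_betw chiA (carrier D) (carrier (VH A))"
  using can_bij by (simp add: DK_simps bij_betw_cong[OF can_eq])

lemma chiA_inj: "X \<in> carrier D \<Longrightarrow> Y \<in> carrier D \<Longrightarrow> chiA X = chiA Y \<Longrightarrow> X = Y"
  using chiA_bij by (auto simp: bij_betw_def inj_on_def)

lemma tau:
  assumes "h \<in> carrier H"
  shows tau_closed: "\<tau> h \<in> carrier D" and chi_tau: "chiA (\<tau> h) = ten (VH A) \<one>\<^bsub>A\<^esub> h"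
proof -
  have c: "ten (VH A) \<one>\<^bsub>A\<^esub> h \<in> carrier (VH A)"
    using assms by (simp add: tK_closed[OF A.H_module H_module] A.one_H)
  have i: "inj_on can (carrier DK)" "can ` carrier DK = carrier (VH A)"
    using can_bij by (auto simp: bij_betw_def)
  show t: "\<tau> h \<in> carrier D"
    using the_inv_into_into[OF i(1), of _ "carrier DK"] c i(2) by (simp add: tau_def DK_simps)
  have "can (\<tau> h) = ten (VH A) \<one>\<^bsub>A\<^esub> h"
    using f_the_inv_into_f[OF i(1)] c i(2) by (simp add: tau_def)
  then show "chiA (\<tau> h) = ten (VH A) \<one>\<^bsub>A\<^esub> h" using can_eq[OF t] by simp
qed

context
  fixes W :: "('k, 'w) module" and act
  assumes W: "ract K A W act"
begin

interpretation WB: tensor_data B W act A "monoid.mult A" by (rule WB_data[OF W])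
interpretation HR: ring H by (rule H_ring)
interpretation AR: ring A by (rule A.H_ring)
interpretation Wm: module K W by (rule W_module[OF W])

lemma chi_eta:
  assumes w: "w \<in> carrier W" and d: "d \<in> carrier D"
  shows "chi W act (eta W act w d) = star W act (ten (VH W) w \<one>\<^bsub>H\<^esub>) (chiA d)"
proof -
  note w1 = klin_closed[OF ten1_klin[OF W] w]
  show ?thesis
  proof (rule D.additive_eqI[OF additive_comp[OF eta_additive[OF W w] chi_additive[OF W]]
        additive_comp[OF chi_additive[OF A_ract] klin_additive[OF kbil_right[OF star_kbil(1)[OF W] w1]]] d])
    fix u v assume uv: "u \<in> carrier A" "v \<in> carrier A"
    have "star W act (ten (VH W) w \<one>\<^bsub>H\<^esub>) (ten (VH A) u \<one>\<^bsub>H\<^esub>) = ten (VH W) (act w u) \<one>\<^bsub>H\<^esub>"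
      using w uv by (simp add: star_kbil(2)[OF W])
    then show "chi W act (eta W act w (ten D u v)) = star W act (ten (VH W) w \<one>\<^bsub>H\<^esub>) (chiA (ten D u v))"
      using w uv star_assoc[OF W w1 klin_closed[OF ten1_klin[OF A_ract] uv(1)] rho_closed[OF uv(2)]]
      by (simp add: eta_ten[OF W] chi_ten[OF W] chi_ten[OF A_ract] kbil_closed[OF W_kbil[OF W]])
  qed
qed

text \<open>As \<open>chiA (\<tau> h)\<close> is \<open>1 \<otimes> h\<close>, the assignment
  \<open>w \<otimes> h \<mapsto> w \<tau>(h)\<close> is a right inverse of \<open>chi\<close>; this
  is where \<open>chi_inv\<close> comes from.\<close>

lemma chi_eta_tau:
  assumes "w \<in> carrier W" "h \<in> carrier H"
  shows "chi W act (eta W act w (\<tau> h)) = ten (VH W) w h"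
  using assms by (simp add: chi_eta tau_closed chi_tau star_kbil(2)[OF W] A.one_H W_one[OF W])

lemma eta_act:
  assumes w: "w \<in> carrier W" and a: "a \<in> carrier A" and d: "d \<in> carrier D"
  shows "eta W act (act w a) d = eta W act w (eta A (monoid.mult A) a d)"
  by (rule D.additive_eqI[OF eta_additive[OF W] additive_comp[OF eta_additive[OF A_ract] eta_additive[OF W]] d])
    (use w a in \<open>auto simp: eta_ten[OF W] eta_ten[OF A_ract] kbil_closed[OF W_kbil[OF W]] W_assoc[OF W]\<close>)

lemma eta_smult:
  assumes w: "w \<in> carrier W" and k: "k \<in> carrier K" and d: "d \<in> carrier D"
  shows "eta W act (k \<odot>\<^bsub>W\<^esub> w) d = eta W act w (k \<odot>\<^bsub>DK\<^esub> d)"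
proof -
  have "additive D D (\<lambda>d. k \<odot>\<^bsub>DK\<^esub> d)"
    using DK.TM_smult_additive[OF k] by (simp add: DK_def)
  note am = additive_comp[OF this eta_additive[OF W w]]
  show ?thesis
    by (rule D.additive_eqI[OF eta_additive[OF W] am d])
      (use w k module.smult_closed[OF A.H_module] in \<open>auto simp: eta_ten[OF W] DK_smult_ten
        kbil_smult_left[OF W_kbil[OF W]] kbil_smult_right[OF W_kbil[OF W]]\<close>)
qed

end

lemma chiA_klin: "klin K DK (VH A) chiA"
proof (rule klinI)
  show "additive DK (VH A) chiA"
    using chi_additive[OF A_ract] by (simp add: additive_def DK_simps)
  interpret Am: module K A by (rule A.H_module)
  interpret VHA: module K "VH A" by (rule tK_module[OF A.H_module H_module])
  fix k d assume k: "k \<in> carrier K" and d: "d \<in> carrier DK"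
  have a1: "additive D D (\<lambda>d. k \<odot>\<^bsub>DK\<^esub> d)"
    using DK.TM_smult_additive[OF k] by (simp add: DK_def)
  have a2: "additive (VH A) (VH A) (\<lambda>d. k \<odot>\<^bsub>VH A\<^esub> d)"
    using k by (auto intro!: additiveI simp: VHA.smult_r_distr)
  show "chiA (k \<odot>\<^bsub>DK\<^esub> d) = k \<odot>\<^bsub>VH A\<^esub> chiA d"
    by (rule D.additive_eqI[OF additive_comp[OF a1 chi_additive[OF A_ract]] additive_comp[OF chi_additive[OF A_ract] a2]])
      (use d k in \<open>auto simp: DK_simps DK_smult_ten chi_ten[OF A_ract] klin_smult[OF ten1_klin[OF A_ract]]
        kbil_smult_left[OF star_kbil(1)[OF A_ract]] klin_closed[OF ten1_klin[OF A_ract]] rho_closed\<close>)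
qed

text \<open>Linearity is tested after the injective linear map \<open>chiA\<close>, which turns
  \<open>\<tau> h\<close> into \<open>1 \<otimes> h\<close>.\<close>

lemma tau_klin: "klin K H DK \<tau>"
proof (intro klinI additiveI)
  interpret Hm: module K H by (rule H_module)
  interpret DKm: module K DK by (rule DK_module)
  show "\<tau> h \<in> carrier DK" if "h \<in> carrier H" for h using tau_closed[OF that] by (simp add: DK_simps)
  note t = kbil_right[OF tK_kbil[OF A.H_module H_module] A.one_H]
  note c = tau_closed[folded DK_simps]
  note i = chiA_inj[folded DK_simps]
  show "\<tau> (h \<oplus>\<^bsub>H\<^esub> h') = \<tau> h \<oplus>\<^bsub>DK\<^esub> \<tau> h'" if "h \<in> carrier H" "h' \<in> carrier H" for h h'
    by (rule i) (use that c in \<open>auto simp: klin_add[OF chiA_klin] chi_tau klin_add[OF t]\<close>)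
  show "\<tau> (k \<odot>\<^bsub>H\<^esub> h) = k \<odot>\<^bsub>DK\<^esub> \<tau> h" if "k \<in> carrier K" "h \<in> carrier H" for k h
    by (rule i) (use that c in \<open>auto simp: klin_smult[OF chiA_klin] chi_tau klin_smult[OF t]\<close>)
qed

context
  fixes W :: "('k, 'w) module" and act
  assumes W: "ract K A W act"
begin

interpretation WB: tensor_data B W act A "monoid.mult A" by (rule WB_data[OF W])
interpretation HR: ring H by (rule H_ring)
interpretation AR: ring A by (rule A.H_ring)
interpretation Wm: module K W by (rule W_module[OF W])
interpretation Dg: abelian_group D by (rule D.T_group)

lemma chi_inv_kbalanced: "kbalanced K W H (WB W act) (\<lambda>w h. eta W act w (\<tau> h))"
proof (rule balancedI)
  show "additive W (WB W act) (\<lambda>w. eta W act w (\<tau> h))" if "h \<in> carrier H" for h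
    by (rule eta_additive_left[OF W tau_closed[OF that]])
  show "additive H (WB W act) (\<lambda>h. eta W act w (\<tau> h))" if "w \<in> carrier W" for w
    using klin_additive[OF tau_klin] eta_additive[OF W that]
    by (auto simp: additive_def DK_simps)
  show "eta W act (k \<odot>\<^bsub>W\<^esub> w) (\<tau> h) = eta W act w (\<tau> (k \<odot>\<^bsub>H\<^esub> h))"
    if "w \<in> carrier W" "k \<in> carrier K" "h \<in> carrier H" for w k h
    using that by (simp add: eta_smult[OF W] tau_closed klin_smult[OF tau_klin])
qed

definition chi_inv where "chi_inv = tensor_lift (WB W act) (\<lambda>w h. eta W act w (\<tau> h))"

lemma chi_inv_ten:
  "w \<in> carrier W \<Longrightarrow> h \<in> carrier H \<Longrightarrow> chi_inv (ten (VH W) w h) = eta W act w (\<tau> h)"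
  unfolding chi_inv_def
  by (rule tK_lift_ten[OF W_module[OF W] H_module WB.T_group chi_inv_kbalanced])

lemma chi_inv_additive: "additive (VH W) (WB W act) chi_inv"
  unfolding chi_inv_def
  by (rule tK_lift_additive[OF W_module[OF W] H_module WB.T_group chi_inv_kbalanced])

text \<open>The inverse of \<open>chiA\<close> sends \<open>a \<otimes> h\<close> to
  \<open>a \<tau>(h)\<close>, and \<open>chi_inv\<close> sends \<open>w a \<otimes> h\<close> to
  \<open>w a \<tau>(h)\<close>; so both are governed by the single translation map.\<close>

lemma chi_inv_star:
  assumes w: "w \<in> carrier W" and d: "d \<in> carrier D"
  shows "chi_inv (star W act (ten (VH W) w \<one>\<^bsub>H\<^esub>) (chiA d)) = eta W act w d"
proof -
  let ?i = "the_inv_into (carrier D) chiA"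
  note i = additive_the_inv[OF chi_additive[OF A_ract] chiA_bij D.T_group]
  note w1 = klin_closed[OF ten1_klin[OF W] w]
  have inv: "?i (chiA d) = d" if "d \<in> carrier D" for d
    using chiA_bij that by (simp add: bij_betw_def the_inv_into_f_f)
  \<comment> \<open>Generalised from \<open>chiA d\<close> to every element of
    \<open>A \<otimes> H\<close>, so that it can be checked on pure tensors.\<close>
  have "chi_inv (star W act (ten (VH W) w \<one>\<^bsub>H\<^esub>) Z) = eta W act w (?i Z)" if "Z \<in> carrier (VH A)" for Z
  proof (rule tK_eqI[OF A.H_module H_module additive_comp[OF klin_additive[OF kbil_right[OF star_kbil(1)[OF W] w1]] chi_inv_additive]
        additive_comp[OF i eta_additive[OF W w]] that])
    fix a h assume ah: "a \<in> carrier A" "h \<in> carrier H"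
    have e: "eta A (monoid.mult A) a (\<tau> h) \<in> carrier D"
      using additive_closed[OF eta_additive[OF A_ract ah(1)]] tau_closed[OF ah(2)] by simp
    have "?i (ten (VH A) a h) = eta A (monoid.mult A) a (\<tau> h)"
      using inv[OF e] chi_eta_tau[OF A_ract ah] by simp
    then show "chi_inv (star W act (ten (VH W) w \<one>\<^bsub>H\<^esub>) (ten (VH A) a h)) = eta W act w (?i (ten (VH A) a h))"
      using w ah by (simp add: star_kbil(2)[OF W] chi_inv_ten kbil_closed[OF W_kbil[OF W]] eta_act[OF W] tau_closed)
  qed
  from this[OF additive_closed[OF chi_additive[OF A_ract] d]] inv[OF d] show ?thesis by simp
qed

lemma chi_inv_chi:
  assumes "X \<in> carrier (WB W act)"
  shows "chi_inv (chi W act X) = X"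
proof (rule WB.additive_eqI[OF additive_comp[OF chi_additive[OF W] chi_inv_additive] _ assms])
  show "additive (WB W act) (WB W act) (\<lambda>x. x)" by (simp add: additive_def)
  fix w e assume we: "w \<in> carrier W" "e \<in> carrier A"
  \<comment> \<open>So \<open>chi\<close> of \<open>w \<otimes> e\<close> is the instance
    \<open>d = 1 \<otimes> e\<close> of \<open>chi_inv_star\<close>.\<close>
  have "chiA (ten D \<one>\<^bsub>A\<^esub> e) = \<rho> e"
  proof -
    have "chiA (ten D \<one>\<^bsub>A\<^esub> e) = star A (monoid.mult A) (\<rho> \<one>\<^bsub>A\<^esub>) (\<rho> e)"
      using we by (simp add: chi_ten[OF A_ract] rho_one)
    also have "\<dots> = \<rho> e" using we rho_mult[of "\<one>\<^bsub>A\<^esub>" e] by simp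
    finally show ?thesis .
  qed
  then show "chi_inv (chi W act (ten (WB W act) w e)) = ten (WB W act) w e"
    using chi_inv_star[OF we(1) D.ten_closed[OF AR.one_closed we(2)]] we
    by (simp add: chi_ten[OF W] eta_ten[OF W] W_one[OF W])
qed

lemma chi_bij: "bij_betw (chi W act) (carrier (WB W act)) (carrier (VH W))"
proof (rule bij_betwI[where g = chi_inv])
  show "chi W act \<in> carrier (WB W act) \<rightarrow> carrier (VH W)"
    using additive_closed[OF chi_additive[OF W]] by auto
  show "chi_inv \<in> carrier (VH W) \<rightarrow> carrier (WB W act)"
    using additive_closed[OF chi_inv_additive] by auto
  show "chi_inv (chi W act X) = X" if "X \<in> carrier (WB W act)" for X by (rule chi_inv_chi[OF that])
  show "chi W act (chi_inv Y) = Y" if "Y \<in> carrier (VH W)" for Y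
    by (rule tK_eqI[OF W_module[OF W] H_module additive_comp[OF chi_inv_additive chi_additive[OF W]] _ that])
      (auto simp: chi_inv_ten chi_eta_tau[OF W] additive_def)
qed

end

end

section \<open>Flatness for modules in arbitrary types\<close>

text \<open>
  Faithful flatness is only assumed for modules whose carriers live in a fixed type of sets of lists.
  Iterated tensor products are moved there by describing their elements by finite lists of lists.
\<close>

fun escape :: "'c \<Rightarrow> 'c \<Rightarrow> 'c list \<Rightarrow> 'c list" where
  "escape p q [] = [q]"
| "escape p q (x # xs) = p # x # escape p q xs"

text \<open>Each letter is announced by \<open>p\<close> and the end of the word by
  \<open>q\<close>, so escaped words form a prefix-free code: reading from the left shows where the
  word stops.\<close>

lemma escape_append_inject:
  assumes "p \<noteq> q"
  shows "escape p q l @ r = escape p q l' @ r' \<Longrightarrow> l = l' \<and> r = r'"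
proof (induction l arbitrary: l')
  case Nil
  then show ?case using assms by (cases l') auto
next
  case (Cons x xs)
  then show ?case using assms by (cases l') auto
qed

lemma inj_concat_escape:
  assumes "p \<noteq> q"
  shows "inj (\<lambda>ls. concat (map (escape p q) ls))"
proof (rule injI)
  fix ls ls' :: "'a list list"
  have ne: "escape p q l \<noteq> []" for l by (cases l) auto
  show "concat (map (escape p q) ls) = concat (map (escape p q) ls') \<Longrightarrow> ls = ls'"
  proof (induction ls arbitrary: ls')
    case Nil
    then show ?case using ne by (cases ls') auto
  next
    case (Cons l ls)
    then show ?case
      using ne by (cases ls') (auto dest!: escape_append_inject[OF assms])
  qed
qed

text \<open>A surjection from words, not an injection into words: this form passes directly to
  tensor products, whose elements have many presentations as sums of pairs.\<close>

definition encodable :: "'c itself \<Rightarrow> 'x set \<Rightarrow> bool" where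
  "encodable _ S \<longleftrightarrow> (\<exists>d :: 'c list \<Rightarrow> 'x. S \<subseteq> range d)"

lemma encodable_subset: "encodable TYPE('c) S \<Longrightarrow> S' \<subseteq> S \<Longrightarrow> encodable TYPE('c) S'"
  by (auto simp: encodable_def)

lemma encodable_Inl: "encodable TYPE('a + 'b) (S :: 'a set)"
  unfolding encodable_def
  by (rule exI[of _ "\<lambda>l. projl (hd l)"]) (auto intro!: range_eqI[of _ _ "[Inl _]"])

lemma encodable_Inr: "encodable TYPE('a + 'b) (S :: 'b set)"
  unfolding encodable_def
  by (rule exI[of _ "\<lambda>l. projr (hd l)"]) (auto intro!: range_eqI[of _ _ "[Inr _]"])

text \<open>An element is represented by the whole set of its codes. This is why the universe of
  test modules consists of sets of lists.\<close>

lemma encodable_inj: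
  fixes S :: "'x set"
  assumes "encodable TYPE('c) S"
  obtains e :: "'x \<Rightarrow> 'c list set" where "inj_on e S"
proof -
  obtain d :: "'c list \<Rightarrow> 'x" where d: "S \<subseteq> range d" using assms by (auto simp: encodable_def)
  have "inj_on (\<lambda>x. {l. d l = x}) S"
  proof (rule inj_onI)
    fix x y assume "x \<in> S" and eq: "{l. d l = x} = {l. d l = y}"
    then obtain l where "d l = x" using d by auto
    then show "x = y" using eq by auto
  qed
  then show ?thesis using that by blast
qed

lemma (in tensor_data) encodable_tensor:
  assumes "(p :: 'c) \<noteq> q" and "encodable TYPE('c) (carrier M)" and "encodable TYPE('c) (carrier N)"
  shows "encodable TYPE('c) (carrier T)"
proof -
  interpret T: abelian_group T by (rule T_group)
  obtain delta_M :: "'c list \<Rightarrow> 'm" where delta_M: "carrier M \<subseteq> range delta_M" using assms by (auto simp: encodable_def)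
  obtain dN :: "'c list \<Rightarrow> 'n" where dN: "carrier N \<subseteq> range dN" using assms by (auto simp: encodable_def)
  \<comment> \<open>A pure tensor is coded by a list of two words, read off by \<open>hd\<close> and
    \<open>last\<close>, and a sum by a list of such lists; escaping twice flattens this to a single
    word.\<close>
  define i where "i = (\<lambda>ls :: 'c list list list. concat (map (escape p q) (map (\<lambda>l. concat (map (escape p q) l)) ls)))"
  define F where "F = (\<lambda>ls. foldr (\<lambda>l X. ten T (delta_M (hd l)) (dN (last l)) \<oplus>\<^bsub>T\<^esub> X) ls \<zero>\<^bsub>T\<^esub>)"
  \<comment> \<open>Words may decode to values outside the carriers, so evaluation is only
    controlled on codes all of whose entries land inside.\<close>
  define ok where "ok ls \<longleftrightarrow> (\<forall>l \<in> set ls. delta_M (hd l) \<in> carrier M \<and> dN (last l) \<in> carrier N)" for ls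
  have "inj i"
    unfolding i_def
    using inj_compose[OF inj_concat_escape[OF assms(1)] inj_mapI[OF inj_concat_escape[OF assms(1)]]]
    by (simp add: comp_def)
  then have i: "inv_into UNIV i (i ls) = ls" for ls by simp
  have F_closed: "F ls \<in> carrier T" if "ok ls" for ls
    using that by (induction ls) (auto simp: F_def ok_def ten_closed)
  have F_append: "F (ls @ ls') = F ls \<oplus>\<^bsub>T\<^esub> F ls'" if "ok ls" "ok ls'" for ls ls'
    using that
  proof (induction ls)
    case Nil
    then show ?case using F_closed[of ls'] by (simp add: F_def)
  next
    case (Cons l ls)
    then have "ok ls" by (simp add: ok_def)
    then show ?case
      using Cons F_closed[OF \<open>ok ls\<close>] F_closed[of ls'] by (auto simp: F_def ok_def T.a_assoc ten_closed)
  qed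
  have "\<exists>ls. ok ls \<and> X = F ls" if "X \<in> carrier T" for X
    using that
  proof (rule tensor_induct)
    fix m n assume mn: "m \<in> carrier M" "n \<in> carrier N"
    then obtain x y where "m = delta_M x" "n = dN y" using delta_M dN by blast
    then show "\<exists>ls. ok ls \<and> ten T m n = F ls"
      using mn by (intro exI[of _ "[[x, y]]"]) (simp add: ok_def F_def ten_closed)
  next
    fix X Y assume "\<exists>ls. ok ls \<and> X = F ls" "\<exists>ls. ok ls \<and> Y = F ls"
    then obtain ls ls' where "ok ls" "X = F ls" "ok ls'" "Y = F ls'" by auto
    then show "\<exists>ls. ok ls \<and> X \<oplus>\<^bsub>T\<^esub> Y = F ls"
      by (intro exI[of _ "ls @ ls'"]) (auto simp: F_append ok_def)
  qed
  then have "carrier T \<subseteq> range (\<lambda>l. F (inv_into UNIV i l))"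
    using i by (metis rangeI subsetI)
  then show ?thesis unfolding encodable_def by blast
qed

text \<open>\<open>rmod\<close> and \<open>rhom\<close> are \<open>right_module\<close> and \<open>right_module_hom\<close> for records with further fields.\<close>

definition rmod :: "('b, 'u) ring_scheme \<Rightarrow> ('m, 'x) ring_scheme \<Rightarrow> ('m \<Rightarrow> 'b \<Rightarrow> 'm) \<Rightarrow> bool" where
  "rmod B M ra \<longleftrightarrow> abelian_group M \<and>
     (\<forall>m \<in> carrier M. \<forall>b \<in> carrier B. ra m b \<in> carrier M) \<and>
     (\<forall>m \<in> carrier M. \<forall>m' \<in> carrier M. \<forall>b \<in> carrier B.
        ra (m \<oplus>\<^bsub>M\<^esub> m') b = ra m b \<oplus>\<^bsub>M\<^esub> ra m' b) \<and>
     (\<forall>m \<in> carrier M. \<forall>b \<in> carrier B. \<forall>b' \<in> carrier B.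
        ra m (b \<oplus>\<^bsub>B\<^esub> b') = ra m b \<oplus>\<^bsub>M\<^esub> ra m b' \<and>
        ra m (b \<otimes>\<^bsub>B\<^esub> b') = ra (ra m b) b') \<and>
     (\<forall>m \<in> carrier M. ra m \<one>\<^bsub>B\<^esub> = m)"

definition rhom :: "('b, 'u) ring_scheme \<Rightarrow> ('m, 'x) ring_scheme \<Rightarrow> ('m \<Rightarrow> 'b \<Rightarrow> 'm) \<Rightarrow> ('n, 'y) ring_scheme
    \<Rightarrow> ('n \<Rightarrow> 'b \<Rightarrow> 'n) \<Rightarrow> ('m \<Rightarrow> 'n) \<Rightarrow> bool" where
  "rhom B M ra N rb f \<longleftrightarrow> additive M N f \<and>
     (\<forall>m \<in> carrier M. \<forall>b \<in> carrier B. f (ra m b) = rb (f m) b)"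

text \<open>\<open>N\<close> enters exactness only through the zero set of \<open>g\<close>, so
  injectivity of \<open>w\<close> and preservation of zero are enough there.\<close>

lemma exact_pair_transfer:
  assumes u: "bij_betw u (carrier L) (carrier L')" and v: "bij_betw v (carrier M) (carrier M')"
    and w: "inj_on w (carrier N)" "w \<zero>\<^bsub>N\<^esub> = \<zero>\<^bsub>N'\<^esub>" "\<zero>\<^bsub>N\<^esub> \<in> carrier N"
    and f: "\<And>x. x \<in> carrier L \<Longrightarrow> f' (u x) = v (f x)" and fc: "\<And>x. x \<in> carrier L \<Longrightarrow> f x \<in> carrier M"
    and g: "\<And>x. x \<in> carrier M \<Longrightarrow> g' (v x) = w (g x)" and gc: "\<And>x. x \<in> carrier M \<Longrightarrow> g x \<in> carrier N"
  shows "exact_pair L f M g N \<longleftrightarrow> exact_pair L' f' M' g' N'"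
proof -
  have vi: "inj_on v (carrier M)" and vs: "v ` carrier M = carrier M'" using v by (auto simp: bij_betw_def)
  have 1: "f' ` carrier L' = v ` (f ` carrier L)"
    using image_cong[OF refl f, of "carrier L" "\<lambda>x. x"] by (simp add: bij_betw_imp_surj_on[OF u, symmetric] image_image)
  have k: "g' (v x) = \<zero>\<^bsub>N'\<^esub> \<longleftrightarrow> g x = \<zero>\<^bsub>N\<^esub>" if "x \<in> carrier M" for x
    using g[OF that] w gc[OF that] by (metis inj_onD)
  have 2: "{m \<in> carrier M'. g' m = \<zero>\<^bsub>N'\<^esub>} = v ` {m \<in> carrier M. g m = \<zero>\<^bsub>N\<^esub>}"
    unfolding vs[symmetric] using k by auto
  show ?thesis
    unfolding exact_pair_def 1 2
    using inj_on_image_eq_iff[OF vi, of "f ` carrier L" "{m \<in> carrier M. g m = \<zero>\<^bsub>N\<^esub>}"] fc by blast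
qed

section \<open>The functor \<open>- \<otimes>_B A\<close> on right \<open>B\<close>-modules\<close>

definition tmap :: "(('n, 'a) tensor, 'x) ring_scheme \<Rightarrow> ('m \<Rightarrow> 'n) \<Rightarrow> ('m, 'a) tensor \<Rightarrow> ('n, 'a) tensor" where
  "tmap NA f = tensor_lift NA (\<lambda>m a. ten NA (f m) a)"

locale left_mod =
  fixes B :: "('b, 'u) ring_scheme" and A :: "('a, 'v) ring_scheme" and la :: "'b \<Rightarrow> 'a \<Rightarrow> 'a"
  assumes A_group: "abelian_group A"
    and la_cl: "\<And>b a. b \<in> carrier B \<Longrightarrow> a \<in> carrier A \<Longrightarrow> la b a \<in> carrier A"
begin

abbreviation tA :: "('m, 'x) ring_scheme \<Rightarrow> ('m \<Rightarrow> 'b \<Rightarrow> 'm) \<Rightarrow> ('m, 'a) tensor ring"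
  where "tA M ra \<equiv> tensor (carrier B) M ra A la"

lemma tA_data: "rmod B M ra \<Longrightarrow> tensor_data (carrier B) M ra A la"
  by (auto simp: tensor_data_def rmod_def A_group la_cl)

lemma tA_group: "rmod B M ra \<Longrightarrow> abelian_group (tA M ra)"
  by (rule tensor_data.T_group[OF tA_data])

lemma tmap:
  assumes M: "rmod B M ra" and N: "rmod B N rb" and f: "rhom B M ra N rb f"
  shows tmap_additive: "additive (tA M ra) (tA N rb) (tmap (tA N rb) f)"
    and tmap_ten: "m \<in> carrier M \<Longrightarrow> a \<in> carrier A \<Longrightarrow>
      tmap (tA N rb) f (ten (tA M ra) m a) = ten (tA N rb) (f m) a"
proof -
  interpret M: tensor_data "carrier B" M ra A la by (rule tA_data[OF M])
  interpret N: tensor_data "carrier B" N rb A la by (rule tA_data[OF N])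
  have b: "balanced (carrier B) M ra A la (tA N rb) (\<lambda>m a. ten (tA N rb) (f m) a)"
    using f
    by (intro balancedI additiveI)
      (auto simp: rhom_def additive_def N.ten_closed N.ten_add_left N.ten_add_right N.ten_move)
  show "additive (tA M ra) (tA N rb) (tmap (tA N rb) f)"
    unfolding tmap_def by (rule M.lift_additive[OF N.T_group b])
  show "m \<in> carrier M \<Longrightarrow> a \<in> carrier A \<Longrightarrow> tmap (tA N rb) f (ten (tA M ra) m a) = ten (tA N rb) (f m) a"
    unfolding tmap_def by (rule M.lift_ten[OF N.T_group b])
qed

lemma tmap_square:
  assumes M: "rmod B M ra" and N: "rmod B N rb" and M': "rmod B M' ra'" and N': "rmod B N' rb'"
    and f: "rhom B M ra N rb f" and g: "rhom B N rb N' rb' g"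
    and f': "rhom B M ra M' ra' f'" and g': "rhom B M' ra' N' rb' g'"
    and eq: "\<And>m. m \<in> carrier M \<Longrightarrow> g (f m) = g' (f' m)" and X: "X \<in> carrier (tA M ra)"
  shows "tmap (tA N' rb') g (tmap (tA N rb) f X) = tmap (tA N' rb') g' (tmap (tA M' ra') f' X)"
proof -
  interpret M: tensor_data "carrier B" M ra A la by (rule tA_data[OF M])
  show ?thesis
    by (rule M.additive_eqI[OF additive_comp[OF tmap_additive[OF M N f] tmap_additive[OF N N' g]]
          additive_comp[OF tmap_additive[OF M M' f'] tmap_additive[OF M' N' g']] X])
      (use f f' eq in \<open>auto simp: tmap_ten[OF M N f] tmap_ten[OF N N' g] tmap_ten[OF M M' f'] tmap_ten[OF M' N' g']
        rhom_def additive_def\<close>)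
qed

lemma tmap_inverse:
  assumes M: "rmod B M ra" and N: "rmod B N rb"
    and f: "rhom B M ra N rb f" and g: "rhom B N rb M ra g"
    and eq: "\<And>m. m \<in> carrier M \<Longrightarrow> g (f m) = m" and X: "X \<in> carrier (tA M ra)"
  shows "tmap (tA M ra) g (tmap (tA N rb) f X) = X"
proof -
  interpret M: tensor_data "carrier B" M ra A la by (rule tA_data[OF M])
  show ?thesis
    by (rule M.additive_eqI[OF additive_comp[OF tmap_additive[OF M N f] tmap_additive[OF N M g]] _ X])
      (use f eq in \<open>auto simp: tmap_ten[OF M N f] tmap_ten[OF N M g] rhom_def additive_def\<close>)
qed

lemma tmap_bij:
  assumes M: "rmod B M ra" and N: "rmod B N rb"
    and f: "rhom B M ra N rb f" and g: "rhom B N rb M ra g"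
    and eq: "\<And>m. m \<in> carrier M \<Longrightarrow> g (f m) = m" and eq': "\<And>n. n \<in> carrier N \<Longrightarrow> f (g n) = n"
  shows "bij_betw (tmap (tA N rb) f) (carrier (tA M ra)) (carrier (tA N rb))"
  by (rule bij_betwI[where g = "tmap (tA M ra) g"])
    (use tmap_inverse[OF M N f g eq] tmap_inverse[OF N M g f eq'] additive_closed[OF tmap_additive[OF M N f]]
      additive_closed[OF tmap_additive[OF N M g]] in auto)

end

text \<open>An isomorphic copy as a bare \<open>ring\<close> record on another type, the kind of
  test module that \<open>faithfully_flat_left\<close> quantifies over.\<close>

definition transport :: "('m \<Rightarrow> 'n) \<Rightarrow> ('m, 'x) ring_scheme \<Rightarrow> 'n ring" where
  "transport e M = \<lparr>carrier = e ` carrier M, monoid.mult = undefined, monoid.one = undefined,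
     ring.zero = e \<zero>\<^bsub>M\<^esub>,
     ring.add = (\<lambda>x y. e (the_inv_into (carrier M) e x \<oplus>\<^bsub>M\<^esub> the_inv_into (carrier M) e y))\<rparr>"

lemma transport:
  assumes M: "rmod B M ra" and e: "inj_on e (carrier M)"
  defines "ra' \<equiv> \<lambda>x b. e (ra (the_inv_into (carrier M) e x) b)"
  shows "right_module B (transport e M) ra'" and "rmod B (transport e M) ra'"
    and "rhom B M ra (transport e M) ra' e"
    and "rhom B (transport e M) ra' M ra (the_inv_into (carrier M) e)"
proof -
  interpret M: abelian_group M using M by (simp add: rmod_def)
  have d: "the_inv_into (carrier M) e (e m) = m" if "m \<in> carrier M" for m
    using that e by (simp add: the_inv_into_f_f)
  have g: "abelian_group (transport e M)"
  proof (rule abelian_groupI)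
    fix x assume "x \<in> carrier (transport e M)"
    then obtain m where "m \<in> carrier M" "x = e m" by (auto simp: transport_def)
    then show "\<exists>y \<in> carrier (transport e M). y \<oplus>\<^bsub>transport e M\<^esub> x = \<zero>\<^bsub>transport e M\<^esub>"
      by (intro bexI[of _ "e (\<ominus>\<^bsub>M\<^esub> m)"]) (auto simp: transport_def d M.l_neg)
  qed (auto simp: transport_def d M.a_ac)
  show "rmod B (transport e M) ra'"
    using M g by (auto simp: rmod_def transport_def ra'_def d)
  then show "right_module B (transport e M) ra'"
    by (simp add: rmod_def right_module_def)
  show "rhom B M ra (transport e M) ra' e" "rhom B (transport e M) ra' M ra (the_inv_into (carrier M) e)"
    using M by (auto simp: rhom_def additive_def ra'_def transport_def d rmod_def)
qed

locale flat_mod = left_mod B A la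
  for B :: "('b, 'u) ring_scheme" and A :: "('a, 'v) ring_scheme" and la :: "'b \<Rightarrow> 'a \<Rightarrow> 'a" +
  fixes ty :: "'c itself"
  assumes flat: "faithfully_flat_left TYPE('c list set) B A la"
begin

text \<open>The three modules are copied into the universe type, where the assumption applies.
  Functoriality of \<open>tmap\<close> along the copying isomorphisms carries exactness back on both
  sides of the equivalence.\<close>

lemma flat_exact:
  assumes L: "rmod B L rL" and M: "rmod B M rM" and N: "rmod B N rN"
    and f: "rhom B L rL M rM f" and g: "rhom B M rM N rN g"
    and encodable: "encodable TYPE('c) (carrier L)" "encodable TYPE('c) (carrier M)" "encodable TYPE('c) (carrier N)"
  shows "exact_pair L f M g N \<longleftrightarrow>
    exact_pair (tA L rL) (tmap (tA M rM) f) (tA M rM) (tmap (tA N rN) g) (tA N rN)"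
proof -
  obtain eL :: "'d \<Rightarrow> 'c list set" where eL: "inj_on eL (carrier L)" using encodable_inj[OF encodable(1)] by blast
  obtain eM :: "'f \<Rightarrow> 'c list set" where eM: "inj_on eM (carrier M)" using encodable_inj[OF encodable(2)] by blast
  obtain eN :: "'h \<Rightarrow> 'c list set" where eN: "inj_on eN (carrier N)" using encodable_inj[OF encodable(3)] by blast
  define dL where "dL = the_inv_into (carrier L) eL"
  define delta_M where "delta_M = the_inv_into (carrier M) eM"
  define dN where "dN = the_inv_into (carrier N) eN"
  define rL' where "rL' = (\<lambda>x b. eL (rL (dL x) b))"
  define rM' where "rM' = (\<lambda>x b. eM (rM (delta_M x) b))"
  define rN' where "rN' = (\<lambda>x b. eN (rN (dN x) b))"
  note tL = transport[OF L eL, folded dL_def, folded rL'_def]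
  note tM = transport[OF M eM, folded delta_M_def, folded rM'_def]
  note tN = transport[OF N eN, folded dN_def, folded rN'_def]
  define L' where "L' = transport eL L"
  define M' where "M' = transport eM M"
  define N' where "N' = transport eN N"
  note tL = tL[folded L'_def] and tM = tM[folded M'_def] and tN = tN[folded N'_def]
  define f' where "f' = (\<lambda>x. eM (f (dL x)))"
  define g' where "g' = (\<lambda>x. eN (g (delta_M x)))"
  have dL: "dL (eL x) = x" if "x \<in> carrier L" for x using that eL by (simp add: dL_def the_inv_into_f_f)
  have delta_M: "delta_M (eM x) = x" if "x \<in> carrier M" for x using that eM by (simp add: delta_M_def the_inv_into_f_f)
  have dN: "dN (eN x) = x" if "x \<in> carrier N" for x using that eN by (simp add: dN_def the_inv_into_f_f)
  have edL: "eL (dL x) = x" if "x \<in> carrier L'" for x using that dL by (auto simp: L'_def transport_def)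
  have edM: "eM (delta_M x) = x" if "x \<in> carrier M'" for x using that delta_M by (auto simp: M'_def transport_def)
  have edN: "eN (dN x) = x" if "x \<in> carrier N'" for x using that dN by (auto simp: N'_def transport_def)
  have rhom_comp: "rhom B X rX Z rZ (\<lambda>x. k (h x))" if "rhom B X rX Y rY h" "rhom B Y rY Z rZ k"
    for X :: "('x1, 'y1) ring_scheme" and rX and Y :: "('x2, 'y2) ring_scheme" and rY
      and Z :: "('x3, 'y3) ring_scheme" and rZ h k
    using that by (auto simp: rhom_def additive_def)
  have f': "rhom B L' rL' M' rM' f'" unfolding f'_def by (rule rhom_comp[OF rhom_comp[OF tL(4) f] tM(3)])
  have g': "rhom B M' rM' N' rN' g'" unfolding g'_def by (rule rhom_comp[OF rhom_comp[OF tM(4) g] tN(3)])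
  interpret Ng: abelian_group N using N by (simp add: rmod_def)
  interpret NA: abelian_group "tA N rN" by (rule tA_group[OF N])
  have fc: "f x \<in> carrier M" if "x \<in> carrier L" for x using f that by (simp add: rhom_def additive_def)
  have gc: "g x \<in> carrier N" if "x \<in> carrier M" for x using g that by (simp add: rhom_def additive_def)
  have "exact_pair L f M g N \<longleftrightarrow> exact_pair L' f' M' g' N'"
  proof (rule exact_pair_transfer[of eL _ _ eM _ _ eN])
    show "bij_betw eL (carrier L) (carrier L')" "bij_betw eM (carrier M) (carrier M')"
      using eL eM by (simp_all add: bij_betw_def L'_def M'_def transport_def)
    show "eN \<zero>\<^bsub>N\<^esub> = \<zero>\<^bsub>N'\<^esub>" by (simp add: N'_def transport_def)
    show "f' (eL x) = eM (f x)" if "x \<in> carrier L" for x using that by (simp add: f'_def dL)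
    show "g' (eM x) = eN (g x)" if "x \<in> carrier M" for x using that by (simp add: g'_def delta_M)
  qed (use eN fc gc in simp_all)
  also have "\<dots> \<longleftrightarrow> exact_pair (tA L' rL') (tmap (tA M' rM') f') (tA M' rM') (tmap (tA N' rN') g') (tA N' rN')"
  proof -
    have hom: "f' \<in> right_module_hom B L' rL' M' rM'" "g' \<in> right_module_hom B M' rM' N' rN'"
      using f' g' by (simp_all add: right_module_hom_def rhom_def additive_def Pi_def)
    show ?thesis
      unfolding tmap_def
      by (rule flat[unfolded faithfully_flat_left_def Let_def, rule_format, of L' rL' M' rM' N' rN' f' g'])
        (intro conjI tL(1) tM(1) tN(1) hom)
  qed
  also have "\<dots> \<longleftrightarrow> exact_pair (tA L rL) (tmap (tA M rM) f) (tA M rM) (tmap (tA N rN) g) (tA N rN)"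
  proof (rule exact_pair_transfer[symmetric])
    show "bij_betw (tmap (tA L' rL') eL) (carrier (tA L rL)) (carrier (tA L' rL'))"
      by (rule tmap_bij[OF L tL(2) tL(3,4) dL edL])
    show "bij_betw (tmap (tA M' rM') eM) (carrier (tA M rM)) (carrier (tA M' rM'))"
      by (rule tmap_bij[OF M tM(2) tM(3,4) delta_M edM])
    show "inj_on (tmap (tA N' rN') eN) (carrier (tA N rN))"
      using tmap_bij[OF N tN(2) tN(3,4) dN edN] by (simp add: bij_betw_def)
    show "tmap (tA N' rN') eN \<zero>\<^bsub>tA N rN\<^esub> = \<zero>\<^bsub>tA N' rN'\<^esub>"
      by (rule additive_zero[OF tmap_additive[OF N tN(2,3)] tA_group[OF N] tA_group[OF tN(2)]])
    show "\<zero>\<^bsub>tA N rN\<^esub> \<in> carrier (tA N rN)" by simp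
    show "tmap (tA M' rM') f' (tmap (tA L' rL') eL X) = tmap (tA M' rM') eM (tmap (tA M rM) f X)"
      if "X \<in> carrier (tA L rL)" for X
      by (rule tmap_square[OF L tL(2) M tM(2) tL(3) f' f tM(3) _ that]) (simp add: f'_def dL)
    show "tmap (tA N' rN') g' (tmap (tA M' rM') eM X) = tmap (tA N' rN') eN (tmap (tA N rN) g X)"
      if "X \<in> carrier (tA M rM)" for X
      by (rule tmap_square[OF M tM(2) N tN(2) tM(3) g' g tN(3) _ that]) (simp add: g'_def delta_M)
    show "tmap (tA M rM) f X \<in> carrier (tA M rM)" if "X \<in> carrier (tA L rL)" for X
      using additive_closed[OF tmap_additive[OF L M f] that] .
    show "tmap (tA N rN) g X \<in> carrier (tA N rN)" if "X \<in> carrier (tA M rM)" for X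
      using additive_closed[OF tmap_additive[OF M N g] that] .
  qed
  finally show ?thesis .
qed

text \<open>Injectivity of \<open>g\<close> is exactness of
  \<open>0 \<rightarrow> M \<rightarrow> N\<close> at \<open>M\<close>; the zero module is taken
  inside \<open>M\<close> itself, and it stays zero after tensoring since
  \<open>0 \<otimes> a = 0\<close>.\<close>

lemma flat_inj:
  assumes M: "rmod B M rM" and N: "rmod B N rN" and g: "rhom B M rM N rN g"
    and encodable: "encodable TYPE('c) (carrier M)" "encodable TYPE('c) (carrier N)"
  shows "inj_on g (carrier M) \<longleftrightarrow> inj_on (tmap (tA N rN) g) (carrier (tA M rM))"
proof -
  interpret Mg: abelian_group M using M by (simp add: rmod_def)
  interpret Ng: abelian_group N using N by (simp add: rmod_def)
  define L where "L = M\<lparr>carrier := {\<zero>\<^bsub>M\<^esub>}\<rparr>"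
  have z: "rM \<zero>\<^bsub>M\<^esub> b = \<zero>\<^bsub>M\<^esub>" if "b \<in> carrier B" for b
    by (rule additive_zero[of M M "\<lambda>m. rM m b"])
      (use M that Mg.abelian_group_axioms in \<open>auto simp: rmod_def additive_def\<close>)
  have cL: "carrier L = {\<zero>\<^bsub>M\<^esub>}" by (simp add: L_def)
  have "abelian_group L"
    by (rule abelian_groupI) (auto simp: L_def)
  then have L: "rmod B L rM"
    using z M by (auto simp: rmod_def L_def)
  have i: "rhom B L rM M rM (\<lambda>x. x)" by (auto simp: rhom_def additive_def L_def)
  have "encodable TYPE('c) (carrier L)" by (rule encodable_subset[OF encodable(1)]) (simp add: L_def)
  note ex = flat_exact[OF L M N i g this encodable]
  interpret L: tensor_data "carrier B" L rM A la by (rule tA_data[OF L])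
  interpret Mt: tensor_data "carrier B" M rM A la by (rule tA_data[OF M])
  interpret MA: abelian_group "tA M rM" by (rule tA_group[OF M])
  interpret NA: abelian_group "tA N rN" by (rule tA_group[OF N])
  have "tmap (tA M rM) (\<lambda>x. x) X = \<zero>\<^bsub>tA M rM\<^esub>" if "X \<in> carrier (tA L rM)" for X
    by (rule L.additive_eqI[OF tmap_additive[OF L M i] _ that, of "\<lambda>_. \<zero>\<^bsub>tA M rM\<^esub>"])
      (auto simp: additive_def tmap_ten[OF L M i] cL Mt.ten_zero_left)
  moreover have "\<zero>\<^bsub>tA L rM\<^esub> \<in> carrier (tA L rM)"
    by (rule abelian_monoid.zero_closed[OF abelian_group.axioms(1)[OF L.T_group]])
  ultimately have im: "tmap (tA M rM) (\<lambda>x. x) ` carrier (tA L rM) = {\<zero>\<^bsub>tA M rM\<^esub>}" by auto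
  have ga: "additive M N g" using g by (simp add: rhom_def)
  note ta = tmap_additive[OF M N g]
  note 1 = additive_inj_iff[OF ga Mg.abelian_group_axioms Ng.abelian_group_axioms]
  note 2 = additive_inj_iff[OF ta MA.abelian_group_axioms NA.abelian_group_axioms]
  show ?thesis
    using ex unfolding exact_pair_def im 1 2 cL by simp
qed

end

section \<open>Relative Hopf modules\<close>

locale principal = galois K H A \<rho> can DK \<tau>
  for K :: "('k, 'u) ring_scheme" and H :: "('k, 'h) module"
    and A :: "('k, 'a) module" and \<rho> :: "'a \<Rightarrow> ('a, 'h) tensor" and can DK \<tau> +
  fixes \<Delta> :: "'h \<Rightarrow> ('h, 'h) tensor" and \<epsilon> :: "'h \<Rightarrow> 'k"
  assumes H_comm: "\<And>x y. x \<in> carrier H \<Longrightarrow> y \<in> carrier H \<Longrightarrow> x \<otimes>\<^bsub>H\<^esub> y = y \<otimes>\<^bsub>H\<^esub> x"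
    and Delta: "klin K H (tensor_K K H H) \<Delta>"
    and eps_closed: "\<And>h. h \<in> carrier H \<Longrightarrow> \<epsilon> h \<in> carrier K"
    and eps_add: "\<And>h h'. h \<in> carrier H \<Longrightarrow> h' \<in> carrier H \<Longrightarrow> \<epsilon> (h \<oplus>\<^bsub>H\<^esub> h') = \<epsilon> h \<oplus>\<^bsub>K\<^esub> \<epsilon> h'"
    and eps_smult: "\<And>k h. k \<in> carrier K \<Longrightarrow> h \<in> carrier H \<Longrightarrow> \<epsilon> (k \<odot>\<^bsub>H\<^esub> h) = k \<otimes>\<^bsub>K\<^esub> \<epsilon> h"
    and rho_coassoc: "\<And>a. a \<in> carrier A \<Longrightarrow>
         tensor_lift (tensor_K K A (tensor_K K H H)) (\<lambda>a0 a1. tensor_lift (tensor_K K A (tensor_K K H H))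
           (\<lambda>x y. ten (tensor_K K A (tensor_K K H H)) x (ten (tensor_K K H H) y a1)) (\<rho> a0)) (\<rho> a)
         = tensor_lift (tensor_K K A (tensor_K K H H)) (\<lambda>a0 a1. ten (tensor_K K A (tensor_K K H H)) a0 (\<Delta> a1)) (\<rho> a)"
    and rho_counit: "\<And>a. a \<in> carrier A \<Longrightarrow> tensor_lift A (\<lambda>a0 a1. \<epsilon> a1 \<odot>\<^bsub>A\<^esub> a0) (\<rho> a) = a"
    and flatness: "faithfully_flat_left TYPE(('a + 'h) list set) (A\<lparr>carrier := B\<rparr>) A (monoid.mult A)"
begin

abbreviation "BB \<equiv> A\<lparr>carrier := B\<rparr>"

lemma flat_mod_A: "flat_mod TYPE('a + 'h) BB A (monoid.mult A)"
  using kbil_closed[OF A.H_mult]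
  by (intro flat_mod.intro left_mod.intro flat_mod_axioms.intro) (auto simp: module_group[OF A.H_module] flatness)

sublocale flat: flat_mod BB A "monoid.mult A" "TYPE('a + 'h)"
  rewrites "carrier BB = B"
  by (rule flat_mod_A) simp

lemma ract_rmod: "ract K A W act \<Longrightarrow> rmod BB W act"
  using kbil_closed[of K W A W act] kbil_add_left[of K W A W act] kbil_add_right[of K W A W act]
  by (auto simp: ract_def rmod_def module_group)

section \<open>Coassociativity, counit and multiplication with coefficients\<close>

lemma star_one_left:
  assumes W: "ract K A W act" and w: "w \<in> carrier W" and Y: "Y \<in> carrier (VH A)"
  shows "star W act (ten (VH W) w \<one>\<^bsub>H\<^esub>) Y = hmap K H W (act w) Y"
proof -
  interpret HR: ring H by (rule H_ring)
  note k = kbil_right[OF W_kbil[OF W] w]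
  note h = hmap_klin[OF A.H_module W_module[OF W] k]
  show ?thesis
    by (rule tK_eqI[OF A.H_module H_module klin_additive[OF kbil_right[OF star_kbil(1)[OF W] klin_closed[OF ten1_klin[OF W] w]]]
        klin_additive[OF h(1)] Y])
      (use w in \<open>auto simp: star_kbil(2)[OF W] h(2)\<close>)
qed

lemma hmap_comp:
  assumes V: "module K V" and U: "module K U" and Q: "module K Q" and f: "klin K V U f" and g: "klin K U Q g"
    and X: "X \<in> carrier (VH V)"
  shows "hmap K H Q g (hmap K H U f X) = hmap K H Q (\<lambda>v. g (f v)) X"
proof -
  note hf = hmap_klin[OF V U f] and hg = hmap_klin[OF U Q g] and hgf = hmap_klin[OF V Q klin_comp[OF f g]]
  show ?thesis
    by (rule tK_eqI[OF V H_module klin_additive[OF klin_comp[OF hf(1) hg(1)]] klin_additive[OF hgf(1)] X])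
      (auto simp: hf(2) hg(2) hgf(2) klin_closed[OF f])
qed

text \<open>The map \<open>id \<otimes> \<Delta>\<close>, bracketed into
  \<open>(W \<otimes> H) \<otimes> H\<close> so that it can be compared with a coaction applied to
  the first leg of \<open>W \<otimes> H\<close>.\<close>

definition coprod_map :: "('k, 'w) module \<Rightarrow> ('w, 'h) tensor \<Rightarrow> (('w, 'h) tensor, 'h) tensor" where
  "coprod_map W = tensor_lift (VH (VH W)) (\<lambda>w h. hmap K H (VH W) (ten (VH W) w) (\<Delta> h))"

lemma hmap_ten_kbil:
  assumes U: "module K U" and W: "module K W" and f: "klin K U W f"
  shows "kbil K U (VH H) (VH (VH W)) (\<lambda>x. hmap K H (VH W) (ten (VH W) (f x)))"
  unfolding hmap_def
proof (rule tK_lift_param[OF H_module H_module tK_module[OF tK_module[OF W H_module] H_module] U])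
  note t = tK_kbil[OF W H_module] and t2 = tK_kbil[OF tK_module[OF W H_module] H_module]
  show "kbil K H H (VH (VH W)) (\<lambda>v. ten (VH (VH W)) (ten (VH W) (f x) v))" if "x \<in> carrier U" for x
    by (rule kbil_comp_args[OF t2 kbil_right[OF t klin_closed[OF f that]] klin_id])
  show "klin K U (VH (VH W)) (\<lambda>x. ten (VH (VH W)) (ten (VH W) (f x) v) w)" if "v \<in> carrier H" "w \<in> carrier H" for v w
    by (rule klin_comp[OF klin_comp[OF f kbil_left[OF t that(1)]] kbil_left[OF t2 that(2)]])
qed

lemma coprod_map_klin:
  assumes W: "module K W"
  shows "klin K (VH W) (VH (VH W)) (coprod_map W)"
    and "w \<in> carrier W \<Longrightarrow> h \<in> carrier H \<Longrightarrow> coprod_map W (ten (VH W) w h) = hmap K H (VH W) (ten (VH W) w) (\<Delta> h)"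
proof -
  note M = tK_module[OF tK_module[OF W H_module] H_module]
  note k = kbil_comp_args[OF hmap_ten_kbil[OF W W klin_id] klin_id Delta]
  show "klin K (VH W) (VH (VH W)) (coprod_map W)"
    unfolding coprod_map_def by (rule tK_lift_klin[OF W H_module M k])
  show "w \<in> carrier W \<Longrightarrow> h \<in> carrier H \<Longrightarrow> coprod_map W (ten (VH W) w h) = hmap K H (VH W) (ten (VH W) w) (\<Delta> h)"
    unfolding coprod_map_def by (rule tK_lift_ten[OF W H_module module_group[OF M] kbil_balanced[OF k]])
qed

text \<open>Coassociativity of \<open>\<rho>\<close> lives in
  \<open>A \<otimes> (H \<otimes> H)\<close>. The map \<open>L\<close> applies \<open>f\<close> to
  the first leg and rebrackets; it turns the two sides of that axiom into the two sides
  here.\<close>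

lemma coassoc_hmap:
  assumes W: "module K W" and f: "klin K A W f" and a: "a \<in> carrier A"
  shows "hmap K H (VH W) (\<lambda>a0. hmap K H W f (\<rho> a0)) (\<rho> a) = coprod_map W (hmap K H W f (\<rho> a))"
proof -
  let ?HH = "VH H" and ?AHH = "tensor_K K A (VH H)"
  note HH = tK_module[OF H_module H_module]
  note AHH = tK_module[OF A.H_module HH]
  note WH = tK_module[OF W H_module]
  note WHH = tK_module[OF WH H_module]
  note kap_pair = hmap_ten_kbil[OF A.H_module W f]
  define L where "L = tensor_lift (VH (VH W)) (\<lambda>x. hmap K H (VH W) (ten (VH W) (f x)))"
  have L: "klin K ?AHH (VH (VH W)) L"
    unfolding L_def by (rule tK_lift_klin[OF A.H_module HH WHH kap_pair])
  have L_ten: "L (ten ?AHH x Z) = hmap K H (VH W) (ten (VH W) (f x)) Z" if "x \<in> carrier A" "Z \<in> carrier ?HH" for x Z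
    unfolding L_def by (rule tK_lift_ten[OF A.H_module HH module_group[OF WHH] kbil_balanced[OF kap_pair] that])
  note hf = hmap_klin[OF A.H_module W f]
  note ht = hmap_klin[OF H_module WH kbil_right[OF tK_kbil[OF W H_module] klin_closed[OF f]]]
  have in_k: "kbil K H (VH A) ?AHH (\<lambda>a1. tensor_lift ?AHH (\<lambda>x y. ten ?AHH x (ten ?HH y a1)))"
  proof (rule tK_lift_param[OF A.H_module H_module AHH H_module])
    show "kbil K A H ?AHH (\<lambda>x y. ten ?AHH x (ten ?HH y a1))" if "a1 \<in> carrier H" for a1
      by (rule kbil_comp_args[OF tK_kbil[OF A.H_module HH] klin_id kbil_left[OF tK_kbil[OF H_module H_module] that]])
    show "klin K H ?AHH (\<lambda>a1. ten ?AHH v (ten ?HH w a1))" if "v \<in> carrier A" "w \<in> carrier H" for v w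
      by (rule klin_comp[OF kbil_right[OF tK_kbil[OF H_module H_module] that(2)] kbil_right[OF tK_kbil[OF A.H_module HH] that(1)]])
  qed
  have in_b: "kbil K A H ?AHH (\<lambda>x y. ten ?AHH x (ten ?HH y a1))" if "a1 \<in> carrier H" for a1
    by (rule kbil_comp_args[OF tK_kbil[OF A.H_module HH] klin_id kbil_left[OF tK_kbil[OF H_module H_module] that]])
  have out_k: "kbil K A H ?AHH (\<lambda>a0 a1. tensor_lift ?AHH (\<lambda>x y. ten ?AHH x (ten ?HH y a1)) (\<rho> a0))"
    using kbil_comp_args[OF kbil_swap[OF in_k] rho klin_id] .
  have in_eq: "L (tensor_lift ?AHH (\<lambda>x y. ten ?AHH x (ten ?HH y a1)) Y) = ten (VH (VH W)) (hmap K H W f Y) a1"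
    if "a1 \<in> carrier H" "Y \<in> carrier (VH A)" for a1 Y
    by (rule tK_eqI[OF A.H_module H_module klin_additive[OF klin_comp[OF kbil_right[OF in_k that(1)] L]]
        klin_additive[OF klin_comp[OF hf(1) kbil_left[OF tK_kbil[OF WH H_module] that(1)]]] that(2)])
      (use that in \<open>simp add: tK_lift_ten[OF A.H_module H_module module_group[OF AHH] kbil_balanced[OF in_b]] L_ten
        tK_closed[OF H_module H_module] ht(2) hf(2)\<close>)
  note hr = hmap_klin[OF A.H_module WH klin_comp[OF rho hf(1)]]
  have 1: "L (tensor_lift ?AHH (\<lambda>a0 a1. tensor_lift ?AHH (\<lambda>x y. ten ?AHH x (ten ?HH y a1)) (\<rho> a0)) Z)
      = hmap K H (VH W) (\<lambda>a0. hmap K H W f (\<rho> a0)) Z" if "Z \<in> carrier (VH A)" for Z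
    by (rule tK_eqI[OF A.H_module H_module klin_additive[OF klin_comp[OF tK_lift_klin[OF A.H_module H_module AHH out_k] L]]
          klin_additive[OF hr(1)] that])
      (simp add: tK_lift_ten[OF A.H_module H_module module_group[OF AHH] kbil_balanced[OF out_k]] in_eq rho_closed hr(2))
  note dk = kbil_comp_args[OF tK_kbil[OF A.H_module HH] klin_id Delta]
  note cW = coprod_map_klin[OF W]
  have 2: "L (tensor_lift ?AHH (\<lambda>a0 a1. ten ?AHH a0 (\<Delta> a1)) Z) = coprod_map W (hmap K H W f Z)" if "Z \<in> carrier (VH A)" for Z
    by (rule tK_eqI[OF A.H_module H_module klin_additive[OF klin_comp[OF tK_lift_klin[OF A.H_module H_module AHH dk] L]]
          klin_additive[OF klin_comp[OF hf(1) cW(1)]] that])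
      (simp add: tK_lift_ten[OF A.H_module H_module module_group[OF AHH] kbil_balanced[OF dk]] L_ten
        klin_closed[OF Delta] hf(2) cW(2) klin_closed[OF f])
  show ?thesis
    using 1[OF rho_closed[OF a]] 2[OF rho_closed[OF a]] rho_coassoc[OF a] by simp
qed

definition counit_map :: "('k, 'w) module \<Rightarrow> ('w, 'h) tensor \<Rightarrow> 'w" where
  "counit_map W = tensor_lift W (\<lambda>w h. \<epsilon> h \<odot>\<^bsub>W\<^esub> w)"

lemma counit_map_klin:
  assumes W: "module K W"
  shows "klin K (VH W) W (counit_map W)"
    and "w \<in> carrier W \<Longrightarrow> h \<in> carrier H \<Longrightarrow> counit_map W (ten (VH W) w h) = \<epsilon> h \<odot>\<^bsub>W\<^esub> w"
proof -
  interpret W: module K W by fact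
  have k: "kbil K W H W (\<lambda>w h. \<epsilon> h \<odot>\<^bsub>W\<^esub> w)"
    by (intro kbilI klinI additiveI)
      (auto simp: eps_closed eps_add eps_smult W.smult_r_distr W.smult_l_distr W.smult_assoc1[symmetric] W.R.m_comm)
  show "klin K (VH W) W (counit_map W)"
    unfolding counit_map_def by (rule tK_lift_klin[OF W H_module W k])
  show "w \<in> carrier W \<Longrightarrow> h \<in> carrier H \<Longrightarrow> counit_map W (ten (VH W) w h) = \<epsilon> h \<odot>\<^bsub>W\<^esub> w"
    unfolding counit_map_def by (rule tK_lift_ten[OF W H_module W.abelian_group_axioms kbil_balanced[OF k]])
qed

lemma counit_map_hmap:
  assumes W: "module K W" and f: "klin K A W f" and a: "a \<in> carrier A"
  shows "counit_map W (hmap K H W f (\<rho> a)) = f a"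
proof -
  note hf = hmap_klin[OF A.H_module W f]
  have "counit_map W (hmap K H W f Z) = f (counit_map A Z)" if "Z \<in> carrier (VH A)" for Z
    by (rule tK_eqI[OF A.H_module H_module klin_additive[OF klin_comp[OF hf(1) counit_map_klin(1)[OF W]]]
          klin_additive[OF klin_comp[OF counit_map_klin(1)[OF A.H_module] f]] that])
      (simp add: hf(2) counit_map_klin(2)[OF W] counit_map_klin(2)[OF A.H_module] klin_closed[OF f] klin_smult[OF f] eps_closed)
  moreover have "counit_map A (\<rho> a) = a" unfolding counit_map_def by (rule rho_counit[OF a])
  ultimately show ?thesis using rho_closed[OF a] by simp
qed

definition mu :: "('k, 'w) module \<Rightarrow> ('w \<Rightarrow> 'a \<Rightarrow> 'w) \<Rightarrow> ('w, 'a) tensor \<Rightarrow> 'w" where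
  "mu W act = tensor_lift W act"

lemma mu:
  assumes W: "ract K A W act"
  shows mu_additive: "additive (WB W act) W (mu W act)"
    and mu_ten: "w \<in> carrier W \<Longrightarrow> e \<in> carrier A \<Longrightarrow> mu W act (ten (WB W act) w e) = act w e"
proof -
  interpret WB: tensor_data B W act A "monoid.mult A" by (rule WB_data[OF W])
  have b: "balanced B W act A (monoid.mult A) W act"
    by (intro balancedI klin_additive[OF kbil_left[OF W_kbil[OF W]]] klin_additive[OF kbil_right[OF W_kbil[OF W]]])
      (auto simp: W_assoc[OF W])
  show "additive (WB W act) W (mu W act)"
    unfolding mu_def by (rule WB.lift_additive[OF WB.M_group b])
  show "w \<in> carrier W \<Longrightarrow> e \<in> carrier A \<Longrightarrow> mu W act (ten (WB W act) w e) = act w e"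
    unfolding mu_def by (rule WB.lift_ten[OF WB.M_group b])
qed

text \<open>On \<open>w \<otimes> e\<close> both sides are \<open>w e\<close>, by the counit law for
  \<open>e\<close>. It later recovers \<open>w\<close> from a preimage of its coaction under
  \<open>chi\<close>.\<close>

lemma counit_map_chi:
  assumes W: "ract K A W act" and X: "X \<in> carrier (WB W act)"
  shows "counit_map W (chi W act X) = mu W act X"
proof -
  interpret WB: tensor_data B W act A "monoid.mult A" by (rule WB_data[OF W])
  show ?thesis
    by (rule WB.additive_eqI[OF additive_comp[OF chi_additive[OF W] klin_additive[OF counit_map_klin(1)[OF W_module[OF W]]]] mu_additive[OF W] X])
      (simp add: chi_ten[OF W] mu_ten[OF W] star_one_left[OF W] rho_closed
        counit_map_hmap[OF W_module[OF W] kbil_right[OF W_kbil[OF W]]])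
qed

abbreviation act' :: "('k, 'w) module \<Rightarrow> ('w \<Rightarrow> 'a \<Rightarrow> 'w) \<Rightarrow> ('w, 'h) tensor \<Rightarrow> 'a \<Rightarrow> ('w, 'h) tensor" where
  "act' W act \<equiv> (\<lambda>X a. star W act X (\<rho> a))"

section \<open>Relative Hopf modules and their coinvariants\<close>

definition coinv :: "('k, 'w) module \<Rightarrow> ('w \<Rightarrow> ('w, 'h) tensor) \<Rightarrow> ('k, 'w) module" where
  "coinv W \<delta> = W\<lparr>carrier := {w \<in> carrier W. \<delta> w = ten (VH W) w \<one>\<^bsub>H\<^esub>}\<rparr>"

text \<open>Records linearity of the coaction and its compatibility with \<open>A\<close>.
  Coassociativity and the counit law enter as conditions on a single element, in
  \<open>theta_surj_cond\<close>.\<close>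

definition hopf_mod :: "('k, 'w) module \<Rightarrow> ('w \<Rightarrow> 'a \<Rightarrow> 'w) \<Rightarrow> ('w \<Rightarrow> ('w, 'h) tensor) \<Rightarrow> bool" where
  "hopf_mod W act \<delta> \<longleftrightarrow> ract K A W act \<and> klin K W (VH W) \<delta> \<and>
     (\<forall>w \<in> carrier W. \<forall>a \<in> carrier A. \<delta> (act w a) = star W act (\<delta> w) (\<rho> a))"

text \<open>Turns the equaliser of \<open>\<delta>\<close> and
  \<open>w \<mapsto> w \<otimes> 1\<close> into a kernel, the form that \<open>exact_pair\<close>
  asks for.\<close>

definition coinv_defect :: "('k, 'w) module \<Rightarrow> ('w \<Rightarrow> ('w, 'h) tensor) \<Rightarrow> 'w \<Rightarrow> ('w, 'h) tensor" where
  "coinv_defect W \<delta> w = \<delta> w \<ominus>\<^bsub>VH W\<^esub> ten (VH W) w \<one>\<^bsub>H\<^esub>"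

context
  fixes W :: "('k, 'w) module" and act \<delta>
  assumes hopf: "hopf_mod W act \<delta>"
begin

lemma hopf_ract: "ract K A W act" and hopf_klin: "klin K W (VH W) \<delta>"
  and hopf_act: "w \<in> carrier W \<Longrightarrow> a \<in> carrier A \<Longrightarrow> \<delta> (act w a) = star W act (\<delta> w) (\<rho> a)"
  using hopf by (auto simp: hopf_mod_def)

lemmas W' = VH_ract[OF hopf_ract]
lemmas Wm = W_module[OF hopf_ract]

interpretation WB: tensor_data B W act A "monoid.mult A" by (rule WB_data[OF hopf_ract])
interpretation VHW: abelian_group "VH W" by (rule tK_group[OF Wm H_module])
interpretation VVHW: abelian_group "VH (VH W)" by (rule tK_group[OF tK_module[OF Wm H_module] H_module])
interpretation W: module K W by (rule Wm)
interpretation HR: ring H by (rule H_ring)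

lemma coinv_defect_additive: "additive W (VH W) (coinv_defect W \<delta>)"
  using additive_diff[OF klin_additive[OF hopf_klin] klin_additive[OF ten1_klin[OF hopf_ract]] VHW.abelian_group_axioms]
  by (simp add: coinv_defect_def[abs_def])

lemma star_additive_left: "Y \<in> carrier (VH A) \<Longrightarrow> additive (VH W) (VH W) (\<lambda>X. star W act X Y)"
  by (rule klin_additive[OF kbil_left[OF star_kbil(1)[OF hopf_ract]]])

lemma ten1_closed: "w \<in> carrier W \<Longrightarrow> ten (VH W) w \<one>\<^bsub>H\<^esub> \<in> carrier (VH W)"
  by (rule klin_closed[OF ten1_klin[OF hopf_ract]])

lemma star_coinv_defect:
  "w \<in> carrier W \<Longrightarrow> a \<in> carrier A \<Longrightarrow>
    star W act (coinv_defect W \<delta> w) (\<rho> a) = \<delta> (act w a) \<ominus>\<^bsub>VH W\<^esub> star W act (ten (VH W) w \<one>\<^bsub>H\<^esub>) (\<rho> a)"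
  unfolding coinv_defect_def
  using additive_minus[OF star_additive_left[OF rho_closed] VHW.abelian_group_axioms VHW.abelian_group_axioms]
  by (simp add: hopf_act klin_closed[OF hopf_klin] ten1_closed)

text \<open>The coaction commutes with all of \<open>A\<close>, but
  \<open>w \<mapsto> w \<otimes> 1\<close> commutes with \<open>b\<close> because
  \<open>\<rho>(b) = b \<otimes> 1\<close>; hence linearity over \<open>B\<close>.\<close>

lemma coinv_defect_rhom: "rhom BB W act (VH W) (act' W act) (coinv_defect W \<delta>)"
  unfolding rhom_def
proof (intro conjI ballI coinv_defect_additive)
  fix w b assume w: "w \<in> carrier W" and b: "b \<in> carrier BB"
  then have b': "b \<in> carrier A" "\<rho> b = ten (VH A) b \<one>\<^bsub>H\<^esub>" by auto
  have "star W act (ten (VH W) w \<one>\<^bsub>H\<^esub>) (\<rho> b) = ten (VH W) (act w b) \<one>\<^bsub>H\<^esub>"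
    using w b' by (simp add: star_kbil(2)[OF hopf_ract])
  then show "coinv_defect W \<delta> (act w b) = star W act (coinv_defect W \<delta> w) (\<rho> b)"
    using star_coinv_defect[OF w b'(1)] by (simp add: coinv_defect_def)
qed

lemmas tmap_g = flat.tmap_additive[OF ract_rmod[OF hopf_ract] ract_rmod[OF W'] coinv_defect_rhom]
  flat.tmap_ten[OF ract_rmod[OF hopf_ract] ract_rmod[OF W'] coinv_defect_rhom]

text \<open>On \<open>w \<otimes> e\<close> the left side is
  \<open>\<delta>(w) \<rho>(e) - (w \<otimes> 1) \<rho>(e)\<close>; the first term is
  \<open>\<delta>(w e)\<close>, the second is \<open>chi\<close> of
  \<open>w \<otimes> e\<close>.\<close>

lemma mu_tmap_g:
  assumes X: "X \<in> carrier (WB W act)"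
  shows "mu (VH W) (act' W act) (tmap (WB (VH W) (act' W act)) (coinv_defect W \<delta>) X) = \<delta> (mu W act X) \<ominus>\<^bsub>VH W\<^esub> chi W act X"
  by (rule WB.additive_eqI[OF additive_comp[OF tmap_g(1) mu_additive[OF W']]
        additive_diff[OF additive_comp[OF mu_additive[OF hopf_ract] klin_additive[OF hopf_klin]] chi_additive[OF hopf_ract]] X])
    (simp_all add: VHW.abelian_group_axioms tmap_g(2) mu_ten[OF W'] mu_ten[OF hopf_ract] chi_ten[OF hopf_ract] star_coinv_defect
      additive_closed[OF coinv_defect_additive])

text \<open>Since \<open>chi\<close> is injective, an element of the kernel is determined by its
  product \<open>mu X\<close>. Injectivity of \<open>theta\<close> and the comparison of kernel
  elements in \<open>kap_image\<close> rest on this.\<close>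

lemma chi_kernel:
  assumes X: "X \<in> carrier (WB W act)" and 0: "tmap (WB (VH W) (act' W act)) (coinv_defect W \<delta>) X = \<zero>\<^bsub>WB (VH W) (act' W act)\<^esub>"
  shows "chi W act X = \<delta> (mu W act X)"
proof -
  have "mu (VH W) (act' W act) \<zero>\<^bsub>WB (VH W) (act' W act)\<^esub> = \<zero>\<^bsub>VH W\<^esub>"
    by (rule additive_zero[OF mu_additive[OF W'] tensor_data.T_group[OF WB_data[OF W']] VHW.abelian_group_axioms])
  then have e: "\<delta> (mu W act X) \<ominus>\<^bsub>VH W\<^esub> chi W act X = \<zero>\<^bsub>VH W\<^esub>"
    using mu_tmap_g[OF X] 0 by simp
  have c: "\<delta> (mu W act X) \<in> carrier (VH W)" "chi W act X \<in> carrier (VH W)"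
    using X klin_closed[OF hopf_klin additive_closed[OF mu_additive[OF hopf_ract]]] additive_closed[OF chi_additive[OF hopf_ract]]
    by auto
  then have "\<delta> (mu W act X) = (\<delta> (mu W act X) \<ominus>\<^bsub>VH W\<^esub> chi W act X) \<oplus>\<^bsub>VH W\<^esub> chi W act X"
    by (simp add: a_minus_def VHW.a_assoc VHW.l_neg)
  then show ?thesis using e c by simp
qed

text \<open>Seen through \<open>chi\<close>, failure to be coinvariant becomes failure of
  coassociativity: an \<open>X\<close> with \<open>chi X = \<delta> w\<close> lies in the kernel
  once coassociativity holds at \<open>w\<close>.\<close>

lemma chi_tmap_g:
  assumes X: "X \<in> carrier (WB W act)"
  shows "chi (VH W) (act' W act) (tmap (WB (VH W) (act' W act)) (coinv_defect W \<delta>) X)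
    = hmap K H (VH W) \<delta> (chi W act X) \<ominus>\<^bsub>VH (VH W)\<^esub> coprod_map W (chi W act X)"
proof -
  note VHm = tK_module[OF Wm H_module]
  note hd = hmap_klin[OF Wm VHm hopf_klin]
  show ?thesis
  proof (rule WB.additive_eqI[OF additive_comp[OF tmap_g(1) chi_additive[OF W']]
        additive_diff[OF additive_comp[OF chi_additive[OF hopf_ract] klin_additive[OF hd(1)]]
          additive_comp[OF chi_additive[OF hopf_ract] klin_additive[OF coprod_map_klin(1)[OF Wm]]] VVHW.abelian_group_axioms] X])
    fix w e assume w: "w \<in> carrier W" and e: "e \<in> carrier A"
    note kw = kbil_right[OF W_kbil[OF hopf_ract] w]
    note hw = hmap_klin[OF A.H_module Wm kw]
    have g: "coinv_defect W \<delta> w \<in> carrier (VH W)" by (rule additive_closed[OF coinv_defect_additive w])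
    have wr: "klin K A (VH W) (act' W act X)" if "X \<in> carrier (VH W)" for X
      by (rule kbil_right[OF W_kbil[OF W'] that])
    note dw = klin_closed[OF hopf_klin w]
    note t1 = ten1_closed[OF w]
    have "chi (VH W) (act' W act) (tmap (WB (VH W) (act' W act)) (coinv_defect W \<delta>) (ten (WB W act) w e))
        = hmap K H (VH W) (act' W act (coinv_defect W \<delta> w)) (\<rho> e)"
      using w e g by (simp add: tmap_g(2) chi_ten[OF W'] star_one_left[OF W'] rho_closed)
    also have "\<dots> = hmap K H (VH W) (\<lambda>a. \<delta> (act w a)) (\<rho> e)
        \<ominus>\<^bsub>VH (VH W)\<^esub> hmap K H (VH W) (\<lambda>a. hmap K H W (act w) (\<rho> a)) (\<rho> e)"
    proof -
      have k1: "klin K A (VH W) (\<lambda>a. \<delta> (act w a))" by (rule klin_comp[OF kw hopf_klin])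
      have k2: "klin K A (VH W) (\<lambda>a. hmap K H W (act w) (\<rho> a))" by (rule klin_comp[OF rho hw(1)])
      note h0 = hmap_klin[OF A.H_module VHm wr[OF g]] and h1 = hmap_klin[OF A.H_module VHm k1]
        and h2 = hmap_klin[OF A.H_module VHm k2]
      show ?thesis
      proof (rule tK_eqI[OF A.H_module H_module klin_additive[OF h0(1)]
            additive_diff[OF klin_additive[OF h1(1)] klin_additive[OF h2(1)] VVHW.abelian_group_axioms] rho_closed[OF e]])
        fix a h assume ah: "a \<in> carrier A" "h \<in> carrier H"
        note t = klin_additive[OF kbil_left[OF tK_kbil[OF VHm H_module] ah(2)]]
        show "hmap K H (VH W) (act' W act (coinv_defect W \<delta> w)) (ten (VH A) a h)
          = hmap K H (VH W) (\<lambda>a. \<delta> (act w a)) (ten (VH A) a h)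
            \<ominus>\<^bsub>VH (VH W)\<^esub> hmap K H (VH W) (\<lambda>a. hmap K H W (act w) (\<rho> a)) (ten (VH A) a h)"
          using additive_minus[OF t VHW.abelian_group_axioms VVHW.abelian_group_axioms klin_closed[OF k1 ah(1)] klin_closed[OF k2 ah(1)]]
            ah w by (simp add: h0(2) h1(2) h2(2) star_coinv_defect star_one_left[OF hopf_ract] rho_closed)
      qed
    qed
    also have "hmap K H (VH W) (\<lambda>a. hmap K H W (act w) (\<rho> a)) (\<rho> e) = coprod_map W (hmap K H W (act w) (\<rho> e))"
      by (rule coassoc_hmap[OF Wm kw e])
    also have "hmap K H (VH W) (\<lambda>a. \<delta> (act w a)) (\<rho> e) = hmap K H (VH W) \<delta> (hmap K H W (act w) (\<rho> e))"
      by (rule hmap_comp[OF A.H_module Wm VHm kw hopf_klin rho_closed[OF e], symmetric])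
    finally show "chi (VH W) (act' W act) (tmap (WB (VH W) (act' W act)) (coinv_defect W \<delta>) (ten (WB W act) w e))
      = hmap K H (VH W) \<delta> (chi W act (ten (WB W act) w e)) \<ominus>\<^bsub>VH (VH W)\<^esub> coprod_map W (chi W act (ten (WB W act) w e))"
      using w e by (simp add: chi_ten[OF hopf_ract] star_one_left[OF hopf_ract] rho_closed)
  qed
qed

lemma coinv_iff: "w \<in> carrier (coinv W \<delta>) \<longleftrightarrow> w \<in> carrier W \<and> \<delta> w = ten (VH W) w \<one>\<^bsub>H\<^esub>"
  by (simp add: coinv_def)

lemma coinv_coinv_defect: "w \<in> carrier (coinv W \<delta>) \<longleftrightarrow> w \<in> carrier W \<and> coinv_defect W \<delta> w = \<zero>\<^bsub>VH W\<^esub>"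
proof -
  have "coinv_defect W \<delta> w = \<zero>\<^bsub>VH W\<^esub> \<longleftrightarrow> \<delta> w = ten (VH W) w \<one>\<^bsub>H\<^esub>" if "w \<in> carrier W"
  proof
    assume "coinv_defect W \<delta> w = \<zero>\<^bsub>VH W\<^esub>"
    then have "\<delta> w \<oplus>\<^bsub>VH W\<^esub> (\<ominus>\<^bsub>VH W\<^esub> ten (VH W) w \<one>\<^bsub>H\<^esub>) = \<zero>\<^bsub>VH W\<^esub>" by (simp add: coinv_defect_def a_minus_def)
    then show "\<delta> w = ten (VH W) w \<one>\<^bsub>H\<^esub>"
      using VHW.minus_equality VHW.minus_minus klin_closed[OF hopf_klin that] ten1_closed[OF that]
      by (metis VHW.a_inv_closed)
  qed (use ten1_closed[OF that] in \<open>simp add: coinv_defect_def a_minus_def VHW.r_neg\<close>)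
  then show ?thesis by (auto simp: coinv_iff)
qed

lemma coinv_simps [simp]: "add (coinv W \<delta>) = add W" "\<zero>\<^bsub>coinv W \<delta>\<^esub> = \<zero>\<^bsub>W\<^esub>"
  by (simp_all add: coinv_def)

lemma coinv_closed: "w \<in> carrier (coinv W \<delta>) \<Longrightarrow> w \<in> carrier W"
  by (simp add: coinv_iff)

lemma coinv_group: "abelian_group (coinv W \<delta>)"
  unfolding coinv_def
proof (rule subgroup_abelian_group[OF W.abelian_group_axioms])
  let ?t = "\<lambda>w. ten (VH W) w \<one>\<^bsub>H\<^esub>"
  note t = klin_additive[OF ten1_klin[OF hopf_ract]] and d = klin_additive[OF hopf_klin]
  note g = W.abelian_group_axioms VHW.abelian_group_axioms
  show "\<zero>\<^bsub>W\<^esub> \<in> {w \<in> carrier W. \<delta> w = ?t w}"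
    using additive_zero[OF t g] additive_zero[OF d g] by simp
  show "x \<oplus>\<^bsub>W\<^esub> y \<in> {w \<in> carrier W. \<delta> w = ?t w}"
    if "x \<in> {w \<in> carrier W. \<delta> w = ?t w}" "y \<in> {w \<in> carrier W. \<delta> w = ?t w}" for x y
    using that by (simp add: additive_add[OF t] additive_add[OF d])
  show "\<ominus>\<^bsub>W\<^esub> x \<in> {w \<in> carrier W. \<delta> w = ?t w}" if "x \<in> {w \<in> carrier W. \<delta> w = ?t w}" for x
    using that by (simp add: additive_a_inv[OF t g] additive_a_inv[OF d g])
qed auto

lemma coinv_act: "w \<in> carrier (coinv W \<delta>) \<Longrightarrow> b \<in> B \<Longrightarrow> act w b \<in> carrier (coinv W \<delta>)"
  by (auto simp: coinv_iff kbil_closed[OF W_kbil[OF hopf_ract]] hopf_act star_kbil(2)[OF hopf_ract])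

lemma coinv_rmod: "rmod BB (coinv W \<delta>) act"
  using ract_rmod[OF hopf_ract] coinv_group coinv_act coinv_closed
  by (auto simp: rmod_def)

lemma incl_rhom: "rhom BB (coinv W \<delta>) act W act (\<lambda>w. w)"
  by (auto simp: rhom_def additive_def coinv_closed)

lemmas tmap_incl = flat.tmap_additive[OF coinv_rmod ract_rmod[OF hopf_ract] incl_rhom]
  flat.tmap_ten[OF coinv_rmod ract_rmod[OF hopf_ract] incl_rhom]

text \<open>The multiplication map from coinvariants tensored with \<open>A\<close> back to
  \<open>W\<close>. It is factored through \<open>W \<otimes>_B A\<close> so that the kernel
  computations there apply.\<close>

definition theta where "theta Y = mu W act (tmap (WB W act) (\<lambda>w. w) Y)"

lemma theta_additive: "additive (WB (coinv W \<delta>) act) W theta"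
  unfolding theta_def[abs_def] by (rule additive_comp[OF tmap_incl(1) mu_additive[OF hopf_ract]])

lemma theta_ten: "c \<in> carrier (coinv W \<delta>) \<Longrightarrow> e \<in> carrier A \<Longrightarrow> theta (ten (WB (coinv W \<delta>) act) c e) = act c e"
  by (simp add: theta_def tmap_incl(2) mu_ten[OF hopf_ract] coinv_closed)

end

section \<open>The structure theorem\<close>

lemma two_letters: "(Inl undefined :: 'a + 'h) \<noteq> Inr undefined"
  by simp

lemma encodable_tensor_K:
  assumes "module K V" "module K W" "encodable TYPE('a + 'h) (carrier V)" "encodable TYPE('a + 'h) (carrier W)"
  shows "encodable TYPE('a + 'h) (carrier (tensor_K K V W))"
proof -
  interpret tensor_module_data "carrier K" V "\<lambda>v k. k \<odot>\<^bsub>V\<^esub> v" W "\<lambda>k w. k \<odot>\<^bsub>W\<^esub> w" K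
    by (rule tensor_K_data[OF assms(1,2)])
  show ?thesis using encodable_tensor[OF two_letters assms(3,4)] by (simp add: tensor_module_simps)
qed

context
  fixes W :: "('k, 'w) module" and act \<delta>
  assumes hopf: "hopf_mod W act \<delta>" and encodable_W: "encodable TYPE('a + 'h) (carrier W)"
begin

interpretation WB: tensor_data B W act A "monoid.mult A" by (rule WB_data[OF hopf_ract[OF hopf]])
interpretation CB: tensor_data B "coinv W \<delta>" act A "monoid.mult A"
  using flat.tA_data[OF coinv_rmod[OF hopf]] .
interpretation WB': tensor_data B "VH W" "act' W act" A "monoid.mult A" by (rule WB_data[OF W'[OF hopf]])
interpretation VHW: abelian_group "VH W" by (rule tK_group[OF Wm[OF hopf] H_module])
interpretation VVHW: abelian_group "VH (VH W)" by (rule tK_group[OF tK_module[OF Wm[OF hopf] H_module] H_module])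

lemma encodable_VHW: "encodable TYPE('a + 'h) (carrier (VH W))"
  by (rule encodable_tensor_K[OF Wm[OF hopf] H_module encodable_W encodable_Inr])

lemma encodable_coinv: "encodable TYPE('a + 'h) (carrier (coinv W \<delta>))"
  by (rule encodable_subset[OF encodable_W]) (auto simp: coinv_closed[OF hopf])

text \<open>Stated for any \<open>N\<close> over \<open>W\<close>, as it serves both for the
  inclusion of the coinvariants and for \<open>kap\<close>.\<close>

lemma tmap_zero:
  assumes N: "rmod BB N rN" and f: "rhom BB N rN W act f" and 0: "\<And>n. n \<in> carrier N \<Longrightarrow> coinv_defect W \<delta> (f n) = \<zero>\<^bsub>VH W\<^esub>"
    and X: "X \<in> carrier (tensor B N rN A (monoid.mult A))"
  shows "tmap (WB (VH W) (act' W act)) (coinv_defect W \<delta>) (tmap (WB W act) f X) = \<zero>\<^bsub>WB (VH W) (act' W act)\<^esub>"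
proof -
  interpret N: tensor_data B N rN A "monoid.mult A" using flat.tA_data[OF N] .
  interpret z: abelian_group "WB (VH W) (act' W act)" by (rule WB'.T_group)
  note tf = flat.tmap_additive[OF N ract_rmod[OF hopf_ract[OF hopf]] f] flat.tmap_ten[OF N ract_rmod[OF hopf_ract[OF hopf]] f]
  have fc: "f n \<in> carrier W" if "n \<in> carrier N" for n using f that by (simp add: rhom_def additive_def)
  show ?thesis
    by (rule N.additive_eqI[OF additive_comp[OF tf(1) tmap_g(1)[OF hopf]] _ X, of "\<lambda>_. \<zero>\<^bsub>WB (VH W) (act' W act)\<^esub>"])
      (simp_all add: tf(2) tmap_g(2)[OF hopf] fc 0 WB'.ten_zero_left additive_def)
qed

lemma chi_zero: "chi W act \<zero>\<^bsub>WB W act\<^esub> = \<zero>\<^bsub>VH W\<^esub>"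
  by (rule additive_zero[OF chi_additive[OF hopf_ract[OF hopf]] WB.T_group VHW.abelian_group_axioms])

lemma chi_injD: "X \<in> carrier (WB W act) \<Longrightarrow> Y \<in> carrier (WB W act) \<Longrightarrow> chi W act X = chi W act Y \<Longrightarrow> X = Y"
  by (rule inj_onD[OF bij_betw_imp_inj_on[OF chi_bij[OF hopf_ract[OF hopf]]]])

text \<open>Let \<open>X\<close> be the image of \<open>Y\<close> in \<open>W \<otimes>_B A\<close>.
  If the product vanishes, \<open>chi_kernel\<close> gives \<open>chi X = \<delta> 0 = 0\<close>, so
  \<open>X = 0\<close>; by flatness the inclusion of the coinvariants stays injective, so
  \<open>Y = 0\<close>.\<close>

lemma theta_inj: "inj_on (theta W act) (carrier (WB (coinv W \<delta>) act))"
proof (rule additive_inj_onI[OF theta_additive[OF hopf] CB.T_group WB.M_group])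
  fix Y assume Y: "Y \<in> carrier (WB (coinv W \<delta>) act)" and 0: "theta W act Y = \<zero>\<^bsub>W\<^esub>"
  interpret zW: abelian_group "WB W act" by (rule WB.T_group)
  interpret zC: abelian_group "WB (coinv W \<delta>) act" by (rule CB.T_group)
  define X where "X = tmap (WB W act) (\<lambda>w. w) Y"
  have X: "X \<in> carrier (WB W act)" unfolding X_def by (rule additive_closed[OF tmap_incl(1)[OF hopf] Y])
  have "tmap (WB (VH W) (act' W act)) (coinv_defect W \<delta>) X = \<zero>\<^bsub>WB (VH W) (act' W act)\<^esub>"
    unfolding X_def by (rule tmap_zero[OF coinv_rmod[OF hopf] incl_rhom[OF hopf] _ Y]) (simp add: coinv_coinv_defect[OF hopf])
  then have "chi W act X = \<delta> (mu W act X)" by (rule chi_kernel[OF hopf X])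
  also have "mu W act X = \<zero>\<^bsub>W\<^esub>" using 0 by (simp add: X_def theta_def[OF hopf])
  also have "\<delta> \<zero>\<^bsub>W\<^esub> = \<zero>\<^bsub>VH W\<^esub>"
    by (rule additive_zero[OF klin_additive[OF hopf_klin[OF hopf]] WB.M_group VHW.abelian_group_axioms])
  finally have "X = \<zero>\<^bsub>WB W act\<^esub>" using chi_injD[OF X] chi_zero by simp
  moreover have "tmap (WB W act) (\<lambda>w. w) \<zero>\<^bsub>WB (coinv W \<delta>) act\<^esub> = \<zero>\<^bsub>WB W act\<^esub>"
    by (rule additive_zero[OF tmap_incl(1)[OF hopf] CB.T_group WB.T_group])
  ultimately have eq: "tmap (WB W act) (\<lambda>w. w) Y = tmap (WB W act) (\<lambda>w. w) \<zero>\<^bsub>WB (coinv W \<delta>) act\<^esub>"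
    unfolding X_def by simp
  have "inj_on (tmap (WB W act) (\<lambda>w. w)) (carrier (WB (coinv W \<delta>) act))"
    by (rule flat.flat_inj[OF coinv_rmod[OF hopf] ract_rmod[OF hopf_ract[OF hopf]] incl_rhom[OF hopf] encodable_coinv encodable_W, THEN iffD1])
      (rule inj_on_id2)
  from inj_onD[OF this eq Y] show "Y = \<zero>\<^bsub>WB (coinv W \<delta>) act\<^esub>" by simp
qed

text \<open>The candidate is the preimage \<open>X\<close> of \<open>\<delta> w\<close> under
  \<open>chi\<close>. By \<open>chi_tmap_g\<close> and coassociativity at \<open>w\<close> it is in
  the kernel of \<open>coinv_defect\<close> tensored with \<open>A\<close>; flatness lifts it to the
  coinvariants, and the counit shows that its product is \<open>w\<close>.\<close>

lemma theta_surj_cond: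
  assumes w: "w \<in> carrier W" and co: "hmap K H (VH W) \<delta> (\<delta> w) = coprod_map W (\<delta> w)" and cu: "counit_map W (\<delta> w) = w"
  obtains Y where "Y \<in> carrier (WB (coinv W \<delta>) act)" "theta W act Y = w"
proof -
  note dw = klin_closed[OF hopf_klin[OF hopf] w]
  obtain X where X: "X \<in> carrier (WB W act)" "chi W act X = \<delta> w"
    using dw unfolding bij_betw_imp_surj_on[OF chi_bij[OF hopf_ract[OF hopf]], symmetric] by fastforce
  interpret z: abelian_group "WB (VH W) (act' W act)" by (rule WB'.T_group)
  let ?g = "tmap (WB (VH W) (act' W act)) (coinv_defect W \<delta>)"
  have gX: "?g X \<in> carrier (WB (VH W) (act' W act))" by (rule additive_closed[OF tmap_g(1)[OF hopf] X(1)])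
  have "coprod_map W (\<delta> w) \<in> carrier (VH (VH W))" by (rule klin_closed[OF coprod_map_klin(1)[OF Wm[OF hopf]] dw])
  then have "chi (VH W) (act' W act) (?g X) = \<zero>\<^bsub>VH (VH W)\<^esub>"
    using chi_tmap_g[OF hopf X(1)] by (simp add: X(2) co a_minus_def VVHW.r_neg)
  also have "\<dots> = chi (VH W) (act' W act) \<zero>\<^bsub>WB (VH W) (act' W act)\<^esub>"
    by (rule additive_zero[OF chi_additive[OF W'[OF hopf]] WB'.T_group VVHW.abelian_group_axioms, symmetric])
  finally have "?g X = \<zero>\<^bsub>WB (VH W) (act' W act)\<^esub>"
    by (rule inj_onD[OF bij_betw_imp_inj_on[OF chi_bij[OF W'[OF hopf]]] _ gX]) simp
  moreover have "exact_pair (coinv W \<delta>) (\<lambda>w. w) W (coinv_defect W \<delta>) (VH W)"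
    by (auto simp: exact_pair_def coinv_coinv_defect[OF hopf])
  ultimately have "X \<in> tmap (WB W act) (\<lambda>w. w) ` carrier (WB (coinv W \<delta>) act)"
    using flat.flat_exact[OF coinv_rmod[OF hopf] ract_rmod[OF hopf_ract[OF hopf]] ract_rmod[OF W'[OF hopf]]
        incl_rhom[OF hopf] coinv_defect_rhom[OF hopf] encodable_coinv encodable_W encodable_VHW] X(1)
    by (simp add: exact_pair_def)
  then obtain Y where Y: "Y \<in> carrier (WB (coinv W \<delta>) act)" "X = tmap (WB W act) (\<lambda>w. w) Y" by blast
  have "theta W act Y = mu W act X" by (simp add: theta_def[OF hopf] Y(2))
  also have "\<dots> = w" using counit_map_chi[OF hopf_ract[OF hopf] X(1)] X(2) cu by simp
  finally show ?thesis using that Y(1) by blast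
qed

text \<open>The image of \<open>theta\<close> is stable under \<open>A\<close>, so surjectivity can
  be tested on module generators.\<close>

lemma theta_act:
  assumes Y: "Y \<in> carrier (WB (coinv W \<delta>) act)" and a: "a \<in> carrier A"
  shows "\<exists>Y' \<in> carrier (WB (coinv W \<delta>) act). theta W act Y' = act (theta W act Y) a"
  using Y
proof (rule CB.tensor_induct)
  interpret zC: abelian_group "WB (coinv W \<delta>) act" by (rule CB.T_group)
  fix c e assume "c \<in> carrier (coinv W \<delta>)" "e \<in> carrier A"
  then show "\<exists>Y' \<in> carrier (WB (coinv W \<delta>) act). theta W act Y' = act (theta W act (ten (WB (coinv W \<delta>) act) c e)) a"
    using a kbil_closed[OF A.H_mult]
    by (intro bexI[of _ "ten (WB (coinv W \<delta>) act) c (e \<otimes>\<^bsub>A\<^esub> a)"])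
      (simp_all add: theta_ten[OF hopf] W_assoc[OF hopf_ract[OF hopf]] coinv_closed[OF hopf] CB.ten_closed)
next
  interpret zC: abelian_group "WB (coinv W \<delta>) act" by (rule CB.T_group)
  fix X Y assume XY: "X \<in> carrier (WB (coinv W \<delta>) act)" "Y \<in> carrier (WB (coinv W \<delta>) act)"
    and "\<exists>Y' \<in> carrier (WB (coinv W \<delta>) act). theta W act Y' = act (theta W act X) a"
      "\<exists>Y' \<in> carrier (WB (coinv W \<delta>) act). theta W act Y' = act (theta W act Y) a"
  then obtain X' Y' where *: "X' \<in> carrier (WB (coinv W \<delta>) act)" "theta W act X' = act (theta W act X) a"
      "Y' \<in> carrier (WB (coinv W \<delta>) act)" "theta W act Y' = act (theta W act Y) a" by auto
  note t = theta_additive[OF hopf]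
  show "\<exists>Y' \<in> carrier (WB (coinv W \<delta>) act). theta W act Y' = act (theta W act (X \<oplus>\<^bsub>WB (coinv W \<delta>) act\<^esub> Y)) a"
    by (rule bexI[of _ "X' \<oplus>\<^bsub>WB (coinv W \<delta>) act\<^esub> Y'"])
      (use * XY a in \<open>simp_all add: additive_add[OF t] kbil_add_left[OF W_kbil[OF hopf_ract[OF hopf]]] additive_closed[OF t]\<close>)
qed

end

section \<open>The Hopf modules \<open>V \<otimes> A\<close> with diagonal coaction\<close>

definition act_tensor :: "('k, 'v) module \<Rightarrow> ('v, 'a) tensor \<Rightarrow> 'a \<Rightarrow> ('v, 'a) tensor" where
  "act_tensor V X a = tensor_lift (tensor_K K V A) (\<lambda>v z. ten (tensor_K K V A) v (z \<otimes>\<^bsub>A\<^esub> a)) X"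

text \<open>General in \<open>V\<close> because it is applied twice: \<open>V = A\<close> gives
  \<open>A \<otimes> A\<close>, and \<open>V = A \<otimes> A\<close> gives the target of
  \<kappa>.\<close>

definition delta_tensor :: "('k, 'v) module \<Rightarrow> ('v \<Rightarrow> ('v, 'h) tensor) \<Rightarrow> ('v, 'a) tensor \<Rightarrow> (('v, 'a) tensor, 'h) tensor" where
  "delta_tensor V \<delta> = tensor_lift (VH (tensor_K K V A))
     (\<lambda>v z. hbil K H (tensor_K K V A) (ten (tensor_K K V A)) (\<delta> v) (\<rho> z))"

context
  fixes V :: "('k, 'v) module" and \<delta>
  assumes V: "module K V" and d: "klin K V (VH V) \<delta>"
begin

abbreviation (input) "VA \<equiv> tensor_K K V A"

lemma VA_module: "module K VA" by (rule tK_module[OF V A.H_module])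

lemma act_tensor_kbil: "kbil K VA A VA (act_tensor V)"
proof -
  note t = tK_kbil[OF V A.H_module]
  have "kbil K A VA VA (\<lambda>a. tensor_lift VA (\<lambda>v z. ten VA v (z \<otimes>\<^bsub>A\<^esub> a)))"
  proof (rule tK_lift_param[OF V A.H_module VA_module A.H_module])
    show "kbil K V A VA (\<lambda>v z. ten VA v (z \<otimes>\<^bsub>A\<^esub> a))" if "a \<in> carrier A" for a
      by (rule kbil_comp_args[OF t klin_id kbil_left[OF A.H_mult that]])
    show "klin K A VA (\<lambda>a. ten VA v (z \<otimes>\<^bsub>A\<^esub> a))" if "v \<in> carrier V" "z \<in> carrier A" for v z
      by (rule klin_comp[OF kbil_right[OF A.H_mult that(2)] kbil_right[OF t that(1)]])
  qed
  from kbil_swap[OF this] show ?thesis by (simp add: act_tensor_def[abs_def])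
qed

lemma act_tensor_ten:
  assumes "v \<in> carrier V" "z \<in> carrier A" "a \<in> carrier A"
  shows "act_tensor V (ten VA v z) a = ten VA v (z \<otimes>\<^bsub>A\<^esub> a)"
  unfolding act_tensor_def
  by (rule tK_lift_ten[OF V A.H_module module_group[OF VA_module]
        kbil_balanced[OF kbil_comp_args[OF tK_kbil[OF V A.H_module] klin_id kbil_left[OF A.H_mult assms(3)]]] assms(1,2)])

lemma VA_ract: "ract K A VA (act_tensor V)"
  unfolding ract_def
proof (intro conjI ballI VA_module act_tensor_kbil)
  interpret AR: ring A by (rule A.H_ring)
  fix w assume w: "w \<in> carrier VA"
  show "act_tensor V w \<one>\<^bsub>A\<^esub> = w"
    by (rule tK_eqI[OF V A.H_module klin_additive[OF kbil_left[OF act_tensor_kbil A.one_H]] klin_additive[OF klin_id] w])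
      (simp add: act_tensor_ten)
  fix a a' assume a: "a \<in> carrier A" "a' \<in> carrier A"
  show "act_tensor V (act_tensor V w a) a' = act_tensor V w (a \<otimes>\<^bsub>A\<^esub> a')"
    by (rule tK_eqI[OF V A.H_module klin_additive[OF klin_comp[OF kbil_left[OF act_tensor_kbil a(1)] kbil_left[OF act_tensor_kbil a(2)]]]
          klin_additive[OF kbil_left[OF act_tensor_kbil AR.m_closed[OF a]]] w])
      (use a in \<open>simp add: act_tensor_ten AR.m_assoc\<close>)
qed

lemmas B2 = hbil_kbil[OF V A.H_module VA_module tK_kbil[OF V A.H_module]]

lemma delta_tensor_kbil: "kbil K V A (VH VA) (\<lambda>v z. hbil K H VA (ten VA) (\<delta> v) (\<rho> z))"
  by (rule kbil_comp_args[OF B2(1) d rho])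

lemma delta_tensor_klin: "klin K VA (VH VA) (delta_tensor V \<delta>)"
  unfolding delta_tensor_def by (rule tK_lift_klin[OF V A.H_module tK_module[OF VA_module H_module] delta_tensor_kbil])

lemma delta_tensor_ten: "v \<in> carrier V \<Longrightarrow> z \<in> carrier A \<Longrightarrow> delta_tensor V \<delta> (ten VA v z) = hbil K H VA (ten VA) (\<delta> v) (\<rho> z)"
  unfolding delta_tensor_def by (rule tK_lift_ten[OF V A.H_module tK_group[OF VA_module H_module] kbil_balanced[OF delta_tensor_kbil]])

lemma VA_hopf: "hopf_mod VA (act_tensor V) (delta_tensor V \<delta>)"
  unfolding hopf_mod_def
proof (intro conjI ballI VA_ract delta_tensor_klin)
  fix w a assume w: "w \<in> carrier VA" and a: "a \<in> carrier A"
  note st = star_kbil[OF VA_ract]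
  show "delta_tensor V \<delta> (act_tensor V w a) = star VA (act_tensor V) (delta_tensor V \<delta> w) (\<rho> a)"
  proof (rule tK_eqI[OF V A.H_module klin_additive[OF klin_comp[OF kbil_left[OF act_tensor_kbil a] delta_tensor_klin]]
        klin_additive[OF klin_comp[OF delta_tensor_klin kbil_left[OF st(1) rho_closed[OF a]]]] w])
    fix v z assume vz: "v \<in> carrier V" "z \<in> carrier A"
    have "star VA (act_tensor V) (hbil K H VA (ten VA) (\<delta> v) (\<rho> z)) (\<rho> a)
        = hbil K H VA (ten VA) (\<delta> v) (star A (monoid.mult A) (\<rho> z) (\<rho> a))"
      by (rule hbil_assoc[OF V A.H_module A.H_module VA_module A.H_module VA_module tK_kbil[OF V A.H_module]
            act_tensor_kbil A.H_mult tK_kbil[OF V A.H_module]])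
        (use vz a in \<open>auto simp: act_tensor_ten rho_closed klin_closed[OF d]\<close>)
    then show "delta_tensor V \<delta> (act_tensor V (ten VA v z) a) = star VA (act_tensor V) (delta_tensor V \<delta> (ten VA v z)) (\<rho> a)"
      using vz a kbil_closed[OF A.H_mult vz(2) a] by (simp add: act_tensor_ten delta_tensor_ten rho_mult)
  qed
qed

end

section \<open>The Hopf module \<open>A \<otimes> A\<close> and its reconstruction from
  coinvariants\<close>

abbreviation "M \<equiv> tensor_K K A A"
abbreviation "act_M \<equiv> act_tensor A"
definition "delta_M = delta_tensor A \<rho>"
abbreviation "C \<equiv> coinv M delta_M"

lemma M_module: "module K M"
  by (rule VA_module[OF A.H_module rho])

lemma M_hopf: "hopf_mod M act_M delta_M"
  unfolding delta_M_def by (rule VA_hopf[OF A.H_module rho])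

lemma delta_M_klin: "klin K M (VH M) delta_M"
  by (rule hopf_klin[OF M_hopf])

lemma M_ract: "ract K A M act_M"
  by (rule hopf_ract[OF M_hopf])

lemma encodable_M: "encodable TYPE('a + 'h) (carrier M)"
  by (rule encodable_tensor_K[OF A.H_module A.H_module encodable_Inl encodable_Inl])

text \<open>As \<open>\<rho>(1) = 1 \<otimes> 1\<close>, the diagonal coaction restricted to
  \<open>A \<otimes> 1\<close> is \<open>\<rho>\<close>, whose coassociativity and counit are
  available.\<close>

lemma delta_M_left:
  assumes a: "a \<in> carrier A"
  shows "delta_M (ten M a \<one>\<^bsub>A\<^esub>) = hmap K H M (\<lambda>a. ten M a \<one>\<^bsub>A\<^esub>) (\<rho> a)"
proof -
  interpret HR: ring H by (rule H_ring)
  note f = kbil_left[OF tK_kbil[OF A.H_module A.H_module] A.one_H]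
  note hf = hmap_klin[OF A.H_module M_module f]
  note b = B2[OF A.H_module rho]
  have "hbil K H M (ten M) Z (ten (VH A) \<one>\<^bsub>A\<^esub> \<one>\<^bsub>H\<^esub>) = hmap K H M (\<lambda>a. ten M a \<one>\<^bsub>A\<^esub>) Z" if "Z \<in> carrier (VH A)" for Z
    by (rule tK_eqI[OF A.H_module H_module klin_additive[OF kbil_left[OF b(1) tK_closed[OF A.H_module H_module A.one_H one_H]]]
          klin_additive[OF hf(1)] that])
      (simp add: b(2) hf(2) A.one_H)
  then show ?thesis
    using a by (simp add: delta_M_def delta_tensor_ten[OF A.H_module rho] A.one_H rho_one rho_closed)
qed

text \<open>Only surjectivity is special to \<open>M\<close>. Coassociativity and counit at
  \<open>a \<otimes> 1\<close> are inherited from \<open>\<rho>\<close>, which gives preimages of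
  these elements; acting by \<open>A\<close> reaches every \<open>a \<otimes> a'\<close>.\<close>

lemma thetaM_bij: "bij_betw (theta M act_M) (carrier (WB C act_M)) (carrier M)"
proof -
  interpret AR: ring A by (rule A.H_ring)
  interpret CB: tensor_data B C act_M A "monoid.mult A"
    using flat.tA_data[OF coinv_rmod[OF M_hopf]] .
  interpret CBg: abelian_group "WB C act_M" by (rule CB.T_group)
  let ?f = "\<lambda>a. ten M a \<one>\<^bsub>A\<^esub>"
  note f = kbil_left[OF tK_kbil[OF A.H_module A.H_module] A.one_H]
  note VHM = tK_module[OF M_module H_module]
  note t = theta_additive[OF M_hopf]
  have one: "\<exists>Y \<in> carrier (WB C act_M). theta M act_M Y = ?f a" if a: "a \<in> carrier A" for a
  proof -
    have "hmap K H (VH M) delta_M (delta_M (?f a)) = hmap K H (VH M) (\<lambda>a. delta_M (?f a)) (\<rho> a)"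
      unfolding delta_M_left[OF a] by (rule hmap_comp[OF A.H_module M_module VHM f delta_M_klin rho_closed[OF a]])
    also have "\<dots> = hmap K H (VH M) (\<lambda>a. hmap K H M ?f (\<rho> a)) (\<rho> a)"
      unfolding hmap_def[of K H "VH M"]
    proof (rule tK_lift_cong[OF A.H_module H_module rho_closed[OF a] tK_group[OF VHM H_module]])
      show "ten (VH (VH M)) (hmap K H M ?f (\<rho> m)) n \<in> carrier (VH (VH M))" if "m \<in> carrier A" "n \<in> carrier H" for m n
        using that klin_closed[OF hmap_klin(1)[OF A.H_module M_module f] rho_closed] by (simp add: tK_closed[OF VHM H_module])
    qed (simp add: delta_M_left)
    also have "\<dots> = coprod_map M (delta_M (?f a))"
      unfolding delta_M_left[OF a] by (rule coassoc_hmap[OF M_module f a])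
    finally have co: "hmap K H (VH M) delta_M (delta_M (?f a)) = coprod_map M (delta_M (?f a))" .
    have cu: "counit_map M (delta_M (?f a)) = ?f a"
      unfolding delta_M_left[OF a] by (rule counit_map_hmap[OF M_module f a])
    show ?thesis
      using theta_surj_cond[OF M_hopf encodable_M klin_closed[OF f a] co cu] by blast
  qed
  have surj: "\<exists>Y \<in> carrier (WB C act_M). theta M act_M Y = m" if "m \<in> carrier M" for m
    using that
  proof (rule tK_induct[OF A.H_module A.H_module])
    fix v w assume vw: "v \<in> carrier A" "w \<in> carrier A"
    obtain Y where Y: "Y \<in> carrier (WB C act_M)" "theta M act_M Y = ?f v" using one[OF vw(1)] by blast
    show "\<exists>Y \<in> carrier (WB C act_M). theta M act_M Y = ten M v w"
      using theta_act[OF M_hopf encodable_M Y(1) vw(2)] vw by (simp add: Y(2) act_tensor_ten[OF A.H_module rho])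
  next
    fix X Y assume "\<exists>Z \<in> carrier (WB C act_M). theta M act_M Z = X" "\<exists>Z \<in> carrier (WB C act_M). theta M act_M Z = Y"
    then obtain Z Z' where "Z \<in> carrier (WB C act_M)" "theta M act_M Z = X"
      "Z' \<in> carrier (WB C act_M)" "theta M act_M Z' = Y" by blast
    then show "\<exists>Z \<in> carrier (WB C act_M). theta M act_M Z = X \<oplus>\<^bsub>M\<^esub> Y"
      by (intro bexI[of _ "Z \<oplus>\<^bsub>WB C act_M\<^esub> Z'"]) (simp_all add: additive_add[OF t])
  qed
  show ?thesis
    unfolding bij_betw_def
  proof (intro conjI theta_inj[OF M_hopf encodable_M] equalityI subsetI)
    show "m \<in> carrier M" if "m \<in> theta M act_M ` carrier (WB C act_M)" for m
      using that additive_closed[OF t] by auto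
    show "m \<in> theta M act_M ` carrier (WB C act_M)" if "m \<in> carrier M" for m
      using surj[OF that] by auto
  qed
qed

section \<open>The tensor square of the coinvariants\<close>

interpretation AR: ring A by (rule A.H_ring)
interpretation HR: ring H by (rule H_ring)

section \<open>The algebra \<open>A \<otimes> A^op\<close> and the two actions of
  \<open>B\<close>\<close>

sublocale AO: k_alg K "opposite A"
  by unfold_locales (rule opposite_algebra[OF A_alg])

text \<open>The leg product with \<open>opposite A\<close> in the role of \<open>H\<close> is the
  multiplication of \<open>A \<otimes> A^op\<close>.\<close>

definition "mulM = hbil K (opposite A) A (monoid.mult A)"

lemmas mulM_kbil = AO.hbil_kbil(1)[OF A.H_module A.H_module A.H_module A.H_mult, folded mulM_def, unfolded tensor_module_opposite opposite_simps]

lemma mulM_ten: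
  "a \<in> carrier A \<Longrightarrow> a' \<in> carrier A \<Longrightarrow> c \<in> carrier A \<Longrightarrow> c' \<in> carrier A \<Longrightarrow>
    mulM (ten M a a') (ten M c c') = ten M (a \<otimes>\<^bsub>A\<^esub> c) (c' \<otimes>\<^bsub>A\<^esub> a')"
  using AO.hbil_kbil(2)[OF A.H_module A.H_module A.H_module A.H_mult, of a a' c c'] by (simp add: mulM_def)

lemma mulM_closed: "x \<in> carrier M \<Longrightarrow> y \<in> carrier M \<Longrightarrow> mulM x y \<in> carrier M"
  by (rule kbil_closed[OF mulM_kbil])

lemma mulM_assoc:
  "x \<in> carrier M \<Longrightarrow> y \<in> carrier M \<Longrightarrow> z \<in> carrier M \<Longrightarrow> mulM (mulM x y) z = mulM x (mulM y z)"
  using AO.hbil_assoc[OF A.H_module A.H_module A.H_module A.H_module A.H_module A.H_module A.H_mult A.H_mult A.H_mult A.H_mult, of x y z]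
  by (simp add: mulM_def AR.m_assoc)

lemma tenM_closed: "a \<in> carrier A \<Longrightarrow> a' \<in> carrier A \<Longrightarrow> ten M a a' \<in> carrier M"
  by (rule tK_closed[OF A.H_module A.H_module])

abbreviation "oneM \<equiv> ten M \<one>\<^bsub>A\<^esub> \<one>\<^bsub>A\<^esub>"

lemmas act_M_ten = act_tensor_ten[OF A.H_module rho]
lemmas act_M_kbil = act_tensor_kbil[OF A.H_module rho]

lemma act_M_closed: "m \<in> carrier M \<Longrightarrow> z \<in> carrier A \<Longrightarrow> act_M m z \<in> carrier M"
  by (rule kbil_closed[OF act_M_kbil])

text \<open>The Hopf module action is left multiplication by the target element
  \<open>1 \<otimes> z\<close>. Hence the balancing over \<open>B\<close> in the bialgebroid is the
  one used for Hopf modules.\<close>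

lemma act_M_mulM:
  assumes m: "m \<in> carrier M" and z: "z \<in> carrier A"
  shows "act_M m z = mulM (ten M \<one>\<^bsub>A\<^esub> z) m"
  by (rule tK_eqI[OF A.H_module A.H_module klin_additive[OF kbil_left[OF act_M_kbil z]]
        klin_additive[OF kbil_right[OF mulM_kbil tenM_closed[OF AR.one_closed z]]] m])
    (use z in \<open>simp add: act_M_ten mulM_ten\<close>)

lemma delta_M_ten: "a \<in> carrier A \<Longrightarrow> a' \<in> carrier A \<Longrightarrow> delta_M (ten M a a') = hbil K H M (ten M) (\<rho> a) (\<rho> a')"
  unfolding delta_M_def by (rule delta_tensor_ten[OF A.H_module rho])

text \<open>Commutativity of \<open>H\<close> enters here. The second factors multiply in reverse
  order, so for \<open>a \<otimes> a'\<close> and \<open>c \<otimes> c'\<close> the legs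
  \<open>a_1 c_1 c'_1 a'_1\<close> have to be rearranged to \<open>a_1 a'_1 c_1 c'_1\<close>. The
  coinvariants are then closed under the product.\<close>

lemma delta_M_mult:
  assumes x: "x \<in> carrier M" and y: "y \<in> carrier M"
  shows "delta_M (mulM x y) = hbil K H M mulM (delta_M x) (delta_M y)"
proof -
  let ?s = "star A (monoid.mult A)" and ?b = "hbil K H M (ten M)" and ?m = "hbil K H M mulM"
  note s = star_kbil[OF A_ract] and b = B2[OF A.H_module rho]
  note m = hbil_kbil[OF M_module M_module M_module mulM_kbil]
  note sl = kbil_left[OF s(1)] and sr = kbil_right[OF s(1)] and bl = kbil_left[OF b(1)] and br = kbil_right[OF b(1)]
    and ml = kbil_left[OF m(1)] and mr = kbil_right[OF m(1)] and sc = kbil_closed[OF s(1)] and bc = kbil_closed[OF b(1)]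
  note e = tK_eqI[OF A.H_module H_module] and tc = tK_closed[OF A.H_module H_module]
  \<comment> \<open>The four coactions are replaced by arbitrary elements of
    \<open>A \<otimes> H\<close>, so that each can be reduced to a pure tensor in turn.\<close>
  have key: "?b (?s Z1 Z2) (?s Z3 Z4) = ?m (?b Z1 Z4) (?b Z2 Z3)"
    if 1: "Z1 \<in> carrier (VH A)" and 2: "Z2 \<in> carrier (VH A)" and 3: "Z3 \<in> carrier (VH A)" and 4: "Z4 \<in> carrier (VH A)"
    for Z1 Z2 Z3 Z4
  proof (rule e[OF klin_additive[OF klin_comp[OF sl[OF 2] bl[OF sc[OF 3 4]]]]
        klin_additive[OF klin_comp[OF bl[OF 4] ml[OF bc[OF 2 3]]]] 1])
    fix a1 h1 assume a1: "a1 \<in> carrier A" "h1 \<in> carrier H"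
    note 1 = tc[OF a1]
    show "?b (?s (ten (VH A) a1 h1) Z2) (?s Z3 Z4) = ?m (?b (ten (VH A) a1 h1) Z4) (?b Z2 Z3)"
    proof (rule e[OF klin_additive[OF klin_comp[OF sr[OF 1] bl[OF sc[OF 3 4]]]]
          klin_additive[OF klin_comp[OF bl[OF 3] mr[OF bc[OF 1 4]]]] 2])
      fix a2 h2 assume a2: "a2 \<in> carrier A" "h2 \<in> carrier H"
      note 2 = tc[OF a2]
      show "?b (?s (ten (VH A) a1 h1) (ten (VH A) a2 h2)) (?s Z3 Z4)
          = ?m (?b (ten (VH A) a1 h1) Z4) (?b (ten (VH A) a2 h2) Z3)"
      proof (rule e[OF klin_additive[OF klin_comp[OF sl[OF 4] br[OF sc[OF 1 2]]]]
            klin_additive[OF klin_comp[OF br[OF 2] mr[OF bc[OF 1 4]]]] 3])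
        fix a3 h3 assume a3: "a3 \<in> carrier A" "h3 \<in> carrier H"
        note 3 = tc[OF a3]
        show "?b (?s (ten (VH A) a1 h1) (ten (VH A) a2 h2)) (?s (ten (VH A) a3 h3) Z4)
            = ?m (?b (ten (VH A) a1 h1) Z4) (?b (ten (VH A) a2 h2) (ten (VH A) a3 h3))"
        proof (rule e[OF klin_additive[OF klin_comp[OF sr[OF 3] br[OF sc[OF 1 2]]]]
              klin_additive[OF klin_comp[OF br[OF 1] ml[OF bc[OF 2 3]]]] 4])
          fix a4 h4 assume a4: "a4 \<in> carrier A" "h4 \<in> carrier H"
          have "h1 \<otimes>\<^bsub>H\<^esub> h2 \<otimes>\<^bsub>H\<^esub> (h3 \<otimes>\<^bsub>H\<^esub> h4) = h1 \<otimes>\<^bsub>H\<^esub> h4 \<otimes>\<^bsub>H\<^esub> (h2 \<otimes>\<^bsub>H\<^esub> h3)"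
            using a1 a2 a3 a4 H_comm[of "h2 \<otimes>\<^bsub>H\<^esub> h3" h4] by (simp add: HR.m_assoc)
          then show "?b (?s (ten (VH A) a1 h1) (ten (VH A) a2 h2)) (?s (ten (VH A) a3 h3) (ten (VH A) a4 h4))
            = ?m (?b (ten (VH A) a1 h1) (ten (VH A) a4 h4)) (?b (ten (VH A) a2 h2) (ten (VH A) a3 h3))"
            using a1 a2 a3 a4 by (simp add: s(2) b(2) m(2) tenM_closed mulM_ten)
        qed
      qed
    qed
  qed
  note eM = tK_eqI[OF A.H_module A.H_module]
  note d = delta_M_klin
  show ?thesis
  proof (rule eM[OF klin_additive[OF klin_comp[OF kbil_left[OF mulM_kbil y] d]]
        klin_additive[OF klin_comp[OF d ml[OF klin_closed[OF d y]]]] x])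
    fix a a' assume a: "a \<in> carrier A" "a' \<in> carrier A"
    show "delta_M (mulM (ten M a a') y) = ?m (delta_M (ten M a a')) (delta_M y)"
    proof (rule eM[OF klin_additive[OF klin_comp[OF kbil_right[OF mulM_kbil tenM_closed[OF a]] d]]
          klin_additive[OF klin_comp[OF d mr[OF klin_closed[OF d tenM_closed[OF a]]]]] y])
      fix c c' assume c: "c \<in> carrier A" "c' \<in> carrier A"
      show "delta_M (mulM (ten M a a') (ten M c c')) = ?m (delta_M (ten M a a')) (delta_M (ten M c c'))"
        using a c by (simp add: mulM_ten delta_M_ten rho_mult key rho_closed)
    qed
  qed
qed

lemma C_iff: "w \<in> carrier C \<longleftrightarrow> w \<in> carrier M \<and> delta_M w = ten (VH M) w \<one>\<^bsub>H\<^esub>"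
  by (rule coinv_iff[OF M_hopf])

lemma C_closed: "w \<in> carrier C \<Longrightarrow> w \<in> carrier M"
  by (simp add: C_iff)

lemma C_mult: "x \<in> carrier C \<Longrightarrow> y \<in> carrier C \<Longrightarrow> mulM x y \<in> carrier C"
  using hbil_kbil(2)[OF M_module M_module M_module mulM_kbil, of x "\<one>\<^bsub>H\<^esub>" y "\<one>\<^bsub>H\<^esub>"]
  by (auto simp: C_iff mulM_closed delta_M_mult)

lemma C_base:
  assumes "b \<in> B" "b' \<in> B"
  shows "ten M b b' \<in> carrier C"
  using assms B2(2)[OF A.H_module rho, of b "\<one>\<^bsub>H\<^esub>" b' "\<one>\<^bsub>H\<^esub>"] by (auto simp: C_iff delta_M_ten tenM_closed)

lemma one_B: "\<one>\<^bsub>A\<^esub> \<in> B"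
  by (simp add: rho_one)

lemma B_closed: "b \<in> B \<Longrightarrow> b \<in> carrier A" by simp

lemma C_one: "oneM \<in> carrier C"
  by (rule C_base[OF one_B one_B])

definition "act_left b m = mulM (ten M b \<one>\<^bsub>A\<^esub>) m"

lemma act_left_closed: "b \<in> carrier A \<Longrightarrow> m \<in> carrier M \<Longrightarrow> act_left b m \<in> carrier M"
  by (simp add: act_left_def mulM_closed tenM_closed)

lemma act_left_C: "b \<in> B \<Longrightarrow> m \<in> carrier C \<Longrightarrow> act_left b m \<in> carrier C"
  unfolding act_left_def by (rule C_mult[OF C_base[OF _ one_B]])

lemma act_left_ten: "b \<in> carrier A \<Longrightarrow> a \<in> carrier A \<Longrightarrow> a' \<in> carrier A \<Longrightarrow> act_left b (ten M a a') = ten M (b \<otimes>\<^bsub>A\<^esub> a) a'"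
  by (simp add: act_left_def mulM_ten)

lemma act_left_klin: "b \<in> carrier A \<Longrightarrow> klin K M M (act_left b)"
  using kbil_right[OF mulM_kbil tenM_closed[OF _ AR.one_closed]] by (simp add: act_left_def[abs_def])

lemma act_left_act_M: "b \<in> carrier A \<Longrightarrow> m \<in> carrier M \<Longrightarrow> z \<in> carrier A \<Longrightarrow> act_left b (act_M m z) = act_M (act_left b m) z"
  by (simp add: act_left_def act_M_mulM mulM_closed tenM_closed mulM_assoc[symmetric] mulM_ten)

lemma C_act: "w \<in> carrier C \<Longrightarrow> b \<in> B \<Longrightarrow> act_M w b \<in> carrier C"
  by (rule coinv_act[OF M_hopf])

lemma C_group: "abelian_group C"
  by (rule coinv_group[OF M_hopf])

lemma C_rmod: "rmod BB C act_M"
  by (rule coinv_rmod[OF M_hopf])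

section \<open>The right \<open>B\<close>-module \<open>C \<otimes>_B C\<close>\<close>

lemma CC_data: "tensor_data B C act_M C act_left"
  using C_group C_act act_left_C by (auto simp: tensor_data_def)

abbreviation "CC \<equiv> tensor B C act_M C act_left"

interpretation CC: tensor_data B C act_M C act_left by (rule CC_data)
interpretation CB: tensor_data B C act_M A "monoid.mult A" using flat.tA_data[OF C_rmod] .

lemma C_simps: "add C = add M" "\<zero>\<^bsub>C\<^esub> = \<zero>\<^bsub>M\<^esub>"
  by (simp_all add: coinv_def)

lemma encodable_CC: "encodable TYPE('a + 'h) (carrier CC)"
  by (rule CC.encodable_tensor[OF two_letters encodable_coinv[OF M_hopf encodable_M] encodable_coinv[OF M_hopf encodable_M]])

text \<open>Acts on the second factor; it respects the balancing because multiplications by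
  \<open>b \<otimes> 1\<close> and by \<open>1 \<otimes> b'\<close> commute. It is the structure
  over which \<open>C \<otimes>_B C\<close> is tensored with \<open>A\<close> once more.\<close>

definition "act_CC X b = tensor_lift CC (\<lambda>c d. ten CC c (act_M d b)) X"

lemma act_CC_balanced: "b \<in> B \<Longrightarrow> balanced B C act_M C act_left CC (\<lambda>c d. ten CC c (act_M d b))"
  by (intro balancedI additiveI)
    (auto simp: CC.ten_closed CC.ten_add_left[unfolded C_simps] CC.ten_add_right[unfolded C_simps] C_act C_simps
      kbil_add_left[OF act_M_kbil] C_closed CC.ten_move act_left_act_M[symmetric])

lemma act_CC_ten: "b \<in> B \<Longrightarrow> c \<in> carrier C \<Longrightarrow> d \<in> carrier C \<Longrightarrow> act_CC (ten CC c d) b = ten CC c (act_M d b)"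
  unfolding act_CC_def by (rule CC.lift_ten[OF CC.T_group act_CC_balanced])

lemma act_CC_additive: "b \<in> B \<Longrightarrow> additive CC CC (\<lambda>X. act_CC X b)"
  unfolding act_CC_def by (rule CC.lift_additive[OF CC.T_group act_CC_balanced])

lemma B_add: "b \<in> B \<Longrightarrow> b' \<in> B \<Longrightarrow> b \<oplus>\<^bsub>A\<^esub> b' \<in> B"
  by (simp add: klin_add[OF rho] kbil_add_left[OF tK_kbil[OF A.H_module H_module]] one_H)

lemma B_mult: "b \<in> B \<Longrightarrow> b' \<in> B \<Longrightarrow> b \<otimes>\<^bsub>A\<^esub> b' \<in> B"
  by (simp add: rho_mult star_kbil(2)[OF A_ract])

lemma CC_rmod: "rmod BB CC act_CC"
proof -
  interpret g: abelian_group CC by (rule CC.T_group)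
  have id: "additive CC CC (\<lambda>X. X)" by (simp add: additive_def)
  have 1: "act_CC X (b \<oplus>\<^bsub>A\<^esub> b') = act_CC X b \<oplus>\<^bsub>CC\<^esub> act_CC X b'" if "X \<in> carrier CC" "b \<in> B" "b' \<in> B" for X b b'
    by (rule CC.additive_eqI[OF act_CC_additive[OF B_add[OF that(2,3)]]
          additive_sum[OF act_CC_additive[OF that(2)] act_CC_additive[OF that(3)] CC.T_group] that(1)])
      (use that B_add[OF that(2,3)] in \<open>simp add: act_CC_ten kbil_add_right[OF act_M_kbil] C_closed CC.ten_add_right[unfolded C_simps] C_act\<close>)
  have 2: "act_CC X (b \<otimes>\<^bsub>A\<^esub> b') = act_CC (act_CC X b) b'" if "X \<in> carrier CC" "b \<in> B" "b' \<in> B" for X b b'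
    by (rule CC.additive_eqI[OF act_CC_additive[OF B_mult[OF that(2,3)]]
          additive_comp[OF act_CC_additive[OF that(2)] act_CC_additive[OF that(3)]] that(1)])
      (use that B_mult[OF that(2,3)] in \<open>simp add: act_CC_ten W_assoc[OF M_ract] C_closed C_act\<close>)
  have 3: "act_CC X \<one>\<^bsub>A\<^esub> = X" if "X \<in> carrier CC" for X
    by (rule CC.additive_eqI[OF act_CC_additive[OF one_B] id that])
      (use one_B in \<open>simp add: act_CC_ten W_one[OF M_ract] C_closed\<close>)
  show ?thesis
    unfolding rmod_def
    using CC.T_group 1 2 3 additive_closed[OF act_CC_additive] additive_add[OF act_CC_additive] by auto
qed

section \<open>The map \<kappa> from \<open>C \<otimes>_B C\<close> to
  \<open>M \<otimes> A\<close>\<close>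

abbreviation "T \<equiv> tensor_K K M A"
definition "delta_T = delta_tensor M delta_M"

lemma T_hopf: "hopf_mod T (act_tensor M) delta_T"
  unfolding delta_T_def by (rule VA_hopf[OF M_module delta_M_klin])

lemmas T_ract = hopf_ract[OF T_hopf]
lemmas T_module = VA_module[OF M_module delta_M_klin]
lemmas act_tensor_ten' = act_tensor_ten[OF M_module delta_M_klin]
lemmas act_tensor_kbil' = act_tensor_kbil[OF M_module delta_M_klin]
lemmas tenT_kbil = tK_kbil[OF M_module A.H_module]

lemma encodable_T: "encodable TYPE('a + 'h) (carrier T)"
  by (rule encodable_tensor_K[OF M_module A.H_module encodable_M encodable_Inl])

text \<open>Defined for all pairs in \<open>M\<close>, not just coinvariant ones; this is what lets
  \<kappa> factor through \<open>M \<otimes>_B M\<close> later.\<close>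

definition "kap_pair m = hmap K A M (act_M m)"

lemma kap_pair_kbil: "kbil K M M T kap_pair"
  unfolding kap_pair_def[abs_def] hmap_def
proof (rule tK_lift_param[OF A.H_module A.H_module T_module M_module])
  show "kbil K A A T (\<lambda>v. ten T (act_M m v))" if "m \<in> carrier M" for m
    by (rule kbil_comp_args[OF tenT_kbil kbil_right[OF act_M_kbil that] klin_id])
  show "klin K M T (\<lambda>m. ten T (act_M m v) w)" if "v \<in> carrier A" "w \<in> carrier A" for v w
    by (rule klin_comp[OF kbil_left[OF act_M_kbil that(1)] kbil_left[OF tenT_kbil that(2)]])
qed

lemma kap_pair_ten: "m \<in> carrier M \<Longrightarrow> x \<in> carrier A \<Longrightarrow> y \<in> carrier A \<Longrightarrow> kap_pair m (ten M x y) = ten T (act_M m x) y"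
  unfolding kap_pair_def by (rule A.hmap_klin(2)[OF A.H_module M_module kbil_right[OF act_M_kbil]])

lemma kap_pair_closed: "m \<in> carrier M \<Longrightarrow> d \<in> carrier M \<Longrightarrow> kap_pair m d \<in> carrier T"
  by (rule kbil_closed[OF kap_pair_kbil])

lemma kap_pair_act:
  assumes m: "m \<in> carrier M" and d: "d \<in> carrier M" and e: "e \<in> carrier A"
  shows "act_tensor M (kap_pair m d) e = kap_pair m (act_M d e)"
  by (rule tK_eqI[OF A.H_module A.H_module klin_additive[OF klin_comp[OF kbil_right[OF kap_pair_kbil m] kbil_left[OF act_tensor_kbil' e]]]
        klin_additive[OF klin_comp[OF kbil_left[OF act_M_kbil e] kbil_right[OF kap_pair_kbil m]]] d])
    (use m e in \<open>simp add: kap_pair_ten act_tensor_ten' act_M_ten act_M_closed\<close>)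

lemma kap_pair_move:
  assumes m: "m \<in> carrier M" and d: "d \<in> carrier M" and b: "b \<in> carrier A"
  shows "kap_pair (act_M m b) d = kap_pair m (act_left b d)"
  by (rule tK_eqI[OF A.H_module A.H_module klin_additive[OF kbil_right[OF kap_pair_kbil act_M_closed[OF m b]]]
        klin_additive[OF klin_comp[OF act_left_klin[OF b] kbil_right[OF kap_pair_kbil m]]] d])
    (use m b in \<open>simp add: kap_pair_ten act_left_ten act_M_closed W_assoc[OF M_ract]\<close>)

lemma delta_T_ten: "m \<in> carrier M \<Longrightarrow> z \<in> carrier A \<Longrightarrow> delta_T (ten T m z) = hbil K H T (ten T) (delta_M m) (\<rho> z)"
  unfolding delta_T_def by (rule delta_tensor_ten[OF M_module delta_M_klin])

text \<open>Coinvariance of \<open>c\<close> gives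
  \<open>\<delta>(c x) = (c \<otimes> 1) \<rho>(x)\<close>, so \<open>kap_pair c\<close> commutes
  with the coactions and sends coinvariants to coinvariants.\<close>

lemma delta_T_kap_pair:
  assumes c: "c \<in> carrier C" and d: "d \<in> carrier M"
  shows "delta_T (kap_pair c d) = hmap K H T (kap_pair c) (delta_M d)"
proof -
  note cM = C_closed[OF c]
  note Lc = kbil_right[OF kap_pair_kbil cM] and ac = kbil_right[OF act_M_kbil cM]
  note hL = hmap_klin[OF M_module T_module Lc] and ha = hmap_klin[OF A.H_module M_module ac]
  note b = B2[OF A.H_module rho] and bT = B2[OF M_module delta_M_klin]
  note e = tK_eqI[OF A.H_module H_module]
  have key: "hbil K H T (ten T) (hmap K H M (act_M c) Z) Z' = hmap K H T (kap_pair c) (hbil K H M (ten M) Z Z')"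
    if Z: "Z \<in> carrier (VH A)" and Z': "Z' \<in> carrier (VH A)" for Z Z'
  proof (rule e[OF klin_additive[OF klin_comp[OF ha(1) kbil_left[OF bT(1) Z']]]
        klin_additive[OF klin_comp[OF kbil_left[OF b(1) Z'] hL(1)]] Z])
    fix a h assume ah: "a \<in> carrier A" "h \<in> carrier H"
    note t = tK_closed[OF A.H_module H_module ah]
    show "hbil K H T (ten T) (hmap K H M (act_M c) (ten (VH A) a h)) Z' = hmap K H T (kap_pair c) (hbil K H M (ten M) (ten (VH A) a h) Z')"
      by (rule e[OF klin_additive[OF kbil_right[OF bT(1) klin_closed[OF ha(1) t]]]
            klin_additive[OF klin_comp[OF kbil_right[OF b(1) t] hL(1)]] Z'])
        (use ah cM in \<open>simp add: ha(2) bT(2) b(2) hL(2) tenM_closed act_M_closed kap_pair_ten\<close>)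
  qed
  show ?thesis
  proof (rule tK_eqI[OF A.H_module A.H_module klin_additive[OF klin_comp[OF Lc hopf_klin[OF T_hopf]]]
        klin_additive[OF klin_comp[OF delta_M_klin hL(1)]] d])
    fix x y assume xy: "x \<in> carrier A" "y \<in> carrier A"
    have "delta_M (act_M c x) = hmap K H M (act_M c) (\<rho> x)"
      using hopf_act[OF M_hopf cM xy(1)] c star_one_left[OF M_ract cM rho_closed[OF xy(1)]] by (simp add: C_iff)
    then show "delta_T (kap_pair c (ten M x y)) = hmap K H T (kap_pair c) (delta_M (ten M x y))"
      using xy cM by (simp add: kap_pair_ten delta_T_ten delta_M_ten act_M_closed key rho_closed)
  qed
qed

definition "kap = tensor_lift T kap_pair"

lemma kap_balanced: "balanced B C act_M C act_left T kap_pair"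
proof (intro balancedI)
  show "additive C T (\<lambda>m. kap_pair m n)" if "n \<in> carrier C" for n
    using klin_additive[OF kbil_left[OF kap_pair_kbil C_closed[OF that]]] C_closed by (auto simp: additive_def C_simps)
  show "additive C T (kap_pair m)" if "m \<in> carrier C" for m
    using klin_additive[OF kbil_right[OF kap_pair_kbil C_closed[OF that]]] C_closed by (auto simp: additive_def C_simps)
qed (auto simp: kap_pair_move C_closed)

lemma kap_additive: "additive CC T kap"
  unfolding kap_def by (rule CC.lift_additive[OF module_group[OF T_module] kap_balanced])

lemma kap_ten: "c \<in> carrier C \<Longrightarrow> d \<in> carrier C \<Longrightarrow> kap (ten CC c d) = kap_pair c d"
  unfolding kap_def by (rule CC.lift_ten[OF module_group[OF T_module] kap_balanced])

lemma kap_rhom: "rhom BB CC act_CC T (act_tensor M) kap"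
  unfolding rhom_def
proof (intro conjI ballI kap_additive)
  fix X b assume X: "X \<in> carrier CC" and b: "b \<in> carrier BB"
  then have b: "b \<in> B" by simp
  show "kap (act_CC X b) = act_tensor M (kap X) b"
    by (rule CC.additive_eqI[OF additive_comp[OF act_CC_additive[OF b] kap_additive]
          additive_comp[OF kap_additive klin_additive[OF kbil_left[OF act_tensor_kbil' B_closed[OF b]]]] X])
      (use b in \<open>simp add: act_CC_ten kap_ten C_act kap_pair_act C_closed\<close>)
qed

lemma kap_coinv:
  assumes "X \<in> carrier CC"
  shows "coinv_defect T delta_T (kap X) = \<zero>\<^bsub>VH T\<^esub>"
proof -
  interpret VHT: abelian_group "VH T" by (rule tK_group[OF T_module H_module])
  show ?thesis
  proof (rule CC.additive_eqI[OF additive_comp[OF kap_additive coinv_defect_additive[OF T_hopf]] _ assms, of "\<lambda>_. \<zero>\<^bsub>VH T\<^esub>"])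
    fix c d assume c: "c \<in> carrier C" and d: "d \<in> carrier C"
    have "delta_T (kap_pair c d) = ten (VH T) (kap_pair c d) \<one>\<^bsub>H\<^esub>"
      using delta_T_kap_pair[OF c C_closed[OF d]] d hmap_klin(2)[OF M_module T_module kbil_right[OF kap_pair_kbil C_closed[OF c]]]
      by (simp add: C_iff one_H)
    then have "kap_pair c d \<in> carrier (coinv T delta_T)" using c d by (simp add: coinv_iff[OF T_hopf] kap_pair_closed C_closed)
    then show "coinv_defect T delta_T (kap (ten CC c d)) = \<zero>\<^bsub>VH T\<^esub>"
      using c d by (simp add: coinv_coinv_defect[OF T_hopf] kap_ten)
  qed (simp add: additive_def)
qed

section \<open>Comparing \<open>C \<otimes>_B C \<otimes>_B A\<close> with
  \<open>M \<otimes> A\<close>\<close>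

abbreviation "CA \<equiv> WB C act_M"
abbreviation "CCA \<equiv> tensor B CC act_CC A (monoid.mult A)"
abbreviation "theta_M \<equiv> theta M act_M"
definition "theta_inv = the_inv_into (carrier CA) theta_M"

lemma CCA_data: "tensor_data B CC act_CC A (monoid.mult A)"
  using flat.tA_data[OF CC_rmod] .

interpretation CCA: tensor_data B CC act_CC A "monoid.mult A" by (rule CCA_data)

lemma theta_inv_additive: "additive M CA theta_inv"
  unfolding theta_inv_def by (rule additive_the_inv[OF theta_additive[OF M_hopf] thetaM_bij CB.T_group])

lemma theta_inv_closed: "m \<in> carrier M \<Longrightarrow> theta_inv m \<in> carrier CA"
  by (rule additive_closed[OF theta_inv_additive])

lemma theta_M_closed: "Y \<in> carrier CA \<Longrightarrow> theta_M Y \<in> carrier M"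
  by (rule additive_closed[OF theta_additive[OF M_hopf]])

lemma theta_inv_theta_M: "Y \<in> carrier CA \<Longrightarrow> theta_inv (theta_M Y) = Y"
  unfolding theta_inv_def using thetaM_bij by (simp add: bij_betw_def the_inv_into_f_f)

lemma theta_M_theta_inv: "m \<in> carrier M \<Longrightarrow> theta_M (theta_inv m) = m"
  unfolding theta_inv_def using thetaM_bij by (simp add: bij_betw_def f_the_inv_into_f)

lemma theta_M_ten: "c \<in> carrier C \<Longrightarrow> e \<in> carrier A \<Longrightarrow> theta_M (ten CA c e) = act_M c e"
  by (rule theta_ten[OF M_hopf])

text \<open>The rebracketing of \<open>C \<otimes>_B (C \<otimes>_B A)\<close> into
  \<open>(C \<otimes>_B C) \<otimes>_B A\<close>, for one \<open>c\<close> at a time.\<close>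

definition "tensor_left c = tensor_lift CCA (\<lambda>d e. ten CCA (ten CC c d) e)"

lemma tensor_left_balanced: "c \<in> carrier C \<Longrightarrow> balanced B C act_M A (monoid.mult A) CCA (\<lambda>d e. ten CCA (ten CC c d) e)"
  by (intro balancedI additiveI)
    (auto simp: CCA.ten_closed CC.ten_closed CC.ten_add_right CCA.ten_add_left CCA.ten_add_right act_CC_ten[symmetric]
      CCA.ten_move)

lemma tensor_left_additive: "c \<in> carrier C \<Longrightarrow> additive CA CCA (tensor_left c)"
  unfolding tensor_left_def by (rule CB.lift_additive[OF CCA.T_group tensor_left_balanced])

lemma tensor_left_ten: "c \<in> carrier C \<Longrightarrow> d \<in> carrier C \<Longrightarrow> e \<in> carrier A \<Longrightarrow> tensor_left c (ten CA d e) = ten CCA (ten CC c d) e"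
  unfolding tensor_left_def by (rule CB.lift_ten[OF CCA.T_group tensor_left_balanced])

lemma tensor_left_additive_left: "Z \<in> carrier CA \<Longrightarrow> additive C CCA (\<lambda>c. tensor_left c Z)"
  unfolding tensor_left_def
  by (rule CB.lift_additive_param[OF CCA.T_group CC.M_group _ tensor_left_balanced])
    (auto intro!: additiveI simp: CCA.ten_closed CC.ten_closed CC.ten_add_left CCA.ten_add_left)

text \<open>The left \<open>B\<close>-action on \<open>C \<otimes>_B A\<close> is expressed by
  transport from \<open>M\<close>, where it is multiplication by \<open>b \<otimes> 1\<close>; the
  transported action is the expected one on the factor \<open>C\<close>.\<close>

lemma theta_M_act_left:
  assumes b: "b \<in> B" and d: "d \<in> carrier C" and e: "e \<in> carrier A"
  shows "theta_inv (act_left b (theta_M (ten CA d e))) = ten CA (act_left b d) e"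
  using theta_inv_theta_M[OF CB.ten_closed[OF act_left_C[OF b d] e]] b d e
  by (simp add: theta_M_ten act_left_act_M C_closed act_left_C)

lemma tensor_left_move:
  assumes c: "c \<in> carrier C" and b: "b \<in> B" and Z: "Z \<in> carrier CA"
  shows "tensor_left (act_M c b) Z = tensor_left c (theta_inv (act_left b (theta_M Z)))"
  by (rule CB.additive_eqI[OF tensor_left_additive[OF C_act[OF c b]] additive_comp[OF additive_comp[OF additive_comp[OF
        theta_additive[OF M_hopf] klin_additive[OF act_left_klin[OF B_closed[OF b]]]] theta_inv_additive] tensor_left_additive[OF c]] Z])
    (simp only: theta_M_act_left[OF b] tensor_left_ten[OF C_act[OF c b]] tensor_left_ten[OF c act_left_C[OF b]] CC.ten_move[OF c b])

text \<open>Observes \<open>kap\<close> tensored with \<open>A\<close> through multiplication into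
  \<open>T\<close>. A left inverse of this composite already makes the tensored map injective, and
  its surjectivity supplies candidates for preimages.\<close>

definition "CCA_iso X = mu T (act_tensor M) (tmap (WB T (act_tensor M)) kap X)"

lemmas tmap_kap = flat.tmap_additive[OF CC_rmod ract_rmod[OF T_ract] kap_rhom]
  flat.tmap_ten[OF CC_rmod ract_rmod[OF T_ract] kap_rhom]

lemma CCA_iso_additive: "additive CCA T CCA_iso"
  unfolding CCA_iso_def[abs_def] by (rule additive_comp[OF tmap_kap(1) mu_additive[OF T_ract]])

lemma CCA_iso_ten: "X \<in> carrier CC \<Longrightarrow> e \<in> carrier A \<Longrightarrow> CCA_iso (ten CCA X e) = act_tensor M (kap X) e"
  by (simp add: CCA_iso_def tmap_kap(2) mu_ten[OF T_ract] additive_closed[OF kap_additive])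

text \<open>Reads the map as \<open>C \<otimes>_B (C \<otimes>_B A) = C \<otimes>_B M\<close> by
  \<open>theta_M\<close>, followed by
  \<open>c \<otimes> (y \<otimes> e) \<mapsto> c y \<otimes> e\<close>, which is
  \<open>theta_M\<close> once more on the first two factors.\<close>

lemma CCA_iso_tensor_left:
  assumes c: "c \<in> carrier C" and Z: "Z \<in> carrier CA"
  shows "CCA_iso (tensor_left c Z) = kap_pair c (theta_M Z)"
  by (rule CB.additive_eqI[OF additive_comp[OF tensor_left_additive[OF c] CCA_iso_additive]
        additive_comp[OF theta_additive[OF M_hopf] klin_additive[OF kbil_right[OF kap_pair_kbil C_closed[OF c]]]] Z])
    (use c in \<open>simp add: tensor_left_ten CCA_iso_ten CC.ten_closed kap_ten kap_pair_act C_closed theta_M_ten\<close>)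

lemma CCA_iso_surj:
  assumes "X \<in> carrier T"
  shows "\<exists>W \<in> carrier CCA. CCA_iso W = X"
  using assms
proof (rule tK_induct[OF M_module A.H_module])
  interpret CCAg: abelian_group CCA by (rule CCA.T_group)
  have add: "\<exists>W \<in> carrier CCA. CCA_iso W = X \<oplus>\<^bsub>T\<^esub> Y"
    if X: "\<exists>W \<in> carrier CCA. CCA_iso W = X" and Y: "\<exists>W \<in> carrier CCA. CCA_iso W = Y" for X Y
  proof -
    obtain V W where "V \<in> carrier CCA" "CCA_iso V = X" "W \<in> carrier CCA" "CCA_iso W = Y" using X Y by blast
    then show ?thesis
      by (intro bexI[of _ "V \<oplus>\<^bsub>CCA\<^esub> W"]) (simp_all add: additive_add[OF CCA_iso_additive])
  qed
  show "\<exists>W \<in> carrier CCA. CCA_iso W = X \<oplus>\<^bsub>T\<^esub> Y"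
    if "\<exists>W \<in> carrier CCA. CCA_iso W = X" "\<exists>W \<in> carrier CCA. CCA_iso W = Y" for X Y
    using that by (rule add)
  fix m e assume m: "m \<in> carrier M" and e: "e \<in> carrier A"
  \<comment> \<open>Writing \<open>m\<close> as \<open>theta_M Y\<close> makes it a sum of elements
    \<open>c y\<close>; then \<open>c y \<otimes> e\<close> comes from \<open>c\<close> together
    with the preimage of \<open>y \<otimes> e\<close> under \<open>theta_M\<close>.\<close>
  have "\<exists>W \<in> carrier CCA. CCA_iso W = ten T (theta_M Y) e" if "Y \<in> carrier CA" for Y
    using that
  proof (rule CB.tensor_induct)
    fix c y assume c: "c \<in> carrier C" and y: "y \<in> carrier A"
    have t: "theta_inv (ten M y e) \<in> carrier CA" by (rule theta_inv_closed[OF tenM_closed[OF y e]])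
    have "CCA_iso (tensor_left c (theta_inv (ten M y e))) = ten T (theta_M (ten CA c y)) e"
      using c y e by (simp add: CCA_iso_tensor_left[OF c t] theta_M_theta_inv tenM_closed theta_M_ten kap_pair_ten C_closed)
    then show "\<exists>W \<in> carrier CCA. CCA_iso W = ten T (theta_M (ten CA c y)) e"
      using additive_closed[OF tensor_left_additive[OF c] t] by blast
  next
    fix X Y assume XY: "X \<in> carrier CA" "Y \<in> carrier CA"
      and "\<exists>W \<in> carrier CCA. CCA_iso W = ten T (theta_M X) e" "\<exists>W \<in> carrier CCA. CCA_iso W = ten T (theta_M Y) e"
    then show "\<exists>W \<in> carrier CCA. CCA_iso W = ten T (theta_M (X \<oplus>\<^bsub>CA\<^esub> Y)) e"
      using add[of "ten T (theta_M X) e" "ten T (theta_M Y) e"] e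
      by (simp add: additive_add[OF theta_additive[OF M_hopf]] kbil_add_left[OF tenT_kbil] theta_M_closed)
  qed
  from this[OF theta_inv_closed[OF m]] show "\<exists>W \<in> carrier CCA. CCA_iso W = ten T m e"
    using theta_M_theta_inv[OF m] by simp
qed

text \<open>The inverse of \<open>CCA_iso\<close> with the last factor fixed:
  \<open>c y \<otimes> e\<close> goes to \<open>c \<otimes> theta_inv (y \<otimes> e)\<close>,
  rebracketed by \<open>tensor_left\<close>.\<close>

definition "Psi_slice e = tensor_lift CCA (\<lambda>c y. tensor_left c (theta_inv (ten M y e)))"

lemmas tenM_kbil = tK_kbil[OF A.H_module A.H_module]

lemma Psi_slice_balanced:
  assumes e: "e \<in> carrier A"
  shows "balanced B C act_M A (monoid.mult A) CCA (\<lambda>c y. tensor_left c (theta_inv (ten M y e)))"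
proof (rule balancedI)
  show "additive C CCA (\<lambda>c. tensor_left c (theta_inv (ten M y e)))" if "y \<in> carrier A" for y
    by (rule tensor_left_additive_left[OF theta_inv_closed[OF tenM_closed[OF that e]]])
  show "additive A CCA (\<lambda>y. tensor_left c (theta_inv (ten M y e)))" if "c \<in> carrier C" for c
    by (rule additive_comp[OF additive_comp[OF klin_additive[OF kbil_left[OF tenM_kbil e]] theta_inv_additive] tensor_left_additive[OF that]])
  show "tensor_left (act_M c b) (theta_inv (ten M y e)) = tensor_left c (theta_inv (ten M (b \<otimes>\<^bsub>A\<^esub> y) e))"
    if "c \<in> carrier C" "b \<in> B" "y \<in> carrier A" for c b y
    using tensor_left_move[OF that(1,2) theta_inv_closed[OF tenM_closed[OF that(3) e]]] that e
    by (simp add: theta_M_theta_inv tenM_closed act_left_ten)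
qed

lemma Psi_slice_additive: "e \<in> carrier A \<Longrightarrow> additive CA CCA (Psi_slice e)"
  unfolding Psi_slice_def by (rule CB.lift_additive[OF CCA.T_group Psi_slice_balanced])

lemma Psi_slice_ten: "e \<in> carrier A \<Longrightarrow> c \<in> carrier C \<Longrightarrow> y \<in> carrier A \<Longrightarrow> Psi_slice e (ten CA c y) = tensor_left c (theta_inv (ten M y e))"
  unfolding Psi_slice_def by (rule CB.lift_ten[OF CCA.T_group Psi_slice_balanced])

lemma Psi_slice_additive_param:
  assumes Z: "Z \<in> carrier CA" shows "additive A CCA (\<lambda>e. Psi_slice e Z)"
  unfolding Psi_slice_def
proof (rule CB.lift_additive_param[OF CCA.T_group AR.is_abelian_group Z Psi_slice_balanced])
  show "additive A CCA (\<lambda>e. tensor_left c (theta_inv (ten M y e)))" if "c \<in> carrier C" "y \<in> carrier A" for c y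
    by (rule additive_comp[OF additive_comp[OF klin_additive[OF kbil_right[OF tenM_kbil that(2)]] theta_inv_additive] tensor_left_additive[OF that(1)]])
qed

lemma Psi_slice_smult:
  assumes k: "k \<in> carrier K" and e: "e \<in> carrier A" and Z: "Z \<in> carrier CA"
  shows "Psi_slice (k \<odot>\<^bsub>A\<^esub> e) Z = Psi_slice e (theta_inv (k \<odot>\<^bsub>M\<^esub> theta_M Z))"
proof -
  interpret Am: module K A by (rule A.H_module)
  interpret Mm: module K M by (rule M_module)
  have a: "additive M M (\<lambda>x. k \<odot>\<^bsub>M\<^esub> x)"
    using k by (auto intro!: additiveI simp: Mm.smult_r_distr)
  show ?thesis
  proof (rule CB.additive_eqI[OF Psi_slice_additive additive_comp[OF additive_comp[OF additive_comp[OF theta_additive[OF M_hopf] a] theta_inv_additive]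
          Psi_slice_additive[OF e]] Z])
    fix c y assume c: "c \<in> carrier C" and y: "y \<in> carrier A"
    have ky: "k \<odot>\<^bsub>A\<^esub> y \<in> carrier A" using k y by simp
    have "theta_inv (k \<odot>\<^bsub>M\<^esub> theta_M (ten CA c y)) = ten CA c (k \<odot>\<^bsub>A\<^esub> y)"
      using theta_inv_theta_M[OF CB.ten_closed[OF c ky]] c y k ky
      by (simp add: theta_M_ten kbil_smult_right[OF act_M_kbil] C_closed)
    then show "Psi_slice (k \<odot>\<^bsub>A\<^esub> e) (ten CA c y) = Psi_slice e (theta_inv (k \<odot>\<^bsub>M\<^esub> theta_M (ten CA c y)))"
      using c y k e ky tK_move[OF A.H_module A.H_module k y e] by (simp add: Psi_slice_ten)
  qed (use k e in simp)
qed

definition "Psi = tensor_lift CCA (\<lambda>m e. Psi_slice e (theta_inv m))"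

lemma Psi_balanced: "kbalanced K M A CCA (\<lambda>m e. Psi_slice e (theta_inv m))"
proof (rule balancedI)
  show "additive M CCA (\<lambda>m. Psi_slice e (theta_inv m))" if "e \<in> carrier A" for e
    by (rule additive_comp[OF theta_inv_additive Psi_slice_additive[OF that]])
  show "additive A CCA (\<lambda>e. Psi_slice e (theta_inv m))" if "m \<in> carrier M" for m
    by (rule Psi_slice_additive_param[OF theta_inv_closed[OF that]])
  show "Psi_slice e (theta_inv (k \<odot>\<^bsub>M\<^esub> m)) = Psi_slice (k \<odot>\<^bsub>A\<^esub> e) (theta_inv m)" if "m \<in> carrier M" "k \<in> carrier K" "e \<in> carrier A" for m k e
    using that by (simp add: Psi_slice_smult theta_inv_closed theta_M_theta_inv)
qed

lemma Psi_additive: "additive T CCA Psi"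
  unfolding Psi_def by (rule tK_lift_additive[OF M_module A.H_module CCA.T_group Psi_balanced])

lemma Psi_ten: "m \<in> carrier M \<Longrightarrow> e \<in> carrier A \<Longrightarrow> Psi (ten T m e) = Psi_slice e (theta_inv m)"
  unfolding Psi_def by (rule tK_lift_ten[OF M_module A.H_module CCA.T_group Psi_balanced])

lemma Psi_kap_pair:
  assumes c: "c \<in> carrier C" and m: "m \<in> carrier M"
  shows "Psi (kap_pair c m) = tensor_left c (theta_inv m)"
proof (rule tK_eqI[OF A.H_module A.H_module additive_comp[OF klin_additive[OF kbil_right[OF kap_pair_kbil C_closed[OF c]]] Psi_additive]
      additive_comp[OF theta_inv_additive tensor_left_additive[OF c]] m])
  fix y e assume y: "y \<in> carrier A" and e: "e \<in> carrier A"
  have "theta_inv (act_M c y) = ten CA c y" using theta_inv_theta_M[OF CB.ten_closed[OF c y]] c y by (simp add: theta_M_ten)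
  then show "Psi (kap_pair c (ten M y e)) = tensor_left c (theta_inv (ten M y e))"
    using c y e by (simp add: kap_pair_ten C_closed Psi_ten act_M_closed Psi_slice_ten)
qed

lemma Psi_CCA_iso:
  assumes "X \<in> carrier CCA"
  shows "Psi (CCA_iso X) = X"
  using assms
proof (rule CCA.tensor_induct)
  fix Y e assume Y: "Y \<in> carrier CC" and e: "e \<in> carrier A"
  have te: "additive CC CCA (\<lambda>Y. ten CCA Y e)"
    using CCA.ten_balanced e by (simp add: balanced_def)
  show "Psi (CCA_iso (ten CCA Y e)) = ten CCA Y e"
  proof (rule CC.additive_eqI[OF additive_comp[OF te additive_comp[OF CCA_iso_additive Psi_additive]] te Y])
    fix c d assume c: "c \<in> carrier C" and d: "d \<in> carrier C"
    have t: "ten CA d e \<in> carrier CA" by (rule CB.ten_closed[OF d e])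
    have "Psi (CCA_iso (tensor_left c (ten CA d e))) = tensor_left c (ten CA d e)"
      by (simp add: CCA_iso_tensor_left[OF c t] Psi_kap_pair[OF c theta_M_closed[OF t]] theta_inv_theta_M[OF t])
    then show "Psi (CCA_iso (ten CCA (ten CC c d) e)) = ten CCA (ten CC c d) e"
      by (simp only: tensor_left_ten[OF c d e])
  qed
next
  fix X Y assume "X \<in> carrier CCA" "Y \<in> carrier CCA" "Psi (CCA_iso X) = X" "Psi (CCA_iso Y) = Y"
  then show "Psi (CCA_iso (X \<oplus>\<^bsub>CCA\<^esub> Y)) = X \<oplus>\<^bsub>CCA\<^esub> Y"
    by (simp add: additive_add[OF CCA_iso_additive] additive_add[OF Psi_additive] additive_closed[OF CCA_iso_additive])
qed

text \<open>The left inverse \<open>Psi\<close> of \<open>CCA_iso\<close> makes \<open>kap\<close>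
  tensored with \<open>A\<close> injective, and faithful flatness reflects injectivity.\<close>

lemma kap_inj: "inj_on kap (carrier CC)"
proof -
  have "inj_on (tmap (WB T (act_tensor M)) kap) (carrier CCA)"
  proof (rule inj_onI)
    fix X Y assume X: "X \<in> carrier CCA" and Y: "Y \<in> carrier CCA"
      and eq: "tmap (WB T (act_tensor M)) kap X = tmap (WB T (act_tensor M)) kap Y"
    have "CCA_iso X = CCA_iso Y" unfolding CCA_iso_def eq by (rule refl)
    then show "X = Y" by (rule Psi_CCA_iso[OF X, symmetric, THEN trans, OF trans[OF arg_cong[of _ _ Psi] Psi_CCA_iso[OF Y]]])
  qed
  then show ?thesis
    using flat.flat_inj[OF CC_rmod ract_rmod[OF T_ract] kap_rhom encodable_CC encodable_T] by blast
qed

text \<open>Exactness of \<open>CC \<rightarrow> T \<rightarrow> T \<otimes> H\<close> is tested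
  after tensoring. Given \<open>X\<close> in the kernel, surjectivity of \<open>CCA_iso\<close>
  yields \<open>W\<close> whose image has the same product as \<open>X\<close>; both satisfy
  \<open>chi_kernel\<close>, so injectivity of \<open>chi\<close> identifies them.\<close>

lemma kap_image:
  assumes "t \<in> carrier (coinv T delta_T)"
  shows "t \<in> kap ` carrier CC"
proof -
  let ?TA = "WB T (act_tensor M)" and ?TH = "WB (VH T) (act' T (act_tensor M))"
  let ?k = "tmap ?TA kap" and ?g = "tmap ?TH (coinv_defect T delta_T)"
  have "exact_pair CCA ?k ?TA ?g ?TH"
    unfolding exact_pair_def
  proof (intro equalityI subsetI)
    fix X assume "X \<in> ?k ` carrier CCA"
    then show "X \<in> {m \<in> carrier ?TA. ?g m = \<zero>\<^bsub>?TH\<^esub>}"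
      using tmap_zero[OF T_hopf encodable_T CC_rmod kap_rhom kap_coinv] additive_closed[OF tmap_kap(1)] by auto
  next
    fix X assume "X \<in> {m \<in> carrier ?TA. ?g m = \<zero>\<^bsub>?TH\<^esub>}"
    then have X: "X \<in> carrier ?TA" "?g X = \<zero>\<^bsub>?TH\<^esub>" by auto
    obtain W where W: "W \<in> carrier CCA" "CCA_iso W = mu T (act_tensor M) X"
      using CCA_iso_surj[OF additive_closed[OF mu_additive[OF T_ract] X(1)]] by blast
    have kW: "?k W \<in> carrier ?TA" by (rule additive_closed[OF tmap_kap(1) W(1)])
    have "chi T (act_tensor M) (?k W) = delta_T (mu T (act_tensor M) (?k W))"
      by (rule chi_kernel[OF T_hopf kW tmap_zero[OF T_hopf encodable_T CC_rmod kap_rhom kap_coinv W(1)]])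
    also have "\<dots> = delta_T (mu T (act_tensor M) X)" using W(2) by (simp add: CCA_iso_def)
    also have "\<dots> = chi T (act_tensor M) X" by (rule chi_kernel[OF T_hopf X, symmetric])
    finally have "?k W = X" by (rule chi_injD[OF T_hopf encodable_T kW X(1)])
    then show "X \<in> ?k ` carrier CCA" using W(1) by blast
  qed
  then have "exact_pair CC kap T (coinv_defect T delta_T) (VH T)"
    using flat.flat_exact[OF CC_rmod ract_rmod[OF T_ract] ract_rmod[OF W'[OF T_hopf]] kap_rhom coinv_defect_rhom[OF T_hopf]
        encodable_CC encodable_T encodable_VHW[OF T_hopf encodable_T]] by blast
  then show ?thesis using assms coinv_coinv_defect[OF T_hopf] unfolding exact_pair_def by blast
qed

section \<open>The Ehresmann--Schauenburg carrier as coinvariants\<close>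

interpretation D: tensor_data B A "monoid.mult A" A "monoid.mult A" by (rule WB_data[OF A_ract])
interpretation MB: tensor_data B M act_M A "monoid.mult A" by (rule WB_data[OF M_ract])

abbreviation "MA \<equiv> WB M act_M"
abbreviation "PP \<equiv> tensor_K K A DK"

lemma PP_module: "module K PP"
  by (rule tK_module[OF A.H_module DK_module])

lemmas tenP_kbil = tK_kbil[OF A.H_module DK_module]

lemma tenD_left: "v \<in> carrier A \<Longrightarrow> klin K A DK (\<lambda>u. ten D u v)"
  by (intro klinI additiveI) (auto simp: DK_simps D.ten_closed D.ten_add_left DK_smult_ten)

lemma tenD_right: "u \<in> carrier A \<Longrightarrow> additive A D (ten D u)"
  by (intro additiveI) (auto simp: D.ten_closed D.ten_add_right)

definition "right_mult_D a = tensor_lift D (\<lambda>u v. ten D u (v \<otimes>\<^bsub>A\<^esub> a))"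

lemma right_mult_D_balanced: "a \<in> carrier A \<Longrightarrow> balanced B A (monoid.mult A) A (monoid.mult A) D (\<lambda>u v. ten D u (v \<otimes>\<^bsub>A\<^esub> a))"
  by (intro balancedI additiveI)
    (auto simp: D.ten_closed D.ten_add_left D.ten_add_right AR.l_distr D.ten_move AR.m_assoc)

lemma right_mult_D_ten: "a \<in> carrier A \<Longrightarrow> u \<in> carrier A \<Longrightarrow> v \<in> carrier A \<Longrightarrow> right_mult_D a (ten D u v) = ten D u (v \<otimes>\<^bsub>A\<^esub> a)"
  unfolding right_mult_D_def by (rule D.lift_ten[OF D.T_group right_mult_D_balanced])

lemma right_mult_D_additive: "a \<in> carrier A \<Longrightarrow> additive D D (right_mult_D a)"
  unfolding right_mult_D_def by (rule D.lift_additive[OF D.T_group right_mult_D_balanced])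

lemma smult_DK_additive: "k \<in> carrier K \<Longrightarrow> additive D D (\<lambda>d. k \<odot>\<^bsub>DK\<^esub> d)"
  using tensor_module_data.TM_smult_additive[OF DK_data] by (simp add: DK_def)

text \<open>Scalars act on the left factor by construction; they cross the tensor sign because
  \<open>k 1\<close> lies in \<open>B\<close>.\<close>

lemma smult_DK_right:
  assumes "k \<in> carrier K" "u \<in> carrier A" "v \<in> carrier A"
  shows "k \<odot>\<^bsub>DK\<^esub> ten D u v = ten D u (k \<odot>\<^bsub>A\<^esub> v)"
proof -
  interpret Am: module K A by (rule A.H_module)
  have k1: "k \<odot>\<^bsub>A\<^esub> \<one>\<^bsub>A\<^esub> \<in> B"
    using assms(1) by (simp add: klin_smult[OF rho] rho_one kbil_smult_left[OF tK_kbil[OF A.H_module H_module]] one_H)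
  have "k \<odot>\<^bsub>A\<^esub> u = u \<otimes>\<^bsub>A\<^esub> (k \<odot>\<^bsub>A\<^esub> \<one>\<^bsub>A\<^esub>)" "(k \<odot>\<^bsub>A\<^esub> \<one>\<^bsub>A\<^esub>) \<otimes>\<^bsub>A\<^esub> v = k \<odot>\<^bsub>A\<^esub> v"
    using assms by (simp_all add: kbil_smult_right[OF A.H_mult] kbil_smult_left[OF A.H_mult])
  then show ?thesis using assms D.ten_move[OF assms(2) k1 assms(3)] by (simp add: DK_smult_ten)
qed

lemma right_mult_D_kbil: "kbil K A DK DK right_mult_D"
proof (rule kbilI)
  interpret Am: module K A by (rule A.H_module)
  show "klin K DK DK (right_mult_D a)" if a: "a \<in> carrier A" for a
  proof (rule klinI)
    show "additive DK DK (right_mult_D a)" using right_mult_D_additive[OF a] by (simp add: additive_def DK_simps)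
    show "right_mult_D a (k \<odot>\<^bsub>DK\<^esub> d) = k \<odot>\<^bsub>DK\<^esub> right_mult_D a d" if "k \<in> carrier K" "d \<in> carrier DK" for k d
      by (rule D.additive_eqI[OF additive_comp[OF smult_DK_additive right_mult_D_additive] additive_comp[OF right_mult_D_additive smult_DK_additive]])
        (use that a in \<open>auto simp: DK_simps DK_smult_ten right_mult_D_ten\<close>)
  qed
  show "klin K A DK (\<lambda>a. right_mult_D a d)" if d: "d \<in> carrier DK" for d
  proof (rule klinI)
    have d': "d \<in> carrier D" using d by (simp add: DK_simps)
    have "additive A D (\<lambda>a. right_mult_D a d)"
      unfolding right_mult_D_def
      by (rule D.lift_additive_param[OF D.T_group AR.is_abelian_group d' right_mult_D_balanced])
        (auto intro!: additiveI simp: D.ten_closed D.ten_add_right AR.r_distr)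
    then show "additive A DK (\<lambda>a. right_mult_D a d)" by (simp add: additive_def DK_simps)
    show "right_mult_D (k \<odot>\<^bsub>A\<^esub> a) d = k \<odot>\<^bsub>DK\<^esub> right_mult_D a d" if "k \<in> carrier K" "a \<in> carrier A" for k a
      by (rule D.additive_eqI[OF right_mult_D_additive additive_comp[OF right_mult_D_additive smult_DK_additive] d'])
        (use that in \<open>auto simp: right_mult_D_ten smult_DK_right kbil_smult_right[OF A.H_mult]\<close>)
  qed
qed

lemma chi_right_mult_D:
  assumes a: "a \<in> carrier A" and d: "d \<in> carrier D"
  shows "chiA (right_mult_D a d) = star A (monoid.mult A) (chiA d) (\<rho> a)"
  by (rule D.additive_eqI[OF additive_comp[OF right_mult_D_additive[OF a] chi_additive[OF A_ract]]
        additive_comp[OF chi_additive[OF A_ract] klin_additive[OF kbil_left[OF star_kbil(1)[OF A_ract] rho_closed[OF a]]]] d])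
    (use a in \<open>simp add: right_mult_D_ten chi_ten[OF A_ract] rho_mult star_assoc[OF A_ract] rho_closed klin_closed[OF ten1_klin[OF A_ract]]\<close>)

text \<open>The rebracketing of \<open>A \<otimes> (A \<otimes>_B A)\<close> into
  \<open>(A \<otimes> A) \<otimes>_B A\<close>, written through \<open>eta\<close> at
  \<open>a \<otimes> 1\<close>.\<close>

definition "alpha = tensor_lift MA (\<lambda>a d. eta M act_M (ten M a \<one>\<^bsub>A\<^esub>) d)"

lemmas tenM1 = kbil_left[OF tenM_kbil A.one_H]

lemma alpha_balanced: "kbalanced K A DK MA (\<lambda>a d. eta M act_M (ten M a \<one>\<^bsub>A\<^esub>) d)"
proof (rule balancedI)
  show "additive A MA (\<lambda>a. eta M act_M (ten M a \<one>\<^bsub>A\<^esub>) d)" if "d \<in> carrier DK" for d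
    by (rule additive_comp[OF klin_additive[OF tenM1] eta_additive_left[OF M_ract]]) (use that in \<open>simp add: DK_simps\<close>)
  show "additive DK MA (eta M act_M (ten M a \<one>\<^bsub>A\<^esub>))" if "a \<in> carrier A" for a
    using eta_additive[OF M_ract klin_closed[OF tenM1 that]] by (simp add: additive_def DK_simps)
  show "eta M act_M (ten M (k \<odot>\<^bsub>A\<^esub> a) \<one>\<^bsub>A\<^esub>) d = eta M act_M (ten M a \<one>\<^bsub>A\<^esub>) (k \<odot>\<^bsub>DK\<^esub> d)"
    if "a \<in> carrier A" "k \<in> carrier K" "d \<in> carrier DK" for a k d
    using that by (simp add: klin_smult[OF tenM1] eta_smult[OF M_ract] klin_closed[OF tenM1] DK_simps)
qed

lemma alpha_additive: "additive PP MA alpha"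
  unfolding alpha_def by (rule tK_lift_additive[OF A.H_module DK_module MB.T_group alpha_balanced])

lemma alpha_ten: "a \<in> carrier A \<Longrightarrow> d \<in> carrier D \<Longrightarrow> alpha (ten PP a d) = eta M act_M (ten M a \<one>\<^bsub>A\<^esub>) d"
  unfolding alpha_def using tK_lift_ten[OF A.H_module DK_module MB.T_group alpha_balanced] by (simp add: DK_simps)

text \<open>The reverse rebracketing \<open>be\<close> is a left inverse; it is assembled from the
  maps \<open>a \<otimes> u \<mapsto> a \<otimes> (u \<otimes> e)\<close> for fixed
  \<open>e\<close>.\<close>

lemma alpha_inj: "inj_on alpha (carrier PP)"
proof -
  let ?G = "\<lambda>e. tensor_lift PP (\<lambda>a u. ten PP a (ten D u e))"
  have k: "kbil K A A PP (\<lambda>a u. ten PP a (ten D u e))" if "e \<in> carrier A" for e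
    by (rule kbil_comp_args[OF tenP_kbil klin_id tenD_left[OF that]])
  have G_ten: "?G e (ten M a u) = ten PP a (ten D u e)" if "a \<in> carrier A" "u \<in> carrier A" "e \<in> carrier A" for a u e
    by (rule tK_lift_ten[OF A.H_module A.H_module module_group[OF PP_module] kbil_balanced[OF k[OF that(3)]] that(1,2)])
  have G_add: "additive M PP (?G e)" if "e \<in> carrier A" for e
    by (rule klin_additive[OF tK_lift_klin[OF A.H_module A.H_module PP_module k[OF that]]])
  have b: "balanced B M act_M A (monoid.mult A) PP (\<lambda>m e. ?G e m)"
  proof (rule balancedI)
    show "additive M PP (?G e)" if "e \<in> carrier A" for e by (rule G_add[OF that])
    interpret AA: tensor_module_data "carrier K" A "\<lambda>v k. k \<odot>\<^bsub>A\<^esub> v" A "\<lambda>k w. k \<odot>\<^bsub>A\<^esub> w" K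
      by (rule tensor_K_data[OF A.H_module A.H_module])
    show "additive A PP (\<lambda>e. ?G e m)" if "m \<in> carrier M" for m
    proof (rule AA.lift_additive_param[OF module_group[OF PP_module] AR.is_abelian_group])
      show "m \<in> carrier AA.T" using that by (simp add: tensor_module_simps)
      show "kbalanced K A A PP (\<lambda>a u. ten PP a (ten D u e))" if "e \<in> carrier A" for e
        by (rule kbil_balanced[OF k[OF that]])
      show "additive A PP (\<lambda>e. ten PP a (ten D u e))" if "a \<in> carrier A" "u \<in> carrier A" for a u
        using tenD_right[OF that(2)] klin_additive[OF kbil_right[OF tenP_kbil that(1)]]
        by (auto simp: additive_def DK_simps)
    qed
    fix m c e assume m: "m \<in> carrier M" and c: "c \<in> B" and e: "e \<in> carrier A"
    have ce: "c \<otimes>\<^bsub>A\<^esub> e \<in> carrier A" using c e by simp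
    show "?G e (act_M m c) = ?G (c \<otimes>\<^bsub>A\<^esub> e) m"
      by (rule tK_eqI[OF A.H_module A.H_module additive_comp[OF klin_additive[OF kbil_left[OF act_M_kbil B_closed[OF c]]] G_add[OF e]]
            G_add[OF ce] m])
        (use c e ce in \<open>simp add: act_M_ten G_ten D.ten_move\<close>)
  qed
  define be where "be = tensor_lift PP (\<lambda>m e. ?G e m)"
  have be_add: "additive MA PP be" unfolding be_def by (rule MB.lift_additive[OF module_group[OF PP_module] b])
  have be_ten: "be (ten MA m e) = ?G e m" if "m \<in> carrier M" "e \<in> carrier A" for m e
    unfolding be_def by (rule MB.lift_ten[OF module_group[OF PP_module] b that])
  have be_alpha: "be (alpha p) = p" if "p \<in> carrier PP" for p
  proof (rule tK_eqI[OF A.H_module DK_module additive_comp[OF alpha_additive be_add] klin_additive[OF klin_id] that])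
    fix a d assume a: "a \<in> carrier A" and "d \<in> carrier DK"
    then have d: "d \<in> carrier D" by (simp add: DK_simps)
    have tP: "additive D PP (ten PP a)"
      using klin_additive[OF kbil_right[OF tenP_kbil a]] by (simp add: additive_def DK_simps)
    note t = klin_closed[OF tenM1 a]
    have "be (eta M act_M (ten M a \<one>\<^bsub>A\<^esub>) d) = ten PP a d"
      by (rule D.additive_eqI[OF additive_comp[OF eta_additive[OF M_ract t] be_add] tP d])
        (use a t in \<open>simp add: eta_ten[OF M_ract] be_ten act_M_ten G_ten tenM_closed\<close>)
    then show "be (alpha (ten PP a d)) = ten PP a d" using a d by (simp add: alpha_ten)
  qed
  show ?thesis by (rule inj_on_inverseI[of _ be]) (rule be_alpha)
qed

text \<open>\<open>chi\<close> after \<open>alpha\<close> embeds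
  \<open>A \<otimes> (A \<otimes>_B A)\<close> into \<open>(A \<otimes> A) \<otimes> H\<close>.
  Since \<open>chiA\<close> takes \<open>\<tau>(h) a'\<close> to
  \<open>(1 \<otimes> h) \<rho>(a')\<close>, the two sides of the defining equation become the
  diagonal coaction of \<open>X\<close> and \<open>X \<otimes> 1\<close>.\<close>

lemma ES_condition:
  assumes X: "X \<in> carrier M"
  shows "tensor_lift PP (\<lambda>a a'. tensor_lift PP (\<lambda>a0 a1. tensor_lift PP (\<lambda>u v.
             ten PP a0 (ten DK u (v \<otimes>\<^bsub>A\<^esub> a'))) (\<tau> a1)) (\<rho> a)) X
         = tensor_lift PP (\<lambda>a a'. ten PP a (ten DK a' \<one>\<^bsub>A\<^esub>)) X
     \<longleftrightarrow> X \<in> carrier C"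
    (is "?l = ?r \<longleftrightarrow> _")
proof -
  note pg = module_group[OF PP_module]
  let ?f = "\<lambda>a' a0 a1. ten PP a0 (right_mult_D a' (\<tau> a1))"
  have inner: "tensor_lift PP (\<lambda>u v. ten PP a0 (ten DK u (v \<otimes>\<^bsub>A\<^esub> a'))) d = ten PP a0 (right_mult_D a' d)"
    if a: "a0 \<in> carrier A" "a' \<in> carrier A" and d: "d \<in> carrier D" for a0 a' d
  proof -
    have tP: "additive D PP (ten PP a0)"
      using klin_additive[OF kbil_right[OF tenP_kbil a(1)]] by (simp add: additive_def DK_simps)
    note b = balanced_comp[OF right_mult_D_balanced[OF a(2)] tP]
    show ?thesis
      unfolding DK_simps
      by (rule D.additive_eqI[OF D.lift_additive[OF pg b] additive_comp[OF right_mult_D_additive[OF a(2)] tP] d])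
        (use a in \<open>simp add: D.lift_ten[OF pg b] right_mult_D_ten\<close>)
  qed
  have fk: "kbil K A H PP (?f a')" if "a' \<in> carrier A" for a'
    by (rule kbil_comp_args[OF tenP_kbil klin_id klin_comp[OF tau_klin kbil_right[OF right_mult_D_kbil that]]])
  have fa: "klin K A PP (\<lambda>a'. ?f a' a0 a1)" if "a0 \<in> carrier A" "a1 \<in> carrier H" for a0 a1
    by (rule klin_comp[OF kbil_left[OF right_mult_D_kbil klin_closed[OF tau_klin that(2)]] kbil_right[OF tenP_kbil that(1)]])
  note pk = tK_lift_param[OF A.H_module H_module PP_module A.H_module fk fa]
  let ?F = "\<lambda>a a'. tensor_lift PP (?f a') (\<rho> a)"
  have Fk: "kbil K A A PP ?F"
    using kbil_comp_args[OF kbil_swap[OF pk] rho klin_id] .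
  have l: "?l = tensor_lift PP ?F X"
  proof (rule tK_lift_cong[OF A.H_module A.H_module X pg])
    fix a a' assume a: "a \<in> carrier A" "a' \<in> carrier A"
    show "tensor_lift PP (\<lambda>a0 a1. tensor_lift PP (\<lambda>u v. ten PP a0 (ten DK u (v \<otimes>\<^bsub>A\<^esub> a'))) (\<tau> a1)) (\<rho> a) = ?F a a'"
      by (rule tK_lift_cong[OF A.H_module H_module rho_closed[OF a(1)] pg])
        (use a kbil_closed[OF fk[OF a(2)]] in \<open>simp_all add: inner tau_closed\<close>)
    show "?F a a' \<in> carrier PP" by (rule kbil_closed[OF Fk a])
  qed
  note F_add = tK_lift_additive[OF A.H_module A.H_module pg kbil_balanced[OF Fk]]
    and F_ten = tK_lift_ten[OF A.H_module A.H_module pg kbil_balanced[OF Fk]]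
  have Rk: "kbil K A A PP (\<lambda>a a'. ten PP a (ten DK a' \<one>\<^bsub>A\<^esub>))"
    unfolding DK_simps by (rule kbil_comp_args[OF tenP_kbil klin_id tenD_left[OF A.one_H]])
  note R_add = tK_lift_additive[OF A.H_module A.H_module pg kbil_balanced[OF Rk]]
    and R_ten = tK_lift_ten[OF A.H_module A.H_module pg kbil_balanced[OF Rk]]
  note ca = additive_comp[OF alpha_additive chi_additive[OF M_ract]]
  note b2 = B2[OF A.H_module rho] and st = star_kbil[OF M_ract]
  note t1 = ten1_klin[OF M_ract]
  have key: "chi M act_M (alpha (tensor_lift PP (?f a') Z)) = hbil K H M (ten M) Z (\<rho> a')"
    if Z: "Z \<in> carrier (VH A)" and a': "a' \<in> carrier A" for Z a'
  proof (rule tK_eqI[OF A.H_module H_module additive_comp[OF klin_additive[OF kbil_right[OF pk a']] ca]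
        klin_additive[OF kbil_left[OF b2(1) rho_closed[OF a']]] Z])
    fix a0 a1 assume a0: "a0 \<in> carrier A" and a1: "a1 \<in> carrier H"
    note m = klin_closed[OF tenM1 a0]
    have "chi M act_M (alpha (ten PP a0 (right_mult_D a' (\<tau> a1)))) = star M act_M (ten (VH M) (ten M a0 \<one>\<^bsub>A\<^esub>) \<one>\<^bsub>H\<^esub>) (chiA (right_mult_D a' (\<tau> a1)))"
      using a0 a1 a' m by (simp add: alpha_ten additive_closed[OF right_mult_D_additive] tau_closed chi_eta[OF M_ract])
    also have "\<dots> = star M act_M (star M act_M (ten (VH M) (ten M a0 \<one>\<^bsub>A\<^esub>) \<one>\<^bsub>H\<^esub>) (ten (VH A) \<one>\<^bsub>A\<^esub> a1)) (\<rho> a')"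
      using a1 a' by (simp add: chi_right_mult_D tau_closed chi_tau star_assoc[OF M_ract] klin_closed[OF t1 m]
          tK_closed[OF A.H_module H_module] rho_closed)
    also have "\<dots> = star M act_M (ten (VH M) (ten M a0 \<one>\<^bsub>A\<^esub>) a1) (\<rho> a')"
      using m a1 by (simp add: st(2) W_one[OF M_ract])
    also have "\<dots> = hbil K H M (ten M) (ten (VH A) a0 a1) (\<rho> a')"
      by (rule tK_eqI[OF A.H_module H_module klin_additive[OF kbil_right[OF st(1) tK_closed[OF M_module H_module m a1]]]
            klin_additive[OF kbil_right[OF b2(1) tK_closed[OF A.H_module H_module a0 a1]]] rho_closed[OF a']])
        (use a0 a1 m in \<open>simp add: st(2) b2(2) act_M_ten\<close>)
    finally show "chi M act_M (alpha (tensor_lift PP (?f a') (ten (VH A) a0 a1))) = hbil K H M (ten M) (ten (VH A) a0 a1) (\<rho> a')"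
      using a0 a1 by (simp add: tK_lift_ten[OF A.H_module H_module pg kbil_balanced[OF fk[OF a']]])
  qed
  have cl: "chi M act_M (alpha (tensor_lift PP ?F X)) = delta_M X"
    by (rule tK_eqI[OF A.H_module A.H_module additive_comp[OF F_add ca] klin_additive[OF delta_M_klin] X])
      (simp add: F_ten key rho_closed delta_M_ten)
  have cr: "chi M act_M (alpha ?r) = ten (VH M) X \<one>\<^bsub>H\<^esub>"
  proof (rule tK_eqI[OF A.H_module A.H_module additive_comp[OF R_add ca] klin_additive[OF t1] X])
    fix a a' assume a: "a \<in> carrier A" "a' \<in> carrier A"
    note m = klin_closed[OF tenM1 a(1)]
    have "alpha (ten PP a (ten DK a' \<one>\<^bsub>A\<^esub>)) = ten MA (ten M a a') \<one>\<^bsub>A\<^esub>"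
      using a m by (simp add: DK_simps alpha_ten D.ten_closed eta_ten[OF M_ract] act_M_ten)
    then show "chi M act_M (alpha (tensor_lift PP (\<lambda>a a'. ten PP a (ten DK a' \<one>\<^bsub>A\<^esub>)) (ten M a a'))) = ten (VH M) (ten M a a') \<one>\<^bsub>H\<^esub>"
      using a by (simp add: R_ten chi_ten[OF M_ract] tenM_closed star_one[OF M_ract] klin_closed[OF t1])
  qed
  have lc: "tensor_lift PP ?F X \<in> carrier PP" by (rule additive_closed[OF F_add X])
  have rc: "?r \<in> carrier PP" by (rule additive_closed[OF R_add X])
  note chi_inv_M = bij_betw_imp_inj_on[OF chi_bij[OF M_ract]]
  show ?thesis
  proof
    assume "?l = ?r"
    then have "delta_M X = ten (VH M) X \<one>\<^bsub>H\<^esub>" using l cl cr by simp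
    then show "X \<in> carrier C" using X by (simp add: C_iff)
  next
    assume "X \<in> carrier C"
    then have "chi M act_M (alpha (tensor_lift PP ?F X)) = chi M act_M (alpha ?r)"
      unfolding cl cr by (simp add: C_iff)
    then have "alpha (tensor_lift PP ?F X) = alpha ?r"
      by (rule inj_onD[OF chi_inv_M _ additive_closed[OF alpha_additive lc] additive_closed[OF alpha_additive rc]])
    then show "?l = ?r" unfolding l by (rule inj_onD[OF alpha_inj _ lc rc])
  qed
qed

section \<open>Coproduct and antipode\<close>

lemma Q_data: "tensor_data B M act_M M act_left"
  by (simp add: tensor_data_def module_group[OF M_module] act_M_closed act_left_closed)

abbreviation "QT \<equiv> tensor B M act_M M act_left"

interpretation Q: tensor_data B M act_M M act_left by (rule Q_data)

lemma smult_one_B: "k \<in> carrier K \<Longrightarrow> k \<odot>\<^bsub>A\<^esub> \<one>\<^bsub>A\<^esub> \<in> B"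
  using module.smult_closed[OF A.H_module]
  by (simp add: klin_smult[OF rho] rho_one kbil_smult_left[OF tK_kbil[OF A.H_module H_module]] one_H)

lemma Q_smult_move:
  assumes k: "k \<in> carrier K" and x: "x \<in> carrier M" and v: "v \<in> carrier A" "z \<in> carrier A"
  shows "ten QT (k \<odot>\<^bsub>M\<^esub> x) (ten M v z) = ten QT x (ten M v (k \<odot>\<^bsub>A\<^esub> z))"
proof -
  interpret Am: module K A by (rule A.H_module)
  note k1 = smult_one_B[OF k]
  have "k \<odot>\<^bsub>M\<^esub> x = act_M x (k \<odot>\<^bsub>A\<^esub> \<one>\<^bsub>A\<^esub>)"
    using k x by (simp add: kbil_smult_right[OF act_M_kbil] W_one[OF M_ract])
  moreover have "act_left (k \<odot>\<^bsub>A\<^esub> \<one>\<^bsub>A\<^esub>) (ten M v z) = ten M v (k \<odot>\<^bsub>A\<^esub> z)"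
    using k v tK_move[OF A.H_module A.H_module k v] by (simp add: act_left_ten kbil_smult_left[OF A.H_mult])
  ultimately show ?thesis
    using Q.ten_move[OF x k1 tenM_closed[OF v]] by simp
qed

definition "psi_slice z = tensor_lift QT (\<lambda>m e. ten QT m (ten M e z))"

lemma psi_slice_balanced: "z \<in> carrier A \<Longrightarrow> balanced B M act_M A (monoid.mult A) QT (\<lambda>m e. ten QT m (ten M e z))"
  by (intro balancedI additiveI)
    (auto simp: Q.ten_closed tenM_closed Q.ten_add_left Q.ten_add_right kbil_add_left[OF tenM_kbil] Q.ten_move act_left_ten)

lemma psi_slice_additive: "z \<in> carrier A \<Longrightarrow> additive MA QT (psi_slice z)"
  unfolding psi_slice_def by (rule MB.lift_additive[OF Q.T_group psi_slice_balanced])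

lemma psi_slice_ten: "z \<in> carrier A \<Longrightarrow> m \<in> carrier M \<Longrightarrow> e \<in> carrier A \<Longrightarrow> psi_slice z (ten MA m e) = ten QT m (ten M e z)"
  unfolding psi_slice_def by (rule MB.lift_ten[OF Q.T_group psi_slice_balanced])

lemma psi_slice_additive_left: "Y \<in> carrier MA \<Longrightarrow> additive A QT (\<lambda>z. psi_slice z Y)"
  unfolding psi_slice_def
  by (rule MB.lift_additive_param[OF Q.T_group AR.is_abelian_group _ psi_slice_balanced])
    (auto intro!: additiveI simp: Q.ten_closed tenM_closed Q.ten_add_right kbil_add_right[OF tenM_kbil])

abbreviation "chi_inv_M \<equiv> chi_inv M act_M"

lemma chi_inv_M_closed: "Y \<in> carrier (VH M) \<Longrightarrow> chi_inv_M Y \<in> carrier MA"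
  by (rule additive_closed[OF chi_inv_additive[OF M_ract]])

lemma psi_slice_chi_inv_M_smult:
  assumes k: "k \<in> carrier K" and z: "z \<in> carrier A" and Y: "Y \<in> carrier (VH M)"
  shows "psi_slice z (chi_inv_M (k \<odot>\<^bsub>VH M\<^esub> Y)) = psi_slice (k \<odot>\<^bsub>A\<^esub> z) (chi_inv_M Y)"
proof -
  interpret Am: module K A by (rule A.H_module)
  interpret Mm: module K M by (rule M_module)
  interpret VHM: module K "VH M" by (rule tK_module[OF M_module H_module])
  have kz: "k \<odot>\<^bsub>A\<^esub> z \<in> carrier A" using k z by simp
  have a: "additive (VH M) (VH M) (\<lambda>x. k \<odot>\<^bsub>VH M\<^esub> x)"
    using k by (auto intro!: additiveI simp: VHM.smult_r_distr)
  note c = chi_inv_additive[OF M_ract]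
  show ?thesis
  proof (rule tK_eqI[OF M_module H_module additive_comp[OF additive_comp[OF a c] psi_slice_additive[OF z]] additive_comp[OF c psi_slice_additive[OF kz]] Y])
    fix m h assume m: "m \<in> carrier M" and h: "h \<in> carrier H"
    have km: "k \<odot>\<^bsub>M\<^esub> m \<in> carrier M" using k m by simp
    have "psi_slice z (eta M act_M (k \<odot>\<^bsub>M\<^esub> m) d) = psi_slice (k \<odot>\<^bsub>A\<^esub> z) (eta M act_M m d)" if "d \<in> carrier D" for d
      by (rule D.additive_eqI[OF additive_comp[OF eta_additive[OF M_ract km] psi_slice_additive[OF z]]
            additive_comp[OF eta_additive[OF M_ract m] psi_slice_additive[OF kz]] that])
        (use k m km z kz in \<open>simp add: eta_ten[OF M_ract] psi_slice_ten act_M_closed kbil_smult_left[OF act_M_kbil] Q_smult_move\<close>)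
    then show "psi_slice z (chi_inv_M (k \<odot>\<^bsub>VH M\<^esub> ten (VH M) m h)) = psi_slice (k \<odot>\<^bsub>A\<^esub> z) (chi_inv_M (ten (VH M) m h))"
      using k m h km by (simp add: tK_smult_ten[OF M_module H_module] chi_inv_ten[OF M_ract] tau_closed)
  qed
qed

lemma psi_balanced: "kbalanced K M A QT (\<lambda>m z. psi_slice z (chi_inv_M (delta_M m)))"
proof (rule balancedI)
  show "additive M QT (\<lambda>m. psi_slice z (chi_inv_M (delta_M m)))" if "z \<in> carrier A" for z
    by (rule additive_comp[OF additive_comp[OF klin_additive[OF delta_M_klin] chi_inv_additive[OF M_ract]] psi_slice_additive[OF that]])
  show "additive A QT (\<lambda>z. psi_slice z (chi_inv_M (delta_M m)))" if "m \<in> carrier M" for m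
    by (rule psi_slice_additive_left[OF chi_inv_M_closed[OF klin_closed[OF delta_M_klin that]]])
  show "psi_slice z (chi_inv_M (delta_M (k \<odot>\<^bsub>M\<^esub> m))) = psi_slice (k \<odot>\<^bsub>A\<^esub> z) (chi_inv_M (delta_M m))" if "m \<in> carrier M" "k \<in> carrier K" "z \<in> carrier A" for m k z
    using that by (simp add: klin_smult[OF delta_M_klin] psi_slice_chi_inv_M_smult klin_closed[OF delta_M_klin])
qed

text \<open>Sends \<open>m \<otimes> z\<close> to
  \<open>m_0 \<tau>(m_1)^1 \<otimes> (\<tau>(m_1)^2 \<otimes> z)\<close>. It leads back from the
  target of \<kappa> to \<open>M \<otimes>_B M\<close>, and it contains the translation map just as
  the coproduct formula does.\<close>

definition "psi = tensor_lift QT (\<lambda>m z. psi_slice z (chi_inv_M (delta_M m)))"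

lemma psi_additive: "additive T QT psi"
  unfolding psi_def by (rule tK_lift_additive[OF M_module A.H_module Q.T_group psi_balanced])

lemma psi_ten: "m \<in> carrier M \<Longrightarrow> z \<in> carrier A \<Longrightarrow> psi (ten T m z) = psi_slice z (chi_inv_M (delta_M m))"
  unfolding psi_def by (rule tK_lift_ten[OF M_module A.H_module Q.T_group psi_balanced])

text \<open>For coinvariant \<open>c\<close>,
  \<open>\<delta>(c x) = (c \<otimes> 1) \<rho>(x)\<close> is \<open>chi\<close> of
  \<open>c \<otimes> x\<close>, so inverting \<open>chi\<close> returns
  \<open>c \<otimes> x\<close>.\<close>

lemma psi_kap_pair:
  assumes c: "c \<in> carrier C" and d: "d \<in> carrier M"
  shows "psi (kap_pair c d) = ten QT c d"
proof -
  note cM = C_closed[OF c]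
  have tq: "additive M QT (ten QT c)"
    using Q.ten_balanced cM by (simp add: balanced_def)
  show ?thesis
  proof (rule tK_eqI[OF A.H_module A.H_module additive_comp[OF klin_additive[OF kbil_right[OF kap_pair_kbil cM]] psi_additive] tq d])
    fix x y assume x: "x \<in> carrier A" and y: "y \<in> carrier A"
    have "delta_M (act_M c x) = chi M act_M (ten MA c x)"
      using c cM x by (simp add: hopf_act[OF M_hopf] chi_ten[OF M_ract] C_iff)
    then have "chi_inv_M (delta_M (act_M c x)) = ten MA c x"
      using chi_inv_chi[OF M_ract MB.ten_closed[OF cM x]] by simp
    then show "psi (kap_pair c (ten M x y)) = ten QT c (ten M x y)"
      using cM x y by (simp add: kap_pair_ten psi_ten act_M_closed psi_slice_ten)
  qed
qed

definition "iota = tensor_lift QT (ten QT)"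

lemma iota_balanced: "balanced B C act_M C act_left QT (ten QT)"
  using C_closed
  by (intro balancedI additiveI) (auto simp: C_simps Q.ten_closed Q.ten_add_left Q.ten_add_right Q.ten_move)

lemma iota_additive: "additive CC QT iota"
  unfolding iota_def by (rule CC.lift_additive[OF Q.T_group iota_balanced])

lemma iota_ten: "c \<in> carrier C \<Longrightarrow> d \<in> carrier C \<Longrightarrow> iota (ten CC c d) = ten QT c d"
  unfolding iota_def by (rule CC.lift_ten[OF Q.T_group iota_balanced])

lemma iota_psi_kap: "w \<in> carrier CC \<Longrightarrow> iota w = psi (kap w)"
  by (rule CC.additive_eqI[OF iota_additive additive_comp[OF kap_additive psi_additive]])
    (auto simp: iota_ten kap_ten psi_kap_pair C_closed)

text \<open>\<open>kap_pair\<close> is balanced on all of \<open>M\<close>, hence induces a map on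
  \<open>M \<otimes>_B M\<close> whose composite with \<open>iota\<close> is the injective
  \<open>kap\<close>.\<close>

lemma iota_inj: "inj_on iota (carrier CC)"
proof (rule inj_onI)
  have b: "balanced B M act_M M act_left T kap_pair"
    by (intro balancedI klin_additive[OF kbil_left[OF kap_pair_kbil]] klin_additive[OF kbil_right[OF kap_pair_kbil]]) (auto simp: kap_pair_move)
  have l: "additive QT T (tensor_lift T kap_pair)" by (rule Q.lift_additive[OF module_group[OF T_module] b])
  have e: "tensor_lift T kap_pair (iota w) = kap w" if "w \<in> carrier CC" for w
    by (rule CC.additive_eqI[OF additive_comp[OF iota_additive l] kap_additive that])
      (simp add: iota_ten kap_ten C_closed Q.lift_ten[OF module_group[OF T_module] b])
  fix v w assume v: "v \<in> carrier CC" and w: "w \<in> carrier CC" and "iota v = iota w"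
  then have "kap v = kap w" using e[OF v] e[OF w] by simp
  then show "v = w" by (rule inj_onD[OF kap_inj _ v w])
qed

definition "insert_one = hmap K A M (\<lambda>a. ten M a \<one>\<^bsub>A\<^esub>)"

lemma insert_one_klin: "klin K M T insert_one"
  unfolding insert_one_def by (rule A.hmap_klin(1)[OF A.H_module M_module tenM1])

lemma insert_one_ten: "a \<in> carrier A \<Longrightarrow> a' \<in> carrier A \<Longrightarrow> insert_one (ten M a a') = ten T (ten M a \<one>\<^bsub>A\<^esub>) a'"
  unfolding insert_one_def by (rule A.hmap_klin(2)[OF A.H_module M_module tenM1])

text \<open>As \<open>\<rho>(1) = 1 \<otimes> 1\<close>, a new factor \<open>1\<close> contributes
  nothing to the leg in \<open>H\<close>; so \<open>insert_one\<close> commutes with the diagonal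
  coactions.\<close>

lemma insert_one_coinv:
  assumes c: "c \<in> carrier C"
  shows "insert_one c \<in> carrier (coinv T delta_T)"
proof -
  let ?f = "\<lambda>a. ten M a \<one>\<^bsub>A\<^esub>"
  note hf = hmap_klin[OF A.H_module M_module tenM1] and hj = hmap_klin[OF M_module T_module insert_one_klin]
  note b = B2[OF A.H_module rho] and bT = B2[OF M_module delta_M_klin]
  note e = tK_eqI[OF A.H_module H_module]
  have key: "hbil K H T (ten T) (hmap K H M ?f Z) Z' = hmap K H T insert_one (hbil K H M (ten M) Z Z')"
    if Z: "Z \<in> carrier (VH A)" and Z': "Z' \<in> carrier (VH A)" for Z Z'
  proof (rule e[OF klin_additive[OF klin_comp[OF hf(1) kbil_left[OF bT(1) Z']]]
        klin_additive[OF klin_comp[OF kbil_left[OF b(1) Z'] hj(1)]] Z])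
    fix a h assume ah: "a \<in> carrier A" "h \<in> carrier H"
    note t = tK_closed[OF A.H_module H_module ah]
    show "hbil K H T (ten T) (hmap K H M ?f (ten (VH A) a h)) Z' = hmap K H T insert_one (hbil K H M (ten M) (ten (VH A) a h) Z')"
      by (rule e[OF klin_additive[OF kbil_right[OF bT(1) klin_closed[OF hf(1) t]]]
            klin_additive[OF klin_comp[OF kbil_right[OF b(1) t] hj(1)]] Z'])
        (use ah in \<open>simp add: hf(2) bT(2) b(2) hj(2) tenM_closed insert_one_ten\<close>)
  qed
  have "delta_T (insert_one X) = hmap K H T insert_one (delta_M X)" if "X \<in> carrier M" for X
  proof (rule tK_eqI[OF A.H_module A.H_module klin_additive[OF klin_comp[OF insert_one_klin hopf_klin[OF T_hopf]]]
        klin_additive[OF klin_comp[OF delta_M_klin hj(1)]] that])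
    fix v w assume vw: "v \<in> carrier A" "w \<in> carrier A"
    then have "delta_T (insert_one (ten M v w)) = hbil K H T (ten T) (hmap K H M ?f (\<rho> v)) (\<rho> w)"
      by (simp add: insert_one_ten delta_T_ten tenM_closed delta_M_left)
    then show "delta_T (insert_one (ten M v w)) = hmap K H T insert_one (delta_M (ten M v w))"
      using vw by (simp add: key rho_closed delta_M_ten)
  qed
  from this[OF C_closed[OF c]] have "delta_T (insert_one c) = ten (VH T) (insert_one c) \<one>\<^bsub>H\<^esub>"
    using c hj(2)[of c "\<one>\<^bsub>H\<^esub>"] by (simp add: C_iff one_H)
  then show ?thesis using klin_closed[OF insert_one_klin C_closed[OF c]] by (simp add: coinv_iff[OF T_hopf])
qed

definition "coprod_formula X = tensor_lift QT (\<lambda>a a'. tensor_lift QT (\<lambda>a0 a1. tensor_lift QT (\<lambda>u v.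
   ten QT (ten M a0 u) (ten M v a')) (\<tau> a1)) (\<rho> a)) X"

text \<open>The coaction of \<open>a \<otimes> 1\<close> is
  \<open>(a_0 \<otimes> 1) \<otimes> a_1\<close>; applying \<open>chi_inv\<close> to it inserts
  exactly the translation map of the coproduct formula.\<close>

lemma coprod_formula_psi:
  assumes X: "X \<in> carrier M"
  shows "coprod_formula X = psi (insert_one X)"
proof -
  let ?f = "\<lambda>a. ten M a \<one>\<^bsub>A\<^esub>"
  have fc: "?f a \<in> carrier M" if "a \<in> carrier A" for a by (rule klin_closed[OF tenM1 that])
  have 1: "tensor_lift QT (\<lambda>u v. ten QT (ten M a0 u) (ten M v a')) d = psi_slice a' (eta M act_M (?f a0) d)"
    if a: "a0 \<in> carrier A" "a' \<in> carrier A" and d: "d \<in> carrier D" for a0 a' d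
  proof -
    have b: "balanced B A (monoid.mult A) A (monoid.mult A) QT (\<lambda>u v. ten QT (ten M a0 u) (ten M v a'))"
      using a
      by (intro balancedI additiveI)
        (auto simp: Q.ten_closed tenM_closed Q.ten_add_left Q.ten_add_right kbil_add_left[OF tenM_kbil]
          kbil_add_right[OF tenM_kbil] Q.ten_move act_left_ten simp flip: act_M_ten)
    show ?thesis
      by (rule D.additive_eqI[OF D.lift_additive[OF Q.T_group b] additive_comp[OF eta_additive[OF M_ract fc[OF a(1)]] psi_slice_additive[OF a(2)]] d])
        (use a in \<open>simp add: D.lift_ten[OF Q.T_group b] eta_ten[OF M_ract] fc act_M_ten psi_slice_ten tenM_closed\<close>)
  qed
  note hf = hmap_klin[OF A.H_module M_module tenM1]
  have kb: "kbalanced K A H QT (\<lambda>a0 a1. psi_slice a' (eta M act_M (?f a0) (\<tau> a1)))" if a': "a' \<in> carrier A" for a'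
  proof (rule balancedI)
    note cb = balanced_comp[OF chi_inv_kbalanced[OF M_ract] psi_slice_additive[OF a']]
    show "additive A QT (\<lambda>a0. psi_slice a' (eta M act_M (?f a0) (\<tau> a1)))" if "a1 \<in> carrier H" for a1
      using cb that by (intro additive_comp[OF klin_additive[OF tenM1], of _ "\<lambda>m. psi_slice a' (eta M act_M m (\<tau> a1))"]) (simp add: balanced_def)
    show "additive H QT (\<lambda>a1. psi_slice a' (eta M act_M (?f a0) (\<tau> a1)))" if "a0 \<in> carrier A" for a0
      using cb fc[OF that] by (simp add: balanced_def)
    show "psi_slice a' (eta M act_M (?f (k \<odot>\<^bsub>A\<^esub> a0)) (\<tau> a1)) = psi_slice a' (eta M act_M (?f a0) (\<tau> (k \<odot>\<^bsub>H\<^esub> a1)))"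
      if "a0 \<in> carrier A" "k \<in> carrier K" "a1 \<in> carrier H" for k a0 a1
      using cb fc[OF that(1)] that by (simp add: balanced_def klin_smult[OF tenM1])
  qed
  have 2: "tensor_lift QT (\<lambda>a0 a1. tensor_lift QT (\<lambda>u v. ten QT (ten M a0 u) (ten M v a')) (\<tau> a1)) (\<rho> a)
      = psi_slice a' (chi_inv_M (delta_M (?f a)))" if a: "a \<in> carrier A" "a' \<in> carrier A" for a a'
  proof -
    have "tensor_lift QT (\<lambda>a0 a1. tensor_lift QT (\<lambda>u v. ten QT (ten M a0 u) (ten M v a')) (\<tau> a1)) (\<rho> a)
      = tensor_lift QT (\<lambda>a0 a1. psi_slice a' (eta M act_M (?f a0) (\<tau> a1))) (\<rho> a)"
    proof (rule tK_lift_cong[OF A.H_module H_module rho_closed[OF a(1)] Q.T_group])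
      fix m n assume "m \<in> carrier A" "n \<in> carrier H"
      then show "psi_slice a' (eta M act_M (?f m) (\<tau> n)) \<in> carrier QT"
        using kb[OF a(2)] by (simp add: balanced_def additive_def)
    qed (simp add: 1 a tau_closed)
    also have "\<dots> = psi_slice a' (chi_inv_M (hmap K H M ?f (\<rho> a)))"
      by (rule tK_eqI[OF A.H_module H_module tK_lift_additive[OF A.H_module H_module Q.T_group kb[OF a(2)]]
            additive_comp[OF klin_additive[OF hf(1)] additive_comp[OF chi_inv_additive[OF M_ract] psi_slice_additive[OF a(2)]]] rho_closed[OF a(1)]])
        (simp add: tK_lift_ten[OF A.H_module H_module Q.T_group kb[OF a(2)]] hf(2) chi_inv_ten[OF M_ract] fc)
    finally show ?thesis by (simp add: delta_M_left[OF a(1)])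
  qed
  have kp: "kbalanced K A A QT (\<lambda>a a'. psi_slice a' (chi_inv_M (delta_M (?f a))))"
  proof (rule balancedI)
    show "additive A QT (\<lambda>a. psi_slice a' (chi_inv_M (delta_M (?f a))))" if "a' \<in> carrier A" for a'
      by (rule additive_comp[OF klin_additive[OF tenM1] additive_comp[OF klin_additive[OF delta_M_klin]
            additive_comp[OF chi_inv_additive[OF M_ract] psi_slice_additive[OF that]]]])
    show "additive A QT (\<lambda>a'. psi_slice a' (chi_inv_M (delta_M (?f a))))" if "a \<in> carrier A" for a
      by (rule psi_slice_additive_left[OF chi_inv_M_closed[OF klin_closed[OF delta_M_klin fc[OF that]]]])
    show "psi_slice a' (chi_inv_M (delta_M (?f (k \<odot>\<^bsub>A\<^esub> a)))) = psi_slice (k \<odot>\<^bsub>A\<^esub> a') (chi_inv_M (delta_M (?f a)))"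
      if "a \<in> carrier A" "k \<in> carrier K" "a' \<in> carrier A" for a k a'
      using that fc[OF that(1)] by (simp add: klin_smult[OF tenM1] klin_smult[OF delta_M_klin] psi_slice_chi_inv_M_smult klin_closed[OF delta_M_klin])
  qed
  have "coprod_formula X = tensor_lift QT (\<lambda>a a'. psi_slice a' (chi_inv_M (delta_M (?f a)))) X"
    unfolding coprod_formula_def
  proof (rule tK_lift_cong[OF A.H_module A.H_module X Q.T_group])
    fix m n assume "m \<in> carrier A" "n \<in> carrier A"
    then show "psi_slice n (chi_inv_M (delta_M (?f m))) \<in> carrier QT"
      using kp by (simp add: balanced_def additive_def)
  qed (simp add: 2)
  also have "\<dots> = psi (insert_one X)"
    by (rule tK_eqI[OF A.H_module A.H_module tK_lift_additive[OF A.H_module A.H_module Q.T_group kp]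
          additive_comp[OF klin_additive[OF insert_one_klin] psi_additive] X])
      (simp add: tK_lift_ten[OF A.H_module A.H_module Q.T_group kp] insert_one_ten psi_ten fc)
  finally show ?thesis .
qed

definition "coprod_C X = the_inv_into (carrier CC) iota (coprod_formula X)"

text \<open>\<open>insert_one c\<close> is coinvariant, hence equal to \<open>kap w\<close> for some
  \<open>w\<close>. Then \<open>iota w = psi (kap w)\<close> is the coproduct formula, so the
  inverse in \<open>coprod_C\<close> is taken at a point that is really attained.\<close>

lemma coprod_C:
  assumes c: "c \<in> carrier C"
  shows coprod_C_closed: "coprod_C c \<in> carrier CC" and kap_coprod_C: "kap (coprod_C c) = insert_one c"
proof -
  obtain w where w: "w \<in> carrier CC" "kap w = insert_one c"
    using kap_image[OF insert_one_coinv[OF c]] by auto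
  have "coprod_formula c = iota w" using coprod_formula_psi[OF C_closed[OF c]] iota_psi_kap[OF w(1)] w(2) by simp
  then have "coprod_C c = w" unfolding coprod_C_def using the_inv_into_f_f[OF iota_inj w(1)] by simp
  then show "coprod_C c \<in> carrier CC" "kap (coprod_C c) = insert_one c" using w by simp_all
qed

section \<open>The flip and the antipode identities\<close>

definition "flip_M = tensor_lift M (\<lambda>a a'. ten M a' a)"

lemma flip_M_klin: "klin K M M flip_M"
  unfolding flip_M_def by (rule tK_lift_klin[OF A.H_module A.H_module M_module kbil_swap[OF tenM_kbil]])

lemma flip_M_ten: "a \<in> carrier A \<Longrightarrow> a' \<in> carrier A \<Longrightarrow> flip_M (ten M a a') = ten M a' a"
  unfolding flip_M_def by (rule tK_lift_ten[OF A.H_module A.H_module module_group[OF M_module] kbil_balanced[OF kbil_swap[OF tenM_kbil]]])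

lemma flip_M_flip_M: "x \<in> carrier M \<Longrightarrow> flip_M (flip_M x) = x"
  by (rule tK_eqI[OF A.H_module A.H_module klin_additive[OF klin_comp[OF flip_M_klin flip_M_klin]] klin_additive[OF klin_id]])
    (auto simp: flip_M_ten)

lemma flip_M_mult:
  assumes x: "x \<in> carrier M" and y: "y \<in> carrier M"
  shows "flip_M (mulM x y) = mulM (flip_M y) (flip_M x)"
proof (rule tK_eqI[OF A.H_module A.H_module klin_additive[OF klin_comp[OF kbil_left[OF mulM_kbil y] flip_M_klin]]
      klin_additive[OF klin_comp[OF flip_M_klin kbil_right[OF mulM_kbil klin_closed[OF flip_M_klin y]]]] x])
  fix a a' assume a: "a \<in> carrier A" "a' \<in> carrier A"
  note t = tenM_closed[OF a]
  show "flip_M (mulM (ten M a a') y) = mulM (flip_M y) (flip_M (ten M a a'))"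
    by (rule tK_eqI[OF A.H_module A.H_module klin_additive[OF klin_comp[OF kbil_right[OF mulM_kbil t] flip_M_klin]]
          klin_additive[OF klin_comp[OF flip_M_klin kbil_left[OF mulM_kbil klin_closed[OF flip_M_klin t]]]] y])
      (use a in \<open>simp add: flip_M_ten mulM_ten\<close>)
qed

text \<open>Commutativity of \<open>H\<close> is what makes the diagonal coaction invariant under the flip.\<close>

lemma flip_M_C:
  assumes c: "c \<in> carrier C"
  shows "flip_M c \<in> carrier C"
proof -
  note hf = hmap_klin[OF M_module M_module flip_M_klin]
  note b = B2[OF A.H_module rho]
  note e = tK_eqI[OF A.H_module H_module]
  have key: "hbil K H M (ten M) Z' Z = hmap K H M flip_M (hbil K H M (ten M) Z Z')"
    if Z: "Z \<in> carrier (VH A)" and Z': "Z' \<in> carrier (VH A)" for Z Z'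
  proof (rule e[OF klin_additive[OF kbil_right[OF b(1) Z']] klin_additive[OF klin_comp[OF kbil_left[OF b(1) Z'] hf(1)]] Z])
    fix a h assume ah: "a \<in> carrier A" "h \<in> carrier H"
    note t = tK_closed[OF A.H_module H_module ah]
    show "hbil K H M (ten M) Z' (ten (VH A) a h) = hmap K H M flip_M (hbil K H M (ten M) (ten (VH A) a h) Z')"
      by (rule e[OF klin_additive[OF kbil_left[OF b(1) t]] klin_additive[OF klin_comp[OF kbil_right[OF b(1) t] hf(1)]] Z'])
        (use ah H_comm in \<open>simp add: b(2) hf(2) tenM_closed flip_M_ten\<close>)
  qed
  have "delta_M (flip_M X) = hmap K H M flip_M (delta_M X)" if "X \<in> carrier M" for X
    by (rule tK_eqI[OF A.H_module A.H_module klin_additive[OF klin_comp[OF flip_M_klin delta_M_klin]]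
          klin_additive[OF klin_comp[OF delta_M_klin hf(1)]] that])
      (simp add: flip_M_ten delta_M_ten key[OF rho_closed rho_closed, symmetric])
  from this[OF C_closed[OF c]] show ?thesis
    using c hf(2)[of c "\<one>\<^bsub>H\<^esub>"] klin_closed[OF flip_M_klin C_closed[OF c]] by (simp add: C_iff one_H)
qed

lemma flip_M_bij: "bij_betw flip_M (carrier C) (carrier C)"
  by (rule bij_betwI[where g = flip_M]) (auto simp: flip_M_C flip_M_flip_M C_closed)

lemma flip_M_inv: "c \<in> carrier C \<Longrightarrow> the_inv_into (carrier C) flip_M c = flip_M c"
  using the_inv_into_f_f[OF bij_betw_imp_inj_on[OF flip_M_bij] flip_M_C, of c] by (simp add: flip_M_flip_M C_closed)

text \<open>The two antipode identities become identities between permutations of tensor factors once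
  they are transported along the injective map \<open>kap\<close>.\<close>

lemma lift_via_kap:
  assumes F: "\<And>c d. c \<in> carrier C \<Longrightarrow> d \<in> carrier C \<Longrightarrow> F c d \<in> carrier CC"
    and s: "additive T T s"
    and eq: "\<And>c d. c \<in> carrier C \<Longrightarrow> d \<in> carrier C \<Longrightarrow> kap (F c d) = s (kap (ten CC c d))"
    and w: "w \<in> carrier CC"
  shows "tensor_lift CC F w \<in> carrier CC" "kap (tensor_lift CC F w) = s (kap w)"
proof -
  interpret CCg: abelian_group CC by (rule CC.T_group)
  interpret Cg: abelian_group C by (rule C_group)
  note kd = inj_onD[OF kap_inj]
  have kl: "additive C T (\<lambda>c. s (kap (ten CC c d)))" if "d \<in> carrier C" for d
    by (rule additive_comp[OF additive_comp[of C CC "\<lambda>c. ten CC c d"] s, OF _ kap_additive])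
      (use CC.ten_balanced that in \<open>simp add: balanced_def\<close>)
  have kr: "additive C T (\<lambda>d. s (kap (ten CC c d)))" if "c \<in> carrier C" for c
    by (rule additive_comp[OF additive_comp[of C CC "ten CC c"] s, OF _ kap_additive])
      (use CC.ten_balanced that in \<open>simp add: balanced_def\<close>)
  \<comment> \<open>Biadditivity and balancing of \<open>F\<close> hold after \<open>kap\<close>,
    where \<open>F\<close> becomes \<open>s\<close> applied to a tensor, and injectivity of
    \<open>kap\<close> brings them back.\<close>
  have b: "balanced B C act_M C act_left CC F"
  proof (intro balancedI additiveI)
    fix c c' d assume c: "c \<in> carrier C" "c' \<in> carrier C" and d: "d \<in> carrier C"
    show "F (c \<oplus>\<^bsub>C\<^esub> c') d = F c d \<oplus>\<^bsub>CC\<^esub> F c' d"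
      by (rule kd) (use c d F Cg.a_closed additive_add[OF kl[OF d]] in \<open>simp_all add: eq additive_add[OF kap_additive]\<close>)
    show "F d (c \<oplus>\<^bsub>C\<^esub> c') = F d c \<oplus>\<^bsub>CC\<^esub> F d c'"
      by (rule kd) (use c d F Cg.a_closed additive_add[OF kr[OF d]] in \<open>simp_all add: eq additive_add[OF kap_additive]\<close>)
  next
    fix c b d assume c: "c \<in> carrier C" and b: "b \<in> B" and d: "d \<in> carrier C"
    show "F (act_M c b) d = F c (act_left b d)"
      by (rule kd) (use c d b F C_act[OF c b] act_left_C[OF b d] CC.ten_move[OF c b d] in \<open>simp_all add: eq\<close>)
  qed (simp_all add: F)
  show "tensor_lift CC F w \<in> carrier CC" by (rule additive_closed[OF CC.lift_additive[OF CC.T_group b] w])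
  show "kap (tensor_lift CC F w) = s (kap w)"
    by (rule CC.additive_eqI[OF additive_comp[OF CC.lift_additive[OF CC.T_group b] kap_additive] additive_comp[OF kap_additive s] w])
      (simp add: CC.lift_ten[OF CC.T_group b] eq)
qed

text \<open>Linear maps out of \<open>(A \<otimes> A) \<otimes> A\<close> from trilinear formulas;
  it supplies the two cyclic shifts of tensor factors.\<close>

lemma perm_klin:
  assumes f: "\<And>z. z \<in> carrier A \<Longrightarrow> kbil K A A T (\<lambda>x y. f x y z)"
    and lin: "\<And>x y. x \<in> carrier A \<Longrightarrow> y \<in> carrier A \<Longrightarrow> klin K A T (f x y)"
  obtains s where "klin K T T s"
    "\<And>x y z. x \<in> carrier A \<Longrightarrow> y \<in> carrier A \<Longrightarrow> z \<in> carrier A \<Longrightarrow> s (ten T (ten M x y) z) = f x y z"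
proof -
  have k: "kbil K A M T (\<lambda>z. tensor_lift T (\<lambda>x y. f x y z))"
    by (rule tK_lift_param[OF A.H_module A.H_module T_module A.H_module f lin])
  note k' = kbil_swap[OF k]
  show ?thesis
  proof (rule that)
    show "klin K T T (tensor_lift T (\<lambda>m z. tensor_lift T (\<lambda>x y. f x y z) m))"
      by (rule tK_lift_klin[OF M_module A.H_module T_module k'])
    show "tensor_lift T (\<lambda>m z. tensor_lift T (\<lambda>x y. f x y z) m) (ten T (ten M x y) z) = f x y z"
      if "x \<in> carrier A" "y \<in> carrier A" "z \<in> carrier A" for x y z
      using that by (simp add: tK_lift_ten[OF M_module A.H_module module_group[OF T_module] kbil_balanced[OF k']] tenM_closed
        tK_lift_ten[OF A.H_module A.H_module module_group[OF T_module] kbil_balanced[OF f]])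
  qed
qed

text \<open>For \<open>c = a \<otimes> a'\<close> and \<open>d = x \<otimes> y\<close>, \<kappa>
  takes \<open>c \<otimes> d\<close> to \<open>(a \<otimes> a' x) \<otimes> y\<close>, while the
  summand built from the flip of \<open>c\<close> and from \<open>d\<close> becomes
  \<open>(a' x \<otimes> y) \<otimes> a\<close>. The two differ by the cyclic shift
  \<open>s\<close>.\<close>

lemma antipode1:
  assumes h: "h \<in> carrier C"
  shows "tensor_lift CC (\<lambda>h1 h2. tensor_lift CC (\<lambda>x y. ten CC (mulM x h2) y) (coprod_C (flip_M h1))) (coprod_C h) = ten CC oneM (flip_M h)"
proof -
  obtain s where s: "klin K T T s"
    and s_ten: "\<And>x y z. x \<in> carrier A \<Longrightarrow> y \<in> carrier A \<Longrightarrow> z \<in> carrier A \<Longrightarrow> s (ten T (ten M x y) z) = ten T (ten M y z) x"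
  proof (rule perm_klin[of "\<lambda>x y z. ten T (ten M y z) x"])
    show "kbil K A A T (\<lambda>x y. ten T (ten M y z) x)" if "z \<in> carrier A" for z
      by (rule kbil_swap, rule kbil_comp_args[OF tenT_kbil kbil_left[OF tenM_kbil that] klin_id])
    show "klin K A T (\<lambda>z. ten T (ten M y z) x)" if "x \<in> carrier A" "y \<in> carrier A" for x y
      by (rule klin_comp[OF kbil_right[OF tenM_kbil that(2)] kbil_left[OF tenT_kbil that(1)]])
  qed auto
  let ?F = "\<lambda>c d. tensor_lift CC (\<lambda>x y. ten CC (mulM x d) y) (coprod_C (flip_M c))"
  have F: "?F c d \<in> carrier CC \<and> kap (?F c d) = s (kap (ten CC c d))" if c: "c \<in> carrier C" and d: "d \<in> carrier C" for c d
  proof -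
    note dM' = C_closed[OF d] and cM = C_closed[OF c]
    note md = kbil_left[OF mulM_kbil dM']
    \<comment> \<open>Right multiplication by \<open>d\<close> commutes with \<open>act_M\<close>,
      which is a left multiplication, so it passes through \<open>kap\<close> as an operation on the
      factor \<open>M\<close>.\<close>
    define R where "R = hmap K A M (\<lambda>m. mulM m d)"
    note R = A.hmap_klin[OF M_module M_module md, folded R_def]
    have R_kap_pair: "kap_pair (mulM x d) y = R (kap_pair x y)" if x: "x \<in> carrier M" and y: "y \<in> carrier M" for x y
      by (rule tK_eqI[OF A.H_module A.H_module klin_additive[OF kbil_right[OF kap_pair_kbil mulM_closed[OF x dM']]]
            klin_additive[OF klin_comp[OF kbil_right[OF kap_pair_kbil x] R(1)]] y])
        (use x dM' in \<open>simp add: kap_pair_ten mulM_closed R(2) act_M_closed act_M_mulM tenM_closed mulM_assoc\<close>)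
    have "tensor_lift CC (\<lambda>x y. ten CC (mulM x d) y) (coprod_C (flip_M c)) \<in> carrier CC"
      "kap (tensor_lift CC (\<lambda>x y. ten CC (mulM x d) y) (coprod_C (flip_M c))) = R (kap (coprod_C (flip_M c)))"
      by (rule lift_via_kap[where F = "\<lambda>x y. ten CC (mulM x d) y" and s = R and w = "coprod_C (flip_M c)"];
          use d flip_M_C[OF c] klin_additive[OF R(1)] in \<open>simp add: CC.ten_closed C_mult kap_ten R_kap_pair C_closed coprod_C_closed\<close>)+
    moreover have "R (insert_one (flip_M m)) = s (kap_pair m d)" if "m \<in> carrier M" for m
      using that
    proof (rule tK_eqI[OF A.H_module A.H_module, rotated 2])
      show "additive M T (\<lambda>m. R (insert_one (flip_M m)))"
        by (rule klin_additive[OF klin_comp[OF klin_comp[OF flip_M_klin insert_one_klin] R(1)]])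
      show "additive M T (\<lambda>m. s (kap_pair m d))"
        by (rule klin_additive[OF klin_comp[OF kbil_left[OF kap_pair_kbil dM'] s]])
      fix a a' assume a: "a \<in> carrier A" "a' \<in> carrier A"
      note a1 = tenM_closed[OF a(2) AR.one_closed]
      have "ten T (mulM (ten M a' \<one>\<^bsub>A\<^esub>) d) a = s (kap_pair (ten M a a') d)"
        by (rule tK_eqI[OF A.H_module A.H_module klin_additive[OF klin_comp[OF kbil_right[OF mulM_kbil a1] kbil_left[OF tenT_kbil a(1)]]]
              klin_additive[OF klin_comp[OF kbil_right[OF kap_pair_kbil tenM_closed[OF a]] s]] dM'])
          (use a in \<open>simp add: mulM_ten kap_pair_ten tenM_closed act_M_ten s_ten\<close>)
      then show "R (insert_one (flip_M (ten M a a'))) = s (kap_pair (ten M a a') d)"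
        using a a1 by (simp add: flip_M_ten insert_one_ten R(2))
    qed
    ultimately show ?thesis using kap_coprod_C[OF flip_M_C[OF c]] kap_ten[OF c d] cM by simp
  qed
  note lv = lift_via_kap[of ?F s, OF conjunct1[OF F] klin_additive[OF s] conjunct2[OF F] coprod_C_closed[OF h]]
  \<comment> \<open>The shift takes \<open>(a \<otimes> 1) \<otimes> a'\<close> to
    \<open>(1 \<otimes> a') \<otimes> a\<close>, which is \<kappa> of the unit tensored with the
    flipped element.\<close>
  have e: "s (insert_one X) = kap_pair oneM (flip_M X)" if "X \<in> carrier M" for X
    by (rule tK_eqI[OF A.H_module A.H_module klin_additive[OF klin_comp[OF insert_one_klin s]]
          klin_additive[OF klin_comp[OF flip_M_klin kbil_right[OF kap_pair_kbil C_closed[OF C_one]]]] that])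
      (simp add: insert_one_ten s_ten flip_M_ten kap_pair_ten tenM_closed act_M_ten)
  show ?thesis
    by (rule inj_onD[OF kap_inj _ lv(1) CC.ten_closed[OF C_one flip_M_C[OF h]]])
      (use lv(2) h in \<open>simp add: kap_coprod_C e C_closed kap_ten C_one flip_M_C\<close>)
qed

text \<open>Supplies the membership condition of \<open>lift_cong\<close> when the inverse of the
  flip is replaced by the flip inside a lift.\<close>

lemma antipode2_closed:
  assumes c: "c \<in> carrier C" and w: "w \<in> carrier CC"
  shows "tensor_lift CC (\<lambda>x y. ten CC x (mulM y c)) w \<in> carrier CC"
proof -
  have "balanced B C act_M C act_left CC (\<lambda>x y. ten CC x (mulM y c))"
    using c by (intro balancedI additiveI)
      (auto simp: CC.ten_closed C_mult CC.ten_add_left[unfolded C_simps] CC.ten_add_right[unfolded C_simps] C_simps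
        kbil_add_left[OF mulM_kbil] C_closed CC.ten_move act_left_def mulM_assoc tenM_closed)
  from additive_closed[OF CC.lift_additive[OF CC.T_group this] w] show ?thesis .
qed

text \<open>Now the shift runs the other way: with \<open>c = x \<otimes> y\<close> and
  \<open>d = a \<otimes> a'\<close>, \<open>(x \<otimes> y a) \<otimes> a'\<close> is compared with
  \<open>(a' \<otimes> x) \<otimes> y a\<close>.\<close>

lemma antipode2:
  assumes h: "h \<in> carrier C"
  shows "tensor_lift CC (\<lambda>h1 h2. tensor_lift CC (\<lambda>x y. ten CC x (mulM y h1)) (coprod_C (flip_M h2))) (coprod_C h) = ten CC (flip_M h) oneM"
proof -
  obtain s where s: "klin K T T s"
    and s_ten: "\<And>x y z. x \<in> carrier A \<Longrightarrow> y \<in> carrier A \<Longrightarrow> z \<in> carrier A \<Longrightarrow> s (ten T (ten M x y) z) = ten T (ten M z x) y"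
  proof (rule perm_klin[of "\<lambda>x y z. ten T (ten M z x) y"])
    show "kbil K A A T (\<lambda>x y. ten T (ten M z x) y)" if "z \<in> carrier A" for z
      by (rule kbil_comp_args[OF tenT_kbil kbil_right[OF tenM_kbil that] klin_id])
    show "klin K A T (\<lambda>z. ten T (ten M z x) y)" if "x \<in> carrier A" "y \<in> carrier A" for x y
      by (rule klin_comp[OF kbil_left[OF tenM_kbil that(1)] kbil_left[OF tenT_kbil that(2)]])
  qed auto
  let ?F = "\<lambda>c d. tensor_lift CC (\<lambda>x y. ten CC x (mulM y c)) (coprod_C (flip_M d))"
  have F: "?F c d \<in> carrier CC \<and> kap (?F c d) = s (kap (ten CC c d))" if c: "c \<in> carrier C" and d: "d \<in> carrier C" for c d
  proof -
    note dM' = C_closed[OF d] and cM = C_closed[OF c]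
    have zk: "klin K A M (\<lambda>z. mulM (ten M \<one>\<^bsub>A\<^esub> z) c)"
      by (rule klin_comp[OF kbil_right[OF tenM_kbil A.one_H] kbil_left[OF mulM_kbil cM]])
    note tk = kbil_comp_args[OF kap_pair_kbil klin_id zk]
    \<comment> \<open>Right multiplication by \<open>c\<close> on the second tensor factor,
      expressed in the target of \<kappa>: in
      \<open>p \<otimes> q = (p \<otimes> 1)(1 \<otimes> q)\<close> the part \<open>p\<close> has
      already moved across by \<open>kap_pair_move\<close>, and the rest is multiplied by
      \<open>c\<close>.\<close>
    define R where "R = tensor_lift T (\<lambda>m z. kap_pair m (mulM (ten M \<one>\<^bsub>A\<^esub> z) c))"
    have R: "klin K T T R" unfolding R_def by (rule tK_lift_klin[OF M_module A.H_module T_module tk])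
    have R_ten: "R (ten T m z) = kap_pair m (mulM (ten M \<one>\<^bsub>A\<^esub> z) c)" if "m \<in> carrier M" "z \<in> carrier A" for m z
      unfolding R_def by (rule tK_lift_ten[OF M_module A.H_module module_group[OF T_module] kbil_balanced[OF tk] that])
    have R_kap_pair: "kap_pair x (mulM y c) = R (kap_pair x y)" if x: "x \<in> carrier M" and y: "y \<in> carrier M" for x y
    proof (rule tK_eqI[OF A.H_module A.H_module klin_additive[OF klin_comp[OF kbil_left[OF mulM_kbil cM] kbil_right[OF kap_pair_kbil x]]]
          klin_additive[OF klin_comp[OF kbil_right[OF kap_pair_kbil x] R]] y])
      fix p q assume p: "p \<in> carrier A" and q: "q \<in> carrier A"
      have "mulM (ten M p q) c = act_left p (mulM (ten M \<one>\<^bsub>A\<^esub> q) c)"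
        using p q cM by (simp add: act_left_def mulM_assoc[symmetric] tenM_closed mulM_ten)
      then show "kap_pair x (mulM (ten M p q) c) = R (kap_pair x (ten M p q))"
        using x p q cM by (simp add: kap_pair_ten R_ten act_M_closed kap_pair_move mulM_closed tenM_closed)
    qed
    have "tensor_lift CC (\<lambda>x y. ten CC x (mulM y c)) (coprod_C (flip_M d)) \<in> carrier CC"
      "kap (tensor_lift CC (\<lambda>x y. ten CC x (mulM y c)) (coprod_C (flip_M d))) = R (kap (coprod_C (flip_M d)))"
      by (rule lift_via_kap[where F = "\<lambda>x y. ten CC x (mulM y c)" and s = R and w = "coprod_C (flip_M d)"];
          use c flip_M_C[OF d] klin_additive[OF R] in \<open>simp add: CC.ten_closed C_mult kap_ten R_kap_pair C_closed coprod_C_closed\<close>)+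
    moreover have "R (insert_one (flip_M m)) = s (kap_pair c m)" if "m \<in> carrier M" for m
      using that
    proof (rule tK_eqI[OF A.H_module A.H_module, rotated 2])
      show "additive M T (\<lambda>m. R (insert_one (flip_M m)))"
        by (rule klin_additive[OF klin_comp[OF klin_comp[OF flip_M_klin insert_one_klin] R]])
      show "additive M T (\<lambda>m. s (kap_pair c m))"
        by (rule klin_additive[OF klin_comp[OF kbil_right[OF kap_pair_kbil cM] s]])
      fix a a' assume a: "a \<in> carrier A" "a' \<in> carrier A"
      note a1 = tenM_closed[OF a(2) AR.one_closed] and a2 = tenM_closed[OF AR.one_closed a(1)]
      have "kap_pair (ten M a' \<one>\<^bsub>A\<^esub>) (mulM (ten M \<one>\<^bsub>A\<^esub> a) c) = s (kap_pair c (ten M a a'))"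
        by (rule tK_eqI[OF A.H_module A.H_module klin_additive[OF klin_comp[OF kbil_right[OF mulM_kbil a2] kbil_right[OF kap_pair_kbil a1]]]
              klin_additive[OF klin_comp[OF kbil_left[OF kap_pair_kbil tenM_closed[OF a]] s]] cM])
          (use a a1 in \<open>simp add: mulM_ten kap_pair_ten tenM_closed act_M_ten s_ten\<close>)
      then show "R (insert_one (flip_M (ten M a a'))) = s (kap_pair c (ten M a a'))"
        using a a1 by (simp add: flip_M_ten insert_one_ten R_ten)
    qed
    ultimately show ?thesis using kap_coprod_C[OF flip_M_C[OF d]] kap_ten[OF c d] dM' by simp
  qed
  note lv = lift_via_kap[of ?F s, OF conjunct1[OF F] klin_additive[OF s] conjunct2[OF F] coprod_C_closed[OF h]]
  have e: "s (insert_one X) = kap_pair (flip_M X) oneM" if "X \<in> carrier M" for X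
    by (rule tK_eqI[OF A.H_module A.H_module klin_additive[OF klin_comp[OF insert_one_klin s]]
          klin_additive[OF klin_comp[OF flip_M_klin kbil_left[OF kap_pair_kbil C_closed[OF C_one]]]] that])
      (simp add: insert_one_ten s_ten flip_M_ten kap_pair_ten tenM_closed act_M_ten)
  show ?thesis
    by (rule inj_onD[OF kap_inj _ lv(1) CC.ten_closed[OF flip_M_C[OF h] C_one]])
      (use lv(2) h in \<open>simp add: kap_coprod_C e C_closed kap_ten C_one flip_M_C\<close>)
qed

end

section \<open>Identification with the Ehresmann-Schauenburg bialgebroid\<close>

locale ES = principal K H A \<rho> can DK \<tau> \<Delta> \<epsilon>
  for K :: "'k ring" and H :: "('k, 'h) module"
    and A :: "('k, 'a) module" and \<rho> :: "'a \<Rightarrow> ('a, 'h) tensor" and can DK \<tau> \<Delta> \<epsilon> +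
  assumes DK_eq: "DK = tensor_B K H A \<rho>" and tau_eq: "\<tau> = translation_map K H A \<rho>"
begin

lemma ES_carrier_eq: "ES_carrier K H A \<rho> = carrier C"
  using ES_condition C_closed
  unfolding ES_carrier_def Let_def DK_eq[symmetric] tau_eq[symmetric] by blast

abbreviation "E \<equiv> ES_algebra K H A \<rho>"
abbreviation "AA \<equiv> tensor_algebra K A (opposite A)"

lemma AA_simps:
  "carrier AA = carrier M" "add AA = add M" "\<zero>\<^bsub>AA\<^esub> = \<zero>\<^bsub>M\<^esub>" "monoid.mult AA = mulM" "\<one>\<^bsub>AA\<^esub> = oneM"
  "smult AA = smult M" "ten AA = ten M"
  by (simp_all add: tensor_algebra_def Let_def mulM_def hbil_def fun_eq_iff ten_def)

lemma E_simps:
  "carrier E = carrier C" "add E = add M" "\<zero>\<^bsub>E\<^esub> = \<zero>\<^bsub>M\<^esub>" "monoid.mult E = mulM" "\<one>\<^bsub>E\<^esub> = oneM"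
  "smult E = smult M"
  by (simp_all add: ES_algebra_def ES_carrier_eq AA_simps)

lemma carrier_coinvariants: "carrier (coinvariants K H A \<rho>) = B"
  by (simp add: coinvariants_def)

lemma E_tensor:
  "tensor B E (\<lambda>h b. ES_target K A b \<otimes>\<^bsub>E\<^esub> h) E (\<lambda>b h. ES_source K A b \<otimes>\<^bsub>E\<^esub> h) = CC"
  by (rule tensor_cong)
    (auto simp: E_simps C_simps ES_target_def ES_source_def act_M_mulM C_closed act_left_def)

lemma AA_tensor:
  "tensor B AA (\<lambda>h b. ES_target K A b \<otimes>\<^bsub>AA\<^esub> h) AA (\<lambda>b h. ES_source K A b \<otimes>\<^bsub>AA\<^esub> h) = QT"
  by (rule tensor_cong)
    (auto simp: AA_simps ES_target_def ES_source_def act_M_mulM act_left_def)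

abbreviation "EE \<equiv> bimodule_tensor (coinvariants K H A \<rho>) E (ES_source K A) (ES_target K A)"
abbreviation "QQ \<equiv> bimodule_tensor (coinvariants K H A \<rho>) AA (ES_source K A) (ES_target K A)"

lemma EE_simps: "carrier EE = carrier CC" "ten EE = ten CC" "tensor_lift EE = tensor_lift CC"
  unfolding bimodule_tensor_def carrier_coinvariants
  by (rule trans[OF tensor_module_simps(1) arg_cong[OF E_tensor, of carrier]],
      rule trans[OF tensor_module_simps(4) arg_cong[OF E_tensor, of ten]],
      rule ext, rule trans[OF tensor_lift_tensor_module], unfold E_tensor, rule refl)

lemma QQ_simps: "ten QQ = ten QT" "tensor_lift QQ = tensor_lift QT"
  unfolding bimodule_tensor_def carrier_coinvariants
  by (rule trans[OF tensor_module_simps(4) arg_cong[OF AA_tensor, of ten]],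
      rule ext, rule trans[OF tensor_lift_tensor_module], unfold AA_tensor, rule refl)

lemma ES_coproduct_eq: "ES_coproduct K H A \<rho> X = coprod_C X"
  unfolding ES_coproduct_def Let_def coprod_C_def coprod_formula_def iota_def tau_eq[symmetric] EE_simps QQ_simps AA_simps(7) ..

lemma flip_eq: "flip K A = flip_M"
  by (simp add: flip_def flip_M_def Let_def)

lemma flip_antipode: "is_antipode K (ES_bialgebroid K H A \<rho>) (flip K A)"
  unfolding is_antipode_def Let_def ES_bialgebroid_def bialgebroid.simps flip_eq EE_simps E_simps ES_coproduct_eq
    carrier_coinvariants
proof (intro conjI ballI)
  show "bij_betw flip_M (carrier C) (carrier C)" by (rule flip_M_bij)
  show "flip_M \<in> algebra_hom K E (opposite E)"
    using flip_M_C C_closed klin_add[OF flip_M_klin] klin_smult[OF flip_M_klin]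
    by (auto simp: algebra_hom_def linear_map_def ring_hom_def E_simps flip_M_mult flip_M_ten A.one_H)
  show "flip_M (ES_target K A b) = ES_source K A b" if "b \<in> B" for b
    using that by (simp add: ES_target_def ES_source_def flip_M_ten A.one_H)
  fix h assume h: "h \<in> carrier C"
  show "tensor_lift CC (\<lambda>h1 h2. tensor_lift CC (\<lambda>x y. ten CC (mulM x h2) y) (coprod_C (flip_M h1))) (coprod_C h) = ten CC oneM (flip_M h)"
    by (rule antipode1[OF h])
  interpret CC: tensor_data B C act_M C act_left by (rule CC_data)
  \<comment> \<open>The inverse of the flip agrees with the flip on the coinvariants, so the
    replacement inside the lift goes through \<open>lift_cong\<close>.\<close>
  have "tensor_lift CC (\<lambda>h1 h2. tensor_lift CC (\<lambda>x y. ten CC x (mulM y h1)) (coprod_C (the_inv_into (carrier C) flip_M h2))) (coprod_C h)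
      = tensor_lift CC (\<lambda>h1 h2. tensor_lift CC (\<lambda>x y. ten CC x (mulM y h1)) (coprod_C (flip_M h2))) (coprod_C h)"
    by (rule CC.lift_cong[OF coprod_C_closed[OF h] CC.T_group])
      (simp_all add: flip_M_inv flip_M_C coprod_C_closed antipode2_closed)
  then show "tensor_lift CC (\<lambda>h1 h2. tensor_lift CC (\<lambda>x y. ten CC x (mulM y h1)) (coprod_C (the_inv_into (carrier C) flip_M h2))) (coprod_C h)
      = ten CC (the_inv_into (carrier C) flip_M h) oneM"
    using antipode2[OF h] by (simp add: flip_M_inv h)
qed

end

theorem corollary3p3:
  fixes K :: "'k ring"
    and H :: "('k, 'h) module" and \<Delta> :: "'h \<Rightarrow> ('h, 'h) tensor"
    and \<epsilon> :: "'h \<Rightarrow> 'k" and S :: "'h \<Rightarrow> 'h"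
    and A :: "('k, 'a) module" and \<rho> :: "'a \<Rightarrow> ('a, 'h) tensor"
  assumes "field K"
    and "hopf_algebra K H \<Delta> \<epsilon> S"
    and "bij_betw S (carrier H) (carrier H)"
    and "principal_comodule_algebra K H \<Delta> \<epsilon> A \<rho>"
    and "\<forall>x \<in> carrier H. \<forall>y \<in> carrier H. x \<otimes>\<^bsub>H\<^esub> y = y \<otimes>\<^bsub>H\<^esub> x"
  shows "is_antipode K (ES_bialgebroid K H A \<rho>) (flip K A)"
proof -
  let ?AH = "tensor_algebra K A H"
  have H: "K_algebra K H" and D: "\<Delta> \<in> algebra_hom K H (tensor_algebra K H H)" and e: "\<epsilon> \<in> ring_hom H K"
    and es: "\<forall>k \<in> carrier K. \<forall>h \<in> carrier H. \<epsilon> (k \<odot>\<^bsub>H\<^esub> h) = k \<otimes>\<^bsub>K\<^esub> \<epsilon> h"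
    using assms(2) by (simp_all add: hopf_algebra_def Let_def)
  have ca: "comodule_algebra K H \<Delta> \<epsilon> A \<rho>" and hg: "hopf_galois K H A \<rho>"
    and ff: "faithfully_flat_left TYPE(('a + 'h) list set) (coinvariants K H A \<rho>) A (monoid.mult A)"
    using assms(4) by (simp_all add: principal_comodule_algebra_def)
  have A: "K_algebra K A" and r: "\<rho> \<in> algebra_hom K A ?AH"
    using ca by (simp_all add: comodule_algebra_def Let_def)
  \<comment> \<open>\<open>tensor_algebra\<close> alters only the product and unit of
    \<open>tensor_K\<close>, so linearity into either is the same condition.\<close>
  have rk: "klin K A (tensor_K K A H) \<rho>" and Dk: "klin K H (tensor_K K H H) \<Delta>"
    using r D unfolding algebra_hom_def linear_map_klin
    by (auto simp: klin_def additive_def tensor_algebra_def Let_def linear_map_def)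
  have "ES K H A \<rho> (canonical_map K H A \<rho>) (tensor_B K H A \<rho>) (translation_map K H A \<rho>) \<Delta> \<epsilon>"
  proof
    show "K_algebra K H" by (rule H)
    show "K_algebra K A" by (rule A)
    show "klin K A (tensor_K K A H) \<rho>" by (rule rk)
    show "klin K H (tensor_K K H H) \<Delta>" by (rule Dk)
    show "\<rho> (a \<otimes>\<^bsub>A\<^esub> a') = hbil K H A (monoid.mult A) (\<rho> a) (\<rho> a')"
      if "a \<in> carrier A" "a' \<in> carrier A" for a a'
      using r that by (simp add: algebra_hom_def ring_hom_def tensor_algebra_def Let_def hbil_def)
    show "\<rho> \<one>\<^bsub>A\<^esub> = ten (tensor_K K A H) \<one>\<^bsub>A\<^esub> \<one>\<^bsub>H\<^esub>"
      using r by (simp add: algebra_hom_def ring_hom_def tensor_algebra_def Let_def)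
    show "canonical_map K H A \<rho> = tensor_lift (tensor_K K A H) (\<lambda>a a'. tensor_lift (tensor_K K A H)
        (\<lambda>a0' a1'. ten (tensor_K K A H) (a \<otimes>\<^bsub>A\<^esub> a0') a1') (\<rho> a'))"
      by (simp add: canonical_map_def Let_def)
    show "tensor_B K H A \<rho> = tensor_module {a \<in> carrier A. \<rho> a = ten (tensor_K K A H) a \<one>\<^bsub>H\<^esub>}
        A (monoid.mult A) A (monoid.mult A)"
      by (simp add: tensor_B_def coinvariants_def)
    show "translation_map K H A \<rho> h = the_inv_into (carrier (tensor_B K H A \<rho>)) (canonical_map K H A \<rho>)
        (ten (tensor_K K A H) \<one>\<^bsub>A\<^esub> h)" for h
      by (simp add: translation_map_def)
    show "bij_betw (canonical_map K H A \<rho>) (carrier (tensor_B K H A \<rho>)) (carrier (tensor_K K A H))"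
      using hg by (simp add: hopf_galois_def)
    show "faithfully_flat_left TYPE(('a + 'h) list set)
        (A\<lparr>carrier := {a \<in> carrier A. \<rho> a = ten (tensor_K K A H) a \<one>\<^bsub>H\<^esub>}\<rparr>) A (monoid.mult A)"
      using ff by (simp add: coinvariants_def)
  qed (use assms(5) e es ca in \<open>auto simp: ring_hom_def comodule_algebra_def Let_def\<close>)
  then show ?thesis by (rule ES.flip_antipode)
qed

end
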